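(* The ideal $\mathfrak I_n$ of all quasi-identities of $M_n$ is finitely generated as a T-ideal of $\mathcal C\langle X\rangle$, by elements each of which depends on at most $2n^2$ of the variables $x_k$ (and their coordinates $x^{(k)}_{ij}$).
   Context: $F$ is a field of characteristic $0$, $n\ge1$, $M_n=M_n(F)$, $\mathcal C=F[x^{(k)}_{ij}:1\le i,j\le n,\ k\ge1]$, $X=\{x_1,x_2,\dots\}$ noncommuting; $\mathcal C\langle X\rangle$ is the free $\mathcal C$-algebra (quasi-polynomials). A quasi-identity of $M_n$ vanishes when each $x_k$ is replaced by any $A_k=(a^{(k)}_{ij})\in M_n$ and each $x^{(k)}_{ij}$ by $a^{(k)}_{ij}$; $\mathfrak I_n$ is the set of quasi-identities. With generic matrices $\xi_k=(x^{(k)}_{ij})\in M_n(\mathcal C)$ and $\Phi:\mathcal C\langle X\rangle\to M_n(\mathcal C)$ the $\mathcal C$-algebra map with $x_k\mapsto\xi_k$, a T-ideal is an ideal closed under all simultaneous substitutions $x_k\mapsto H_k$, $x^{(k)}_{ij}\mapsto\Phi(H_k)_{ij}$ ($H_k\in\mathcal C\langle X\rangle$); the T-ideal generated by a set is the smallest T-ideal containing it. *)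

theory Defs
  imports "HOL-Analysis.Analysis" "HOL-Library.Poly_Mapping" "HOL-Library.Product_Plus"
begin

text \<open>Words in the noncommuting variables x_0, x_1, ... ; the free monoid under
concatenation (written additively so that Poly_Mapping's convolution product applies).\<close>
datatype word = Word (unword: "nat list")

instantiation word :: monoid_add
begin
definition zero_word :: word where "zero_word = Word []"
definition plus_word :: "word \<Rightarrow> word \<Rightarrow> word" where
  "plus_word u v = Word (unword u @ unword v)"
instance by standard (auto simp: zero_word_def plus_word_def)
end

text \<open>Commutative monomials in the variables x^{(k)}_{ij}, with k :: nat and
i, j ranging over the finite index type 'n (so n = CARD('n)).\<close>
type_synonym 'n cmon = "(nat \<times> 'n \<times> 'n) \<Rightarrow>\<^sub>0 nat"

text \<open>The coefficient ring C = F[x^{(k)}_{ij}] and the quasi-polynomial algebra C<X>,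
the latter with F-basis (commutative monomial) * (word).\<close>
type_synonym ('a, 'n) cpoly = "'n cmon \<Rightarrow>\<^sub>0 'a"
type_synonym ('a, 'n) qpoly = "('n cmon \<times> word) \<Rightarrow>\<^sub>0 'a"

definition wprod :: "(nat \<Rightarrow> 'r::comm_ring_1^'n::finite^'n) \<Rightarrow> word \<Rightarrow> 'r^'n^'n" where
  "wprod A w = foldr (\<lambda>k M. A k ** M) (unword w) (mat 1)"

definition mon_eval :: "(nat \<Rightarrow> 'r::comm_ring_1^'n::finite^'n) \<Rightarrow> 'n cmon \<Rightarrow> 'r" where
  "mon_eval A m = (\<Prod>v\<in>Poly_Mapping.keys m. (A (fst v) $ fst (snd v) $ snd (snd v)) ^ Poly_Mapping.lookup m v)"

definition geval :: "('a::field \<Rightarrow> 'r::comm_ring_1) \<Rightarrow> (nat \<Rightarrow> 'r^'n::finite^'n)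
    \<Rightarrow> ('a, 'n) qpoly \<Rightarrow> 'r^'n^'n" where
  "geval phi A p = (\<chi> i j. \<Sum>mw\<in>Poly_Mapping.keys p.
      phi (Poly_Mapping.lookup p mw) * mon_eval A (fst mw) * (wprod A (snd mw) $ i $ j))"

definition generic :: "nat \<Rightarrow> ('a::field, 'n::finite) cpoly^'n^'n" where
  "generic k = (\<chi> i j. Poly_Mapping.single (Poly_Mapping.single (k, i, j) 1) 1)"

definition Phi :: "('a::field, 'n::finite) qpoly \<Rightarrow> ('a, 'n) cpoly^'n^'n" where
  "Phi p = geval (\<lambda>c. Poly_Mapping.single 0 c) generic p"

definition cembed :: "('a::field, 'n::finite) cpoly \<Rightarrow> ('a, 'n) qpoly" where
  "cembed c = (\<Sum>m\<in>Poly_Mapping.keys c. Poly_Mapping.single (m, 0) (Poly_Mapping.lookup c m))"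

definition qsubst :: "(nat \<Rightarrow> ('a::field, 'n::finite) qpoly) \<Rightarrow> ('a, 'n) qpoly \<Rightarrow> ('a, 'n) qpoly" where
  "qsubst H p = (\<Sum>(m, w)\<in>Poly_Mapping.keys p.
      Poly_Mapping.single 0 (Poly_Mapping.lookup p (m, w))
      * cembed (mon_eval (\<lambda>k. Phi (H k)) m)
      * foldr (\<lambda>k q. H k * q) (unword w) 1)"

definition is_ideal :: "('a::field, 'n::finite) qpoly set \<Rightarrow> bool" where
  "is_ideal I \<longleftrightarrow> 0 \<in> I \<and> (\<forall>a\<in>I. \<forall>b\<in>I. a + b \<in> I) \<and> (\<forall>a\<in>I. \<forall>r. r * a \<in> I \<and> a * r \<in> I)"

definition T_ideal :: "('a::field, 'n::finite) qpoly set \<Rightarrow> bool" where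
  "T_ideal I \<longleftrightarrow> is_ideal I \<and> (\<forall>H. \<forall>p\<in>I. qsubst H p \<in> I)"

definition T_gen :: "('a::field, 'n::finite) qpoly set \<Rightarrow> ('a, 'n) qpoly set" where
  "T_gen S = \<Inter>{I. T_ideal I \<and> S \<subseteq> I}"

definition quasi_ids :: "('a::field, 'n::finite) qpoly set" where
  "quasi_ids = {p. \<forall>A :: nat \<Rightarrow> 'a^'n^'n. geval id A p = 0}"

definition qvars :: "('a::field, 'n::finite) qpoly \<Rightarrow> nat set" where
  "qvars p = {k. \<exists>mw\<in>Poly_Mapping.keys p. k \<in> set (unword (snd mw)) \<or> (\<exists>i j. (k, i, j) \<in> Poly_Mapping.keys (fst mw))}"

end

theory Submission
  imports Defs
begin

text \<open>
  Write \<open>m = n\<^sup>2\<close>. The proof has three ingredients.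

  (i) A symmetric group argument. A function on the permutations of a finite set that is annihilated by
  all symmetrizers of colourings with \<open>k\<close> colours is a combination of alternators of \<open>k + 1\<close> points,
  as one sees by cancelling lexicographically largest terms along decreasing subsequences. For
  \<open>k = n\<close> it shows that every polynomial without coefficients that alternates in more than \<open>m\<close>
  letters is a consequence of the Cayley--Hamilton polynomial. For \<open>k = 2 m\<close> and rational coefficients it shows by
  duality that a multilinear quasi-identity is a combination of alternating and of symmetrized ones.
  In an alternating one with more than \<open>2 m\<close> alternating variables either more than \<open>m\<close> of them occur
  as coordinates, which forces it to vanish, or more than \<open>m\<close> of them occur in the word;
  a symmetrized one is the polarisation of a quasi-identity in \<open>2 m\<close> variables.

  (ii) Euler's identity reduces arbitrary quasi-identities to multilinear ones.

  (iii) By the Nagata--Higman theorem, the Cayley--Hamilton polynomial reduces every word to a combination of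
  words of length less than \<open>2\<^sup>n - 1\<close> with coefficients in the coordinates. Hence the quasi-identities in
  \<open>2 m\<close> variables are controlled by a submodule of a free module of finite rank over a polynomial ring in finitely
  many variables, which is finitely generated.
\<close>

hide_const (open) Finite_Cartesian_Product.transpose

text \<open>A direct Noetherian argument is impossible, because neither the number of variables nor
  the length of words is bounded. Multilinear quasi-identities supply the first bound and the
  Cayley-Hamilton polynomial the second; both are congruences modulo the T-ideal of that polynomial,
  so it has to be among the generators. Behind the symmetric group argument stands the block
  decomposition of the rational group algebra: alternators of \<open>k + 1\<close> points generate
  the blocks of Young diagrams with more than \<open>k\<close> rows, symmetrizers of
  \<open>k\<close> colours those with at most \<open>k\<close> rows. The lexicographic order on
  permutations replaces this theory. For \<open>k = n\<close> an explicit combination is rewritten;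
  for \<open>k = 2 * n^2\<close> only membership is wanted, and it is tested by linear functionals.
  That test rests on sums of squares, hence on an ordered field. The ground field may admit no
  order, so the functionals are linear over the rationals only.\<close>

abbreviation "single \<equiv> Poly_Mapping.single"
abbreviation "keys \<equiv> Poly_Mapping.keys"
abbreviation "lookup \<equiv> Poly_Mapping.lookup"

section \<open>Divisible subgroups and extraction of coefficients\<close>

text \<open>The auxiliary sets of the Nagata-Higman argument need not be ideals, and the ring there
  carries no field of scalars. Cancellation of positive integers is therefore made a property of the
  subgroup.\<close>

definition divisible_subgroup :: "'r::ring_1 set \<Rightarrow> bool" where
  "divisible_subgroup N \<longleftrightarrow> 0 \<in> N \<and> (\<forall>x\<in>N. \<forall>y\<in>N. x - y \<in> N) \<and>
     (\<forall>k::nat. \<forall>x. k > 0 \<longrightarrow> of_nat k * x \<in> N \<longrightarrow> x \<in> N)"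

lemma divisible_subgroup_zero: "divisible_subgroup N \<Longrightarrow> 0 \<in> N"
  and divisible_subgroup_diff: "divisible_subgroup N \<Longrightarrow> x \<in> N \<Longrightarrow> y \<in> N \<Longrightarrow> x - y \<in> N"
  and divisible_subgroup_cancel: "divisible_subgroup N \<Longrightarrow> k > 0 \<Longrightarrow> of_nat k * x \<in> N \<Longrightarrow> x \<in> N"
  unfolding divisible_subgroup_def by blast+

lemma divisible_subgroup_uminus: "divisible_subgroup N \<Longrightarrow> x \<in> N \<Longrightarrow> - x \<in> N"
  using divisible_subgroup_diff[of N 0 x] divisible_subgroup_zero[of N] by simp

lemma divisible_subgroup_add: "divisible_subgroup N \<Longrightarrow> x \<in> N \<Longrightarrow> y \<in> N \<Longrightarrow> x + y \<in> N"
  using divisible_subgroup_diff[of N x "- y"] divisible_subgroup_uminus[of N y] by simp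

lemma divisible_subgroup_of_nat: "divisible_subgroup N \<Longrightarrow> x \<in> N \<Longrightarrow> of_nat k * x \<in> N"
  by (induction k) (auto simp: distrib_right divisible_subgroup_zero divisible_subgroup_add)

lemma divisible_subgroup_sum:
  "divisible_subgroup N \<Longrightarrow> (\<And>i. i \<in> A \<Longrightarrow> f i \<in> N) \<Longrightarrow> sum f A \<in> N"
  by (induction A rule: infinite_finite_induct)
    (auto simp: divisible_subgroup_zero divisible_subgroup_add)

text \<open>Passing from \<open>g(t)\<close> to \<open>2\<^sup>D g(t) - g(2t)\<close> kills the top coefficient and
multiplies the others by nonzero integers.\<close>

lemma polynomial_coefficients_mem:
  fixes v :: "nat \<Rightarrow> 'r::ring_1"
  assumes N: "divisible_subgroup N"
    and "\<And>t::nat. t > 0 \<Longrightarrow> (\<Sum>e\<le>D. of_nat (t ^ e) * v e) \<in> N"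
    and "e \<le> D"
  shows "v e \<in> N"
  using assms(2,3)
proof (induction D arbitrary: v e)
  case 0
  from "0.prems"(1)[of 1] "0.prems"(2) show ?case by simp
next
  case (Suc D)
  have low: "v e \<in> N" if "e \<le> D" for e
  proof -
    define u where "u e = of_nat (2 ^ Suc D - 2 ^ e) * v e" for e
    have "(\<Sum>e\<le>D. of_nat (t ^ e) * u e) \<in> N" if t: "t > 0" for t :: nat
    proof -
      let ?g = "\<lambda>t::nat. \<Sum>e\<le>Suc D. of_nat (t ^ e) * v e"
      have "of_nat (2 ^ Suc D) * ?g t - ?g (2 * t) \<in> N"
        using Suc.prems(1)[of t] Suc.prems(1)[of "2 * t"] t
        by (intro divisible_subgroup_diff[OF N] divisible_subgroup_of_nat[OF N]) auto
      moreover have "of_nat (2 ^ Suc D) * ?g t - ?g (2 * t)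
          = (\<Sum>e\<le>Suc D. of_nat (2 ^ Suc D * t ^ e) * v e - of_nat ((2 * t) ^ e) * v e)"
        by (simp add: sum_distrib_left sum_subtractf mult.assoc del: sum.atMost_Suc)
      moreover have "\<dots> = (\<Sum>e\<le>Suc D. of_nat (t ^ e) * u e)"
      proof (rule sum.cong[OF refl])
        fix e assume "e \<in> {..Suc D}"
        then have le: "(2::nat) ^ e \<le> 2 ^ Suc D"
          by (intro power_increasing) auto
        have "of_nat (2 ^ Suc D * t ^ e) * v e - of_nat ((2 * t) ^ e) * v e
            = of_nat (2 ^ Suc D * t ^ e - 2 ^ e * t ^ e) * v e"
          using le by (subst of_nat_diff) (auto simp: algebra_simps power_mult_distrib)
        also have "2 ^ Suc D * t ^ e - 2 ^ e * t ^ e = t ^ e * (2 ^ Suc D - 2 ^ e)"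
          by (simp add: diff_mult_distrib algebra_simps)
        finally show "of_nat (2 ^ Suc D * t ^ e) * v e - of_nat ((2 * t) ^ e) * v e
            = of_nat (t ^ e) * u e"
          by (simp add: u_def mult.assoc del: power_Suc)
      qed
      moreover have "\<dots> = (\<Sum>e\<le>D. of_nat (t ^ e) * u e)"
        by (simp add: u_def)
      ultimately show ?thesis by simp
    qed
    from Suc.IH[OF this \<open>e \<le> D\<close>] have "of_nat (2 ^ Suc D - 2 ^ e) * v e \<in> N"
      by (simp add: u_def)
    moreover have "(2::nat) ^ e < 2 ^ Suc D"
      using that by (intro power_strict_increasing) auto
    ultimately show ?thesis
      using divisible_subgroup_cancel[OF N, of "2 ^ Suc D - 2 ^ e" "v e"] by auto
  qed
  show ?case
  proof (cases "e \<le> D")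
    case True then show ?thesis by (rule low)
  next
    case False
    then have e: "e = Suc D" using Suc.prems by simp
    have "(\<Sum>e\<le>Suc D. v e) \<in> N" using Suc.prems(1)[of 1] by simp
    moreover have "(\<Sum>e\<le>D. v e) \<in> N" using low by (intro divisible_subgroup_sum[OF N]) auto
    ultimately have "(\<Sum>e\<le>Suc D. v e) - (\<Sum>e\<le>D. v e) \<in> N"
      by (rule divisible_subgroup_diff[OF N])
    then show ?thesis using e by simp
  qed
qed

section \<open>Cancellation in alternating sums\<close>

lemma sum_permutations_right:
  assumes "q permutes S"
  shows "(\<Sum>p | p permutes S. f (p \<circ> q)) = (\<Sum>p | p permutes S. f p)"
  using sum_permutations_compose_right[OF assms, of f] by (simp add: o_def)

lemma sign_transpose_comp:
  assumes "finite S" "p permutes S" "x \<noteq> y"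
  shows "sign (transpose x y \<circ> p) = - sign p" "sign (p \<circ> transpose x y) = - sign p"
proof -
  have "permutation p" using assms permutation_permutes by blast
  then show "sign (transpose x y \<circ> p) = - sign p" "sign (p \<circ> transpose x y) = - sign p"
    using assms(3) by (simp_all add: sign_compose permutation_swap_id sign_swap_id)
qed

text \<open>Each \<open>p\<close> cancels against \<open>transpose x y \<circ> p\<close>, which has
  the opposite sign. The sum is split by parity because \<open>'v\<close> may have characteristic
  two, where being equal to its own negative does not make a sum vanish.\<close>

lemma alternating_sum_vanishes_left:
  fixes h :: "('x \<Rightarrow> 'x) \<Rightarrow> 'v::ring_1"
  assumes S: "finite S" "x \<in> S" "y \<in> S" "x \<noteq> y"
    and inv: "\<And>p. p permutes S \<Longrightarrow> h (transpose x y \<circ> p) = h p"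
  shows "(\<Sum>p | p permutes S. of_int (sign p) * h p) = 0"
proof -
  let ?E = "{p. p permutes S \<and> sign p = 1}" and ?O = "{p. p permutes S \<and> sign p = -1}"
  let ?t = "\<lambda>p. transpose x y \<circ> p"
  have fin: "finite {p. p permutes S}" by (rule finite_permutations[OF S(1)])
  have tt: "?t (?t p) = p" for p :: "'x \<Rightarrow> 'x" by (simp add: fun_eq_iff)
  have tp: "?t p permutes S" if "p permutes S" for p
    using that permutes_swap_id[OF S(2,3)] by (rule permutes_compose)
  have sgn: "sign p = 1 \<or> sign p = -1" for p :: "'x \<Rightarrow> 'x"
    by (cases p rule: sign_cases) auto
  have eq: "{p. p permutes S} = ?E \<union> ?O" using sgn by blast
  have "(\<Sum>p | p permutes S. of_int (sign p) * h p)
      = (\<Sum>p\<in>?E. of_int (sign p) * h p) + (\<Sum>p\<in>?O. of_int (sign p) * h p)"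
    unfolding eq by (rule sum.union_disjoint) (use fin in auto)
  also have "(\<Sum>p\<in>?O. of_int (sign p) * h p) = (\<Sum>p\<in>?E. - (of_int (sign p) * h p))"
    by (rule sum.reindex_bij_witness[where i = ?t and j = ?t])
      (use S in \<open>auto simp: tt tp sign_transpose_comp inv\<close>)
  finally show ?thesis by (simp add: sum_negf)
qed

text \<open>Inversion keeps signs and turns composition on the right into composition on the
  left.\<close>

lemma alternating_sum_vanishes_right:
  fixes h :: "('x \<Rightarrow> 'x) \<Rightarrow> 'v::ring_1"
  assumes S: "finite S" "x \<in> S" "y \<in> S" "x \<noteq> y"
    and inv: "\<And>p. p permutes S \<Longrightarrow> h (p \<circ> transpose x y) = h p"
  shows "(\<Sum>p | p permutes S. of_int (sign p) * h p) = 0"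
proof -
  have "(\<Sum>p | p permutes S. of_int (sign p) * h p)
      = (\<Sum>p | p permutes S. of_int (sign (Hilbert_Choice.inv p)) * h (Hilbert_Choice.inv p))"
    by (rule sum_permutations_inverse)
  also have "\<dots> = (\<Sum>p | p permutes S. of_int (sign p) * h (Hilbert_Choice.inv p))"
    using S(1) by (intro sum.cong) (auto simp: sign_inverse permutes_imp_permutation)
  also have "\<dots> = 0"
  proof (rule alternating_sum_vanishes_left[OF S])
    fix p assume p: "p permutes S"
    have "Hilbert_Choice.inv (transpose x y \<circ> p) = Hilbert_Choice.inv p \<circ> transpose x y"
      using permutes_bij[OF p] by (simp add: o_inv_distrib)
    then show "h (Hilbert_Choice.inv (transpose x y \<circ> p)) = h (Hilbert_Choice.inv p)"
      using inv[OF permutes_inv[OF p]] by simp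
  qed
  finally show ?thesis .
qed

section \<open>Vanishing combinations of permutations\<close>

text \<open>A permutation is read as a number in base \<open>d\<close> whose earlier positions are
  more significant. Lexicographic comparison becomes comparison of natural numbers, on which an
  induction can run.\<close>

definition lex_rank :: "nat \<Rightarrow> nat set \<Rightarrow> (nat \<Rightarrow> nat) \<Rightarrow> nat" where
  "lex_rank d P \<sigma> = (\<Sum>i\<in>P. \<sigma> i * d ^ (d - i))"

lemma digit_sum_less:
  fixes B :: nat
  assumes "B > 0"
  shows "(\<Sum>e<k. (B - 1) * B ^ e) < B ^ k"
proof (induction k)
  case (Suc k)
  have "(\<Sum>e<Suc k. (B - 1) * B ^ e) < B ^ k + (B - 1) * B ^ k"
    using Suc by simp
  also have "\<dots> = B ^ Suc k" using assms by (cases B) (auto simp: algebra_simps)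
  finally show ?case .
qed simp

text \<open>By \<open>digit_sum_less\<close>, all digits behind position \<open>i\<close> together
  weigh less than one unit of the digit at \<open>i\<close>.\<close>

lemma lex_rank_less:
  assumes P: "P \<subseteq> {..<d}" and i: "i \<in> P"
    and agree: "\<And>j. j \<in> P \<Longrightarrow> j < i \<Longrightarrow> \<sigma> j = \<pi> j" and less: "\<sigma> i < \<pi> i"
    and bnd: "\<And>j. j \<in> P \<Longrightarrow> \<sigma> j < d"
  shows "lex_rank d P \<sigma> < lex_rank d P \<pi>"
proof -
  have fin: "finite P" using P finite_subset by blast
  have d: "d > 0" "i < d" using P i by auto
  let ?L = "{j\<in>P. j < i}" and ?U = "{j\<in>P. i < j}"
  have split: "lex_rank d P \<rho> = (\<Sum>j\<in>?L. \<rho> j * d ^ (d - j)) + \<rho> i * d ^ (d - i)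
      + (\<Sum>j\<in>?U. \<rho> j * d ^ (d - j))" for \<rho>
  proof -
    have "P = (?L \<union> {i}) \<union> ?U" using i by auto
    then have "lex_rank d P \<rho> = (\<Sum>j\<in>(?L \<union> {i}) \<union> ?U. \<rho> j * d ^ (d - j))"
      unfolding lex_rank_def by simp
    also have "\<dots> = (\<Sum>j\<in>?L \<union> {i}. \<rho> j * d ^ (d - j)) + (\<Sum>j\<in>?U. \<rho> j * d ^ (d - j))"
      using fin by (intro sum.union_disjoint) auto
    also have "(\<Sum>j\<in>?L \<union> {i}. \<rho> j * d ^ (d - j)) = (\<Sum>j\<in>?L. \<rho> j * d ^ (d - j)) + \<rho> i * d ^ (d - i)"
      using fin by (subst sum.union_disjoint) auto
    finally show ?thesis .
  qed
  have "(\<Sum>j\<in>?U. \<sigma> j * d ^ (d - j)) \<le> (\<Sum>j\<in>?U. (d - 1) * d ^ (d - j))"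
  proof (rule sum_mono)
    fix j assume "j \<in> ?U"
    then have "\<sigma> j \<le> d - 1" using bnd[of j] by auto
    then show "\<sigma> j * d ^ (d - j) \<le> (d - 1) * d ^ (d - j)" by simp
  qed
  also have "\<dots> = (\<Sum>e\<in>(\<lambda>j. d - j) ` ?U. (d - 1) * d ^ e)"
    using P by (subst sum.reindex) (auto simp: inj_on_def)
  also have "\<dots> \<le> (\<Sum>e<d - i. (d - 1) * d ^ e)"
    using d by (intro sum_mono2) auto
  also have "\<dots> < d ^ (d - i)" by (rule digit_sum_less[OF d(1)])
  finally have "\<sigma> i * d ^ (d - i) + (\<Sum>j\<in>?U. \<sigma> j * d ^ (d - j)) < (\<sigma> i + 1) * d ^ (d - i)"
    by (simp add: algebra_simps)
  also have "\<dots> \<le> \<pi> i * d ^ (d - i)" using less by (intro mult_right_mono) auto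
  finally have "\<sigma> i * d ^ (d - i) + (\<Sum>j\<in>?U. \<sigma> j * d ^ (d - j)) < \<pi> i * d ^ (d - i)" .
  moreover have "(\<Sum>j\<in>?L. \<sigma> j * d ^ (d - j)) = (\<Sum>j\<in>?L. \<pi> j * d ^ (d - j))"
    using agree by (intro sum.cong) auto
  ultimately show ?thesis unfolding split[of \<sigma>] split[of \<pi>] by linarith
qed

text \<open>The colour of a position is the length of the longest decreasing subsequence ending there.\<close>

lemma decreasing_subsequence_or_colouring:
  fixes \<sigma> :: "nat \<Rightarrow> nat"
  assumes fin: "finite P" and inj: "inj_on \<sigma> P"
  obtains (decreasing) X where "X \<subseteq> P" "card X = Suc k"
      "\<And>i j. i \<in> X \<Longrightarrow> j \<in> X \<Longrightarrow> i < j \<Longrightarrow> \<sigma> j < \<sigma> i"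
  | (colouring) f :: "nat \<Rightarrow> nat" where "f ` P \<subseteq> {..<k}"
      "\<And>i j. i \<in> P \<Longrightarrow> j \<in> P \<Longrightarrow> i < j \<Longrightarrow> f i = f j \<Longrightarrow> \<sigma> i < \<sigma> j"
proof -
  define D where "D Y \<longleftrightarrow> Y \<subseteq> P \<and> (\<forall>i\<in>Y. \<forall>j\<in>Y. i < j \<longrightarrow> \<sigma> j < \<sigma> i)" for Y
  define E where "E i = {Y. D Y \<and> i \<in> Y \<and> (\<forall>j\<in>Y. j \<le> i)}" for i
  \<comment> \<open>The maximum counts the end point itself and is at least one on \<open>P\<close>.
    Subtracting one puts the colours into \<open>{..<k}\<close> as soon as no decreasing sequence
    has more than \<open>k\<close> points.\<close>
  define f where "f i = Max (card ` E i) - 1" for i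
  have finE: "finite (E i)" for i
    by (rule finite_subset[of _ "Pow P"]) (auto simp: E_def D_def fin)
  have single: "{i} \<in> E i" if "i \<in> P" for i using that by (auto simp: E_def D_def)
  have witness: "\<exists>Y\<in>E i. card Y = Suc (f i)" if "i \<in> P" for i
  proof -
    have "Max (card ` E i) \<in> card ` E i"
      using finE single[OF that] by (intro Max_in) auto
    then obtain Y where Y: "Y \<in> E i" "card Y = Max (card ` E i)" by auto
    have "finite Y" "i \<in> Y" using Y(1) fin finite_subset by (auto simp: E_def D_def)
    then have "card Y > 0" using card_gt_0_iff by blast
    then show ?thesis using Y by (intro bexI[of _ Y]) (auto simp: f_def)
  qed
  have bound: "card Y \<le> Suc (f i)" if "Y \<in> E i" for Y i
  proof -
    have "card Y \<le> Max (card ` E i)" using that finE by (intro Max_ge) auto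
    then show ?thesis by (simp add: f_def)
  qed
  show thesis
  proof (cases "\<exists>i\<in>P. f i \<ge> k")
    case True
    then obtain i Y where "D Y" "card Y \<ge> Suc k" using witness by (fastforce simp: E_def)
    then obtain X where "X \<subseteq> Y" "card X = Suc k"
      using obtain_subset_with_card_n by metis
    then show thesis using \<open>D Y\<close> by (intro decreasing[of X]) (auto simp: D_def)
  next
    case False
    show thesis
    proof (rule colouring[of f])
      show "f ` P \<subseteq> {..<k}" using False by force
      fix i j assume ij: "i \<in> P" "j \<in> P" "i < j" "f i = f j"
      show "\<sigma> i < \<sigma> j"
      proof (rule ccontr)
        assume "\<not> \<sigma> i < \<sigma> j"
        moreover have "\<sigma> i \<noteq> \<sigma> j" using inj ij by (auto simp: inj_on_def)
        ultimately have gt: "\<sigma> j < \<sigma> i" by simp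
        \<comment> \<open>The point \<open>j\<close> extends a longest decreasing sequence ending at
          \<open>i\<close>, so its colour would exceed that of \<open>i\<close>.\<close>
        obtain Y where Y: "Y \<in> E i" "card Y = Suc (f i)" using witness[OF ij(1)] by blast
        have le: "\<sigma> i \<le> \<sigma> y" if "y \<in> Y" for y
          using that Y(1) by (cases "y = i") (fastforce simp: E_def D_def)+
        have Y': "Y \<subseteq> P" "\<And>y. y \<in> Y \<Longrightarrow> y \<le> i" "\<And>y z. y \<in> Y \<Longrightarrow> z \<in> Y \<Longrightarrow> y < z \<Longrightarrow> \<sigma> z < \<sigma> y"
          using Y(1) by (auto simp: E_def D_def)
        have "\<sigma> z < \<sigma> y" if "y \<in> insert j Y" "z \<in> insert j Y" "y < z" for y z
        proof (cases "z = j")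
          case True
          then have "y \<in> Y" using that by auto
          then show ?thesis using le gt True by (meson order.strict_trans2)
        next
          case False
          then have "z \<in> Y" using that by auto
          then have "y \<noteq> j" using Y'(2)[of z] ij(3) that(3) by auto
          then show ?thesis using Y'(3) that \<open>z \<in> Y\<close> by auto
        qed
        moreover have "y \<le> j" if "y \<in> insert j Y" for y using that Y'(2)[of y] ij(3) by auto
        ultimately have "insert j Y \<in> E j"
          unfolding E_def D_def using Y'(1) ij(2) by blast
        moreover have "j \<notin> Y" using Y(1) ij(3) by (auto simp: E_def)
        moreover have "finite Y" using Y(1) fin finite_subset by (auto simp: E_def D_def)
        ultimately show False using bound[of "insert j Y" j] Y(2) ij(4) by simp
      qed
    qed
  qed
qed

text \<open>The condition is two-sided: an alternator multiplied by a permutation on the right is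
  again a translated alternator, on another set \<open>X\<close>.\<close>

definition alternators_in :: "nat set \<Rightarrow> nat \<Rightarrow> ((nat \<Rightarrow> nat) \<Rightarrow> 'v::ring_1) \<Rightarrow> 'v set \<Rightarrow> bool" where
  "alternators_in P k G I \<longleftrightarrow> (\<forall>X g. X \<subseteq> P \<longrightarrow> card X = Suc k \<longrightarrow> g permutes P \<longrightarrow>
     (\<Sum>\<tau> | \<tau> permutes X. of_int (sign \<tau>) * G (g \<circ> \<tau>)) \<in> I)"

text \<open>The permutations \<open>\<tau>\<close> form the Young subgroup of the colouring
  \<open>f\<close>. Colours may stay empty, so \<open>k\<close> only bounds the number of
  classes.\<close>

definition symmetrizers_in :: "nat set \<Rightarrow> nat \<Rightarrow> ((nat \<Rightarrow> nat) \<Rightarrow> 'v::ring_1) \<Rightarrow> 'v set \<Rightarrow> bool" where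
  "symmetrizers_in P k G I \<longleftrightarrow> (\<forall>(f :: nat \<Rightarrow> nat) g. f ` P \<subseteq> {..<k} \<longrightarrow> g permutes P \<longrightarrow>
     (\<Sum>\<tau> | \<tau> permutes P \<and> (\<forall>x\<in>P. f (\<tau> x) = f x). G (g \<circ> \<tau>)) \<in> I)"

text \<open>With \<open>k\<close> colours on \<open>k + 1\<close> points, some \<open>x\<close> and
  \<open>y\<close> have the same colour. Their transposition lies in both subgroups: it reverses the
  sign of the alternator and preserves the symmetrizer.\<close>

lemma symmetrizer_of_alternator:
  fixes f :: "nat \<Rightarrow> nat"
  assumes P: "finite P" and X: "X \<subseteq> P" "card X = Suc k" and f: "f ` P \<subseteq> {..<k}"
    and \<sigma>: "\<sigma> permutes P" and \<rho>: "\<rho> permutes P"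
  defines "e \<equiv> \<lambda>\<pi>. \<Sum>\<tau> | \<tau> permutes X. of_int (sign \<tau>) * (if \<pi> = \<sigma> \<circ> \<tau> then 1 else (0::'v::ring_1))"
  shows "(\<Sum>\<tau> | \<tau> permutes P \<and> (\<forall>x\<in>P. f (\<tau> x) = f x). e (\<rho> \<circ> \<tau>)) = 0"
proof -
  let ?Y = "{\<tau>. \<tau> permutes P \<and> (\<forall>x\<in>P. f (\<tau> x) = f x)}"
  have finX: "finite X" using P X finite_subset by blast
  have "card (f ` X) \<le> k" using X(1) f by (metis card_lessThan card_mono finite_lessThan image_mono order_trans)
  then have "\<not> inj_on f X" using X(2) card_image by fastforce
  then obtain x y where xy: "x \<in> X" "y \<in> X" "x \<noteq> y" "f x = f y" by (auto simp: inj_on_def)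
  let ?t = "transpose x y"
  have t: "?t permutes X" "?t permutes P" using xy X(1) permutes_swap_id by (auto intro: permutes_swap_id)
  have ft: "f (?t z) = f z" for z using xy(4) by (auto simp: Transposition.transpose_def)
  have finY: "finite ?Y" using finite_permutations[OF P] by (rule finite_subset[rotated]) auto
  have "(\<Sum>\<tau>\<in>?Y. e (\<rho> \<circ> \<tau>))
      = (\<Sum>\<tau>' | \<tau>' permutes X. of_int (sign \<tau>') * (\<Sum>\<tau>\<in>?Y. if \<rho> \<circ> \<tau> = \<sigma> \<circ> \<tau>' then 1 else 0))"
    unfolding e_def by (subst sum.swap) (simp add: sum_distrib_left)
  also have "\<dots> = 0"
  proof (rule alternating_sum_vanishes_right[OF finX xy(1-3)])
    fix p :: "nat \<Rightarrow> nat" assume "p permutes X"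
    have tt: "h \<circ> ?t \<circ> ?t = h" for h :: "nat \<Rightarrow> nat" by (simp add: fun_eq_iff)
    show "(\<Sum>\<tau>\<in>?Y. if \<rho> \<circ> \<tau> = \<sigma> \<circ> (p \<circ> ?t) then 1 else (0::'v)) = (\<Sum>\<tau>\<in>?Y. if \<rho> \<circ> \<tau> = \<sigma> \<circ> p then 1 else 0)"
    proof (rule sum.reindex_bij_witness[where i = "\<lambda>\<tau>. \<tau> \<circ> ?t" and j = "\<lambda>\<tau>. \<tau> \<circ> ?t"])
      fix \<tau> assume a: "\<tau> \<in> ?Y"
      show "\<tau> \<circ> ?t \<in> ?Y"
        using a t(2) ft by (auto simp: permutes_in_image intro!: permutes_compose)
      show "\<tau> \<circ> ?t \<circ> ?t = \<tau>" by (rule tt)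
      have "\<rho> \<circ> (\<tau> \<circ> ?t) = \<sigma> \<circ> p \<longleftrightarrow> \<rho> \<circ> \<tau> = \<sigma> \<circ> (p \<circ> ?t)"
      proof
        assume "\<rho> \<circ> (\<tau> \<circ> ?t) = \<sigma> \<circ> p"
        then have "\<rho> \<circ> (\<tau> \<circ> ?t) \<circ> ?t = \<sigma> \<circ> p \<circ> ?t" by (rule arg_cong)
        then show "\<rho> \<circ> \<tau> = \<sigma> \<circ> (p \<circ> ?t)" by (simp only: comp_assoc transpose_comp_involutory comp_id)
      next
        assume "\<rho> \<circ> \<tau> = \<sigma> \<circ> (p \<circ> ?t)"
        then have "\<rho> \<circ> \<tau> \<circ> ?t = \<sigma> \<circ> (p \<circ> ?t) \<circ> ?t" by (rule arg_cong)
        then show "\<rho> \<circ> (\<tau> \<circ> ?t) = \<sigma> \<circ> p" by (simp only: comp_assoc transpose_comp_involutory comp_id)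
      qed
      then show "(if \<rho> \<circ> (\<tau> \<circ> ?t) = \<sigma> \<circ> p then 1 else (0::'v)) = (if \<rho> \<circ> \<tau> = \<sigma> \<circ> (p \<circ> ?t) then 1 else 0)"
        by simp
    qed (use t(2) ft in \<open>auto simp: permutes_in_image tt intro!: permutes_compose\<close>)
  qed
  finally show ?thesis .
qed

text \<open>All smaller points are fixed and therefore already taken as values, so the least moved
  point can only go up. It is the first position at which \<open>\<sigma>\<close> and
  \<open>\<sigma> \<circ> \<tau>\<close> differ.\<close>

lemma moved_least:
  fixes \<tau> :: "nat \<Rightarrow> nat"
  assumes "\<tau> permutes P" "finite P" "\<tau> \<noteq> id"
  obtains i where "i \<in> P" "\<And>j. j < i \<Longrightarrow> \<tau> j = j" "i < \<tau> i"
proof -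
  define i where "i = (LEAST i. \<tau> i \<noteq> i)"
  have ex: "\<exists>i. \<tau> i \<noteq> i" using assms(3) by (auto simp: fun_eq_iff)
  have i: "\<tau> i \<noteq> i" unfolding i_def using ex by (metis (mono_tags, lifting) LeastI_ex)
  have below: "\<tau> j = j" if "j < i" for j using that not_less_Least unfolding i_def by blast
  have "\<not> \<tau> i < i"
  proof
    assume "\<tau> i < i"
    then have "\<tau> (\<tau> i) = \<tau> i" by (rule below)
    then show False using i permutes_inj[OF assms(1)] by (auto simp: inj_def)
  qed
  with i have "i < \<tau> i" by simp
  moreover have "i \<in> P" using i assms(1) by (metis permutes_not_in)
  ultimately show thesis using below that by blast
qed

text \<open>The lexicographically largest permutation in the support of \<open>a\<close> cannot admit a colouring
with increasing colour classes, so it has a long decreasing subsequence and can be replaced by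
smaller permutations.\<close>

theorem symmetrizer_free_combination_in_alternators:
  fixes a G :: "(nat \<Rightarrow> nat) \<Rightarrow> 'v::ring_1"
  assumes P: "finite P"
    and I: "0 \<in> I" "\<And>x y. x \<in> I \<Longrightarrow> y \<in> I \<Longrightarrow> x + y \<in> I" "\<And>r x. x \<in> I \<Longrightarrow> r * x \<in> I"
    and G: "alternators_in P k G I" and a: "symmetrizers_in P k a {0}"
  shows "(\<Sum>\<pi> | \<pi> permutes P. a \<pi> * G \<pi>) \<in> I"
proof -
  obtain d where d: "P \<subseteq> {..<d}"
    using P finite_nat_iff_bounded by blast
  let ?S = "{\<pi>. \<pi> permutes P}"
  have finS: "finite ?S" by (rule finite_permutations[OF P])
  have Isum: "sum h A \<in> I" if "\<And>i. i \<in> A \<Longrightarrow> h i \<in> I" for h :: "(nat \<Rightarrow> nat) \<Rightarrow> 'v" and A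
    using that by (induction A rule: infinite_finite_induct) (auto intro: I)
  have bnd: "\<pi> j < d" if "\<pi> permutes P" "j \<in> P" for \<pi> j
    using that d permutes_in_image by fastforce
  define rk where "rk = lex_rank d P"
  have "(\<Sum>\<pi>\<in>?S. a \<pi> * G \<pi>) \<in> I"
    if "symmetrizers_in P k a {0}" "\<And>\<pi>. \<pi> permutes P \<Longrightarrow> a \<pi> \<noteq> 0 \<Longrightarrow> rk \<pi> < L" for L a
    using that
  proof (induction L arbitrary: a)
    case 0
    then have "(\<Sum>\<pi>\<in>?S. a \<pi> * G \<pi>) = 0" by (intro sum.neutral) force
    then show ?case using I(1) by simp
  next
    case (Suc L)
    define T where "T = {\<sigma>\<in>?S. a \<sigma> \<noteq> 0 \<and> rk \<sigma> = L}"
    have finT: "finite T" using finS by (auto simp: T_def)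
    have bad: "\<exists>X\<subseteq>P. card X = Suc k \<and> (\<forall>i\<in>X. \<forall>j\<in>X. i < j \<longrightarrow> \<sigma> j < \<sigma> i)" if "\<sigma> \<in> T" for \<sigma>
    proof -
      have \<sigma>: "\<sigma> permutes P" "a \<sigma> \<noteq> 0" "rk \<sigma> = L" using that by (auto simp: T_def)
      show ?thesis
      proof (cases rule: decreasing_subsequence_or_colouring[OF P permutes_inj_on[OF \<sigma>(1)], where k = k])
        case (1 X)
        then show ?thesis by blast
      next
        case (2 f)
        let ?Y = "{\<tau>. \<tau> permutes P \<and> (\<forall>x\<in>P. f (\<tau> x) = f x)}"
        have finY: "finite ?Y" using finS by (rule finite_subset[rotated]) auto
        \<comment> \<open>As \<open>\<sigma>\<close> increases on every colour class, each
          nontrivial \<open>\<tau>\<close> raises the rank above \<open>L\<close>, where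
          \<open>a\<close> vanishes. The symmetrizer shrinks to the term \<open>a \<sigma>\<close>,
          which contradicts \<open>\<sigma> \<in> T\<close>.\<close>
        have "0 = (\<Sum>\<tau>\<in>?Y. a (\<sigma> \<circ> \<tau>))"
          using Suc.prems(1) 2(1) \<sigma>(1) by (auto simp: symmetrizers_in_def)
        also have "\<dots> = (\<Sum>\<tau>\<in>{id}. a (\<sigma> \<circ> \<tau>))"
        proof (rule sum.mono_neutral_right[OF finY])
          show "{id} \<subseteq> ?Y" by auto
          show "\<forall>\<tau>\<in>?Y - {id}. a (\<sigma> \<circ> \<tau>) = 0"
          proof
            fix \<tau> assume \<tau>: "\<tau> \<in> ?Y - {id}"
            then obtain i where i: "i \<in> P" "\<And>j. j < i \<Longrightarrow> \<tau> j = j" "i < \<tau> i"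
              using moved_least[OF _ P, of \<tau>] by auto
            have "\<sigma> i < \<sigma> (\<tau> i)"
              using 2(2)[of i "\<tau> i"] i \<tau> by (auto simp: permutes_in_image)
            then have "rk \<sigma> < rk (\<sigma> \<circ> \<tau>)"
              unfolding rk_def using i bnd[OF \<sigma>(1)] by (intro lex_rank_less[OF d i(1)]) auto
            moreover have "\<sigma> \<circ> \<tau> permutes P" using \<tau> \<sigma>(1) by (auto intro: permutes_compose)
            ultimately show "a (\<sigma> \<circ> \<tau>) = 0" using Suc.prems(2)[of "\<sigma> \<circ> \<tau>"] \<sigma>(3)
              by (metis leD less_Suc_eq_le)
          qed
        qed
        finally show ?thesis using \<sigma>(2) by simp
      qed
    qed
    then have "\<forall>\<sigma>\<in>T. \<exists>X. X \<subseteq> P \<and> card X = Suc k \<and> (\<forall>i\<in>X. \<forall>j\<in>X. i < j \<longrightarrow> \<sigma> j < \<sigma> i)" by blast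
    from bchoice[OF this] obtain X where
      "\<forall>\<sigma>\<in>T. X \<sigma> \<subseteq> P \<and> card (X \<sigma>) = Suc k \<and> (\<forall>i\<in>X \<sigma>. \<forall>j\<in>X \<sigma>. i < j \<longrightarrow> \<sigma> j < \<sigma> i)" ..
    then have
      X: "\<And>\<sigma>. \<sigma> \<in> T \<Longrightarrow> X \<sigma> \<subseteq> P" "\<And>\<sigma>. \<sigma> \<in> T \<Longrightarrow> card (X \<sigma>) = Suc k"
        "\<And>\<sigma> i j. \<sigma> \<in> T \<Longrightarrow> i \<in> X \<sigma> \<Longrightarrow> j \<in> X \<sigma> \<Longrightarrow> i < j \<Longrightarrow> \<sigma> j < \<sigma> i" by blast+
    have finX: "finite (X \<sigma>)" if "\<sigma> \<in> T" for \<sigma> using X(1)[OF that] P finite_subset by blast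
    \<comment> \<open>\<open>e \<sigma>\<close> is the alternator on the decreasing set
      \<open>X \<sigma>\<close>, translated by \<open>\<sigma>\<close>: its leading term is
      \<open>\<sigma>\<close> with coefficient one, and all other terms have smaller rank.
      Subtracting multiples of it empties rank \<open>L\<close> and keeps every symmetrizer
      zero.\<close>
    define e :: "(nat \<Rightarrow> nat) \<Rightarrow> (nat \<Rightarrow> nat) \<Rightarrow> 'v" where
      "e \<sigma> \<pi> = (\<Sum>\<tau> | \<tau> permutes X \<sigma>. of_int (sign \<tau>) * (if \<pi> = \<sigma> \<circ> \<tau> then 1 else 0))" for \<sigma> \<pi>
    define a' where "a' \<pi> = a \<pi> - (\<Sum>\<sigma>\<in>T. a \<sigma> * e \<sigma> \<pi>)" for \<pi>
    have small: "rk (\<sigma> \<circ> \<tau>) < L" if \<sigma>: "\<sigma> \<in> T" and \<tau>: "\<tau> permutes X \<sigma>" "\<tau> \<noteq> id" for \<sigma> \<tau>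
    proof -
      obtain i where i: "i \<in> X \<sigma>" "\<And>j. j < i \<Longrightarrow> \<tau> j = j" "i < \<tau> i"
        using moved_least[OF \<tau>(1) finX[OF \<sigma>] \<tau>(2)] by auto
      have s: "\<sigma> permutes P" "rk \<sigma> = L" using \<sigma> by (auto simp: T_def)
      have "\<tau> permutes P" using \<tau>(1) X(1)[OF \<sigma>] by (rule permutes_subset)
      then have "\<sigma> \<circ> \<tau> permutes P" using s(1) by (rule permutes_compose)
      moreover have "\<sigma> (\<tau> i) < \<sigma> i"
        using X(3)[OF \<sigma> i(1) _ i(3)] i(1) permutes_in_image[OF \<tau>(1)] by auto
      ultimately have "rk (\<sigma> \<circ> \<tau>) < rk \<sigma>"
        unfolding rk_def using i X(1)[OF \<sigma>] bnd[of "\<sigma> \<circ> \<tau>"] by (intro lex_rank_less[OF d, of i]) auto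
      then show ?thesis using s by simp
    qed
    have e_other: "e \<sigma> \<pi> = 0" if "\<sigma> \<in> T" "rk \<pi> \<ge> L" "\<pi> \<noteq> \<sigma>" for \<sigma> \<pi>
      unfolding e_def
    proof (rule sum.neutral, rule ballI)
      fix \<tau> assume "\<tau> \<in> {\<tau>. \<tau> permutes X \<sigma>}"
      then have "\<pi> \<noteq> \<sigma> \<circ> \<tau>" using small[OF that(1), of \<tau>] that(2,3) by (cases "\<tau> = id") auto
      then show "of_int (sign \<tau>) * (if \<pi> = \<sigma> \<circ> \<tau> then 1 else 0) = (0::'v)" by simp
    qed
    have e_self: "e \<sigma> \<sigma> = 1" if "\<sigma> \<in> T" for \<sigma>
    proof -
      have "\<sigma> = \<sigma> \<circ> \<tau> \<longleftrightarrow> \<tau> = id" for \<tau>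
      proof -
        have "inj \<sigma>" using that permutes_inj by (auto simp: T_def)
        then show ?thesis by (auto simp: fun_eq_iff inj_eq)
      qed
      then have "e \<sigma> \<sigma> = (\<Sum>\<tau> | \<tau> permutes X \<sigma>. if \<tau> = id then 1 else 0)"
        unfolding e_def by (intro sum.cong) auto
      also have "\<dots> = 1" using finite_permutations[OF finX[OF that]] by (simp add: sum.delta)
      finally show ?thesis .
    qed
    have "symmetrizers_in P k a' {0}"
      unfolding symmetrizers_in_def
    proof (intro allI impI)
      fix f g :: "nat \<Rightarrow> nat" assume fg: "f ` P \<subseteq> {..<k}" "g permutes P"
      let ?Y = "{\<tau>. \<tau> permutes P \<and> (\<forall>x\<in>P. f (\<tau> x) = f x)}"
      have "(\<Sum>\<tau>\<in>?Y. a' (g \<circ> \<tau>)) = (\<Sum>\<tau>\<in>?Y. a (g \<circ> \<tau>)) - (\<Sum>\<tau>\<in>?Y. \<Sum>\<sigma>\<in>T. a \<sigma> * e \<sigma> (g \<circ> \<tau>))"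
        unfolding a'_def by (rule sum_subtractf)
      also have "(\<Sum>\<tau>\<in>?Y. a (g \<circ> \<tau>)) = 0"
        using Suc.prems(1) fg by (auto simp: symmetrizers_in_def)
      also have "(\<Sum>\<tau>\<in>?Y. \<Sum>\<sigma>\<in>T. a \<sigma> * e \<sigma> (g \<circ> \<tau>)) = (\<Sum>\<sigma>\<in>T. a \<sigma> * (\<Sum>\<tau>\<in>?Y. e \<sigma> (g \<circ> \<tau>)))"
        by (subst sum.swap) (simp add: sum_distrib_left)
      also have "\<dots> = 0"
      proof (rule sum.neutral, rule ballI)
        fix \<sigma> assume "\<sigma> \<in> T"
        then have "(\<Sum>\<tau>\<in>?Y. e \<sigma> (g \<circ> \<tau>)) = 0"
          unfolding e_def using X fg by (intro symmetrizer_of_alternator[OF P]) (auto simp: T_def)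
        then show "a \<sigma> * (\<Sum>\<tau>\<in>?Y. e \<sigma> (g \<circ> \<tau>)) = 0" by simp
      qed
      finally show "(\<Sum>\<tau>\<in>?Y. a' (g \<circ> \<tau>)) \<in> {0}"
        by (simp only: diff_zero singleton_iff)
    qed
    moreover have "rk \<pi> < L" if \<pi>: "\<pi> permutes P" "a' \<pi> \<noteq> 0" for \<pi>
    proof (rule ccontr)
      assume n: "\<not> rk \<pi> < L"
      have "(\<Sum>\<sigma>\<in>T. a \<sigma> * e \<sigma> \<pi>) = (\<Sum>\<sigma>\<in>T. if \<sigma> = \<pi> then a \<sigma> else 0)"
        using n e_other e_self by (intro sum.cong) auto
      also have "\<dots> = (if \<pi> \<in> T then a \<pi> else 0)" using finT by simp
      finally have a': "a' \<pi> = (if \<pi> \<in> T then 0 else a \<pi>)" by (simp add: a'_def)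
      with \<pi> have "a \<pi> \<noteq> 0" "\<pi> \<notin> T" by (auto split: if_splits)
      then show False using Suc.prems(2)[OF \<pi>(1)] n \<pi>(1) by (auto simp: T_def)
    qed
    ultimately have IH: "(\<Sum>\<pi>\<in>?S. a' \<pi> * G \<pi>) \<in> I" by (rule Suc.IH)
    have eG: "(\<Sum>\<pi>\<in>?S. e \<sigma> \<pi> * G \<pi>) = (\<Sum>\<tau> | \<tau> permutes X \<sigma>. of_int (sign \<tau>) * G (\<sigma> \<circ> \<tau>))"
      if \<sigma>: "\<sigma> \<in> T" for \<sigma>
    proof -
      have "(\<Sum>\<pi>\<in>?S. e \<sigma> \<pi> * G \<pi>)
          = (\<Sum>\<tau> | \<tau> permutes X \<sigma>. \<Sum>\<pi>\<in>?S. (if \<pi> = \<sigma> \<circ> \<tau> then of_int (sign \<tau>) * G \<pi> else 0))"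
        unfolding e_def sum_distrib_right by (subst sum.swap) (auto intro!: sum.cong)
      also have "\<dots> = (\<Sum>\<tau> | \<tau> permutes X \<sigma>. of_int (sign \<tau>) * G (\<sigma> \<circ> \<tau>))"
      proof (rule sum.cong[OF refl])
        fix \<tau> assume "\<tau> \<in> {\<tau>. \<tau> permutes X \<sigma>}"
        then have "\<sigma> \<circ> \<tau> \<in> ?S"
          using \<sigma> X(1)[OF \<sigma>] by (auto simp: T_def intro: permutes_compose permutes_subset)
        then show "(\<Sum>\<pi>\<in>?S. (if \<pi> = \<sigma> \<circ> \<tau> then of_int (sign \<tau>) * G \<pi> else 0)) = of_int (sign \<tau>) * G (\<sigma> \<circ> \<tau>)"
          using finS by (simp add: sum.delta)
      qed
      finally show ?thesis .
    qed
    have "(\<Sum>\<pi>\<in>?S. a \<pi> * G \<pi>) = (\<Sum>\<pi>\<in>?S. a' \<pi> * G \<pi>) + (\<Sum>\<pi>\<in>?S. \<Sum>\<sigma>\<in>T. a \<sigma> * (e \<sigma> \<pi> * G \<pi>))"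
      unfolding sum.distrib[symmetric]
      by (rule sum.cong) (auto simp: a'_def left_diff_distrib sum_distrib_right mult.assoc)
    also have "(\<Sum>\<pi>\<in>?S. \<Sum>\<sigma>\<in>T. a \<sigma> * (e \<sigma> \<pi> * G \<pi>))
        = (\<Sum>\<sigma>\<in>T. a \<sigma> * (\<Sum>\<tau> | \<tau> permutes X \<sigma>. of_int (sign \<tau>) * G (\<sigma> \<circ> \<tau>)))"
      by (subst sum.swap) (simp add: sum_distrib_left[symmetric] eG)
    finally have eq: "(\<Sum>\<pi>\<in>?S. a \<pi> * G \<pi>) = (\<Sum>\<pi>\<in>?S. a' \<pi> * G \<pi>)
        + (\<Sum>\<sigma>\<in>T. a \<sigma> * (\<Sum>\<tau> | \<tau> permutes X \<sigma>. of_int (sign \<tau>) * G (\<sigma> \<circ> \<tau>)))" .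
    have "a \<sigma> * (\<Sum>\<tau> | \<tau> permutes X \<sigma>. of_int (sign \<tau>) * G (\<sigma> \<circ> \<tau>)) \<in> I" if "\<sigma> \<in> T" for \<sigma>
      using G X(1,2)[OF that] that unfolding alternators_in_def by (intro I(3)) (simp add: T_def)
    then show ?case unfolding eq by (intro I(2)[OF IH] Isum)
  qed
  moreover have "rk \<pi> < Suc (\<Sum>\<pi>\<in>?S. rk \<pi>)" if "\<pi> permutes P" for \<pi>
    using member_le_sum[of \<pi> ?S rk] finS that by (simp add: less_Suc_eq_le)
  ultimately show ?thesis using a by blast
qed

text \<open>Duality: a rational functional vanishing on \<open>I\<close> turns \<open>G\<close> into a function that is both
alternator-free and symmetrizer-free, so the sum of its squares vanishes.\<close>

theorem mem_if_alternators_and_symmetrizers_in: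
  fixes G :: "(nat \<Rightarrow> nat) \<Rightarrow> 'v::ring_1" and scale :: "rat \<Rightarrow> 'v \<Rightarrow> 'v"
  assumes V: "vector_space scale" and P: "finite P"
    and I: "0 \<in> I" "\<And>x y. x \<in> I \<Longrightarrow> y \<in> I \<Longrightarrow> x + y \<in> I" "\<And>c x. x \<in> I \<Longrightarrow> scale c x \<in> I"
    and alt: "alternators_in P k G I" and sym: "symmetrizers_in P k G I"
    and \<pi>: "\<pi> permutes P"
  shows "G \<pi> \<in> I"
proof (rule ccontr)
  assume notin: "G \<pi> \<notin> I"
  interpret V: vector_space scale by (rule V)
  interpret Q: vector_space "(*) :: rat \<Rightarrow> rat \<Rightarrow> rat"
    by unfold_locales (auto simp: algebra_simps)
  interpret VQ: vector_space_pair scale "(*) :: rat \<Rightarrow> rat \<Rightarrow> rat" ..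
  have sub: "V.subspace I" using I by (auto simp: V.subspace_def)
  obtain B where B: "B \<subseteq> I" "V.independent B" "I \<subseteq> V.span B"
    using V.basis_exists[of I] by metis
  have "V.span B \<subseteq> I" using B(1) sub by (rule V.span_minimal)
  then have nB: "G \<pi> \<notin> V.span B" using notin by blast
  then have "V.independent (insert (G \<pi>) B)" using B(2) by (simp add: V.independent_insert)
  from VQ.linear_independent_extend[OF this, of "\<lambda>x. if x = G \<pi> then 1 else 0"]
  obtain \<phi> where \<phi>: "Vector_Spaces.linear scale (*) \<phi>"
      "\<And>x. x \<in> insert (G \<pi>) B \<Longrightarrow> \<phi> x = (if x = G \<pi> then 1 else 0)" by blast
  interpret \<phi>: Vector_Spaces.linear scale "(*)" \<phi> by (rule \<phi>(1))
  have one: "\<phi> (G \<pi>) = 1" using \<phi>(2) by simp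
  have "\<phi> x = 0" if "x \<in> B" for x
    using \<phi>(2)[of x] that nB V.span_base by auto
  then have zero: "\<phi> x = 0" if "x \<in> I" for x
    using VQ.linear_eq_0_on_span[OF \<phi>(1), of B x] B(3) that by blast
  have sgn: "\<phi> (of_int (sign \<tau>) * x) = of_int (sign \<tau>) * \<phi> x" for \<tau> :: "nat \<Rightarrow> nat" and x
    by (cases \<tau> rule: sign_cases) (auto simp: \<phi>.neg)
  define a where "a = \<phi> \<circ> G"
  have "alternators_in P k a {0}"
    unfolding alternators_in_def
  proof (intro allI impI)
    fix X g assume "X \<subseteq> P" "card X = Suc k" "g permutes P"
    then have "\<phi> (\<Sum>\<tau> | \<tau> permutes X. of_int (sign \<tau>) * G (g \<circ> \<tau>)) = 0"
      using alt by (intro zero) (auto simp: alternators_in_def)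
    then show "(\<Sum>\<tau> | \<tau> permutes X. of_int (sign \<tau>) * a (g \<circ> \<tau>)) \<in> {0}"
      by (simp add: \<phi>.sum sgn a_def)
  qed
  moreover have "symmetrizers_in P k a {0}"
    unfolding symmetrizers_in_def
  proof (intro allI impI)
    fix f g :: "nat \<Rightarrow> nat" assume "f ` P \<subseteq> {..<k}" "g permutes P"
    then have "\<phi> (\<Sum>\<tau> | \<tau> permutes P \<and> (\<forall>x\<in>P. f (\<tau> x) = f x). G (g \<circ> \<tau>)) = 0"
      using sym by (intro zero) (auto simp: symmetrizers_in_def)
    then show "(\<Sum>\<tau> | \<tau> permutes P \<and> (\<forall>x\<in>P. f (\<tau> x) = f x). a (g \<circ> \<tau>)) \<in> {0}"
      by (simp add: \<phi>.sum a_def)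
  qed
  \<comment> \<open>The preceding theorem is used with \<open>a\<close> in both roles and with the
    zero ideal of the rationals.\<close>
  ultimately have "(\<Sum>\<pi> | \<pi> permutes P. a \<pi> * a \<pi>) \<in> {0}"
    by (intro symmetrizer_free_combination_in_alternators[OF P]) auto
  then have "a \<pi> * a \<pi> = 0"
    using sum_nonneg_eq_0_iff[OF finite_permutations[OF P], of "\<lambda>\<pi>. a \<pi> * a \<pi>"] \<pi> by auto
  then show False using one by (simp add: a_def)
qed

section \<open>Evaluation and substitution as homomorphisms\<close>

lemma single_zero_pair:
  "single (0, 0) c = single (0 :: 'n cmon \<times> word) c"
  "single (0, Word []) c = single (0 :: 'n cmon \<times> word) c"
  by (simp_all add: zero_prod_def zero_word_def)

lemma keys_sum_superset:
  assumes "finite A" "keys p \<subseteq> A" "\<And>k. f k 0 = 0"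
  shows "(\<Sum>k\<in>keys p. f k (lookup p k)) = (\<Sum>k\<in>A. f k (lookup p k))"
  using assms by (intro sum.mono_neutral_left) (auto simp: in_keys_iff)

lemma keys_sum_add:
  fixes f :: "'k \<Rightarrow> 'b::comm_monoid_add \<Rightarrow> 'c::comm_monoid_add"
  assumes "\<And>k. f k 0 = 0" "\<And>k x y. f k (x + y) = f k x + f k y"
  shows "(\<Sum>k\<in>keys (p + q). f k (lookup (p + q) k))
    = (\<Sum>k\<in>keys p. f k (lookup p k)) + (\<Sum>k\<in>keys q. f k (lookup q k))"
proof -
  let ?A = "keys p \<union> keys q"
  have "(\<Sum>k\<in>keys r. f k (lookup r k)) = (\<Sum>k\<in>?A. f k (lookup r k))"
    if "keys r \<subseteq> ?A" for r
    using that assms(1) by (intro keys_sum_superset) auto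
  from this[of p] this[of q] this[of "p + q"] show ?thesis
    using Poly_Mapping.keys_add[of p q] by (simp add: lookup_add assms(2) sum.distrib)
qed

lemma poly_mapping_single_sum:
  fixes p :: "'k \<Rightarrow>\<^sub>0 'b::comm_monoid_add"
  shows "(\<Sum>k\<in>keys p. single k (lookup p k)) = p"
  by (rule poly_mapping_eqI)
    (auto simp: lookup_sum lookup_single when_def sum.delta in_keys_iff)

lemma poly_mapping_single_induct [case_names zero add]:
  fixes p :: "'k \<Rightarrow>\<^sub>0 'b::comm_monoid_add"
  assumes "P 0" "\<And>k c p. P p \<Longrightarrow> P (single k c + p)"
  shows "P p"
proof -
  have "P (\<Sum>k\<in>A. single k (lookup p k))" if "finite A" for A
    using that by induction (auto intro: assms)
  from this[OF finite_keys[of p]] show ?thesis by (simp add: poly_mapping_single_sum)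
qed

definition ring_hom :: "('a::ring_1 \<Rightarrow> 'b::ring_1) \<Rightarrow> bool" where
  "ring_hom f \<longleftrightarrow> f 1 = 1 \<and> (\<forall>x y. f (x + y) = f x + f y) \<and> (\<forall>x y. f (x * y) = f x * f y)"

lemma ring_homD:
  assumes "ring_hom f"
  shows "f 0 = 0" "f 1 = 1" "f (x + y) = f x + f y" "f (x * y) = f x * f y"
    "f (- x) = - f x" "f (x - y) = f x - f y" "f (x ^ n) = f x ^ n"
proof -
  show add: "f (x + y) = f x + f y" and "f (x * y) = f x * f y" and "f 1 = 1" for x y
    using assms by (auto simp: ring_hom_def)
  then show "f (x ^ n) = f x ^ n" by (induction n) auto
  show z: "f 0 = 0" using add[of 0 0] by simp
  show m: "f (- x) = - f x" for x using add[of x "- x"] z by (simp add: eq_neg_iff_add_eq_0 add.commute)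
  show "f (x - y) = f x - f y" using add[of x "- y"] m by simp
qed

lemma ring_hom_sum: "ring_hom f \<Longrightarrow> f (sum g A) = (\<Sum>x\<in>A. f (g x))"
  by (induction A rule: infinite_finite_induct) (auto simp: ring_homD)

lemma ring_hom_prod:
  fixes f :: "'a::comm_ring_1 \<Rightarrow> 'b::comm_ring_1"
  shows "ring_hom f \<Longrightarrow> f (prod g A) = (\<Prod>x\<in>A. f (g x))"
  by (induction A rule: infinite_finite_induct) (auto simp: ring_homD)

lemma ring_hom_prod_list: "ring_hom f \<Longrightarrow> f (prod_list xs) = prod_list (map f xs)"
  by (induction xs) (auto simp: ring_homD)

lemma ring_hom_of_int: "ring_hom f \<Longrightarrow> f (of_int k) = of_int k"
proof -
  assume f: "ring_hom f"
  have n: "f (of_nat n) = of_nat n" for n by (induction n) (auto simp: ring_homD[OF f])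
  show ?thesis by (cases k) (auto simp: n ring_homD[OF f] simp del: of_nat_Suc)
qed

lemma ring_hom_of_nat: "ring_hom f \<Longrightarrow> f (of_nat k) = of_nat k"
  using ring_hom_of_int[of f "int k"] by simp

lemma ring_hom_id: "ring_hom id" "ring_hom (\<lambda>x. x)"
  by (auto simp: ring_hom_def)

lemma ring_hom_const: "ring_hom (\<lambda>c::'a::field. single (0::'k::monoid_add) c)"
  by (auto simp: ring_hom_def single_add mult_single)

definition map_mat :: "('a \<Rightarrow> 'b) \<Rightarrow> 'a^'n^'m \<Rightarrow> 'b^'n^'m" where
  "map_mat h M = (\<chi> i j. h (M $ i $ j))"

lemma map_mat_nth [simp]: "map_mat h M $ i $ j = h (M $ i $ j)"
  by (simp add: map_mat_def)

lemma map_mat_mult: "ring_hom h \<Longrightarrow> map_mat h (M ** M') = map_mat h M ** map_mat h M'"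
  for h :: "'a::comm_ring_1 \<Rightarrow> 'b::comm_ring_1"
  by (simp add: vec_eq_iff matrix_matrix_mult_def ring_hom_sum ring_homD)

lemma map_mat_one: "ring_hom h \<Longrightarrow> map_mat h (mat 1) = mat 1"
  for h :: "'a::comm_ring_1 \<Rightarrow> 'b::comm_ring_1"
  by (simp add: vec_eq_iff mat_def ring_homD)

lemma mon_eval_superset:
  assumes "finite K" "keys m \<subseteq> K"
  shows "mon_eval A m = (\<Prod>v\<in>K. (A (fst v) $ fst (snd v) $ snd (snd v)) ^ lookup m v)"
  unfolding mon_eval_def using assms by (intro prod.mono_neutral_left) (auto simp: in_keys_iff)

lemma mon_eval_zero [simp]: "mon_eval A 0 = 1"
  by (simp add: mon_eval_def)

lemma mon_eval_add: "mon_eval A (m + m') = mon_eval A m * mon_eval A m'"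
proof -
  let ?K = "keys m \<union> keys m'"
  have *: "finite ?K" "keys m \<subseteq> ?K" "keys m' \<subseteq> ?K"
    "keys (m + m') \<subseteq> ?K" using Poly_Mapping.keys_add[of m m'] by auto
  show ?thesis
    unfolding mon_eval_superset[OF *(1,2)] mon_eval_superset[OF *(1,3)] mon_eval_superset[OF *(1,4)]
    by (simp add: lookup_add power_add prod.distrib)
qed

lemma mon_eval_single [simp]: "mon_eval A (single (k, i, j) e) = (A k $ i $ j) ^ e"
  by (cases "e = 0") (auto simp: mon_eval_def)

lemma mon_eval_hom: "ring_hom h \<Longrightarrow> h (mon_eval A m) = mon_eval (\<lambda>k. map_mat h (A k)) m"
  by (simp add: mon_eval_def ring_hom_prod ring_homD)

lemma wprod_zero [simp]: "wprod A 0 = mat 1"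
  by (simp add: wprod_def zero_word_def)

lemma wprod_Cons: "wprod A (Word (k # w)) = A k ** wprod A (Word w)"
  by (simp add: wprod_def)

lemma wprod_add: "wprod A (u + v) = wprod A u ** wprod A v"
proof -
  have "foldr (\<lambda>k M. A k ** M) us (wprod A v) = foldr (\<lambda>k M. A k ** M) us (mat 1) ** wprod A v" for us
    by (induction us) (auto simp: matrix_mul_assoc)
  then show ?thesis by (simp add: wprod_def plus_word_def)
qed

lemma wprod_hom: "ring_hom h \<Longrightarrow> map_mat h (wprod A w) = wprod (\<lambda>k. map_mat h (A k)) w"
proof (induction "unword w" arbitrary: w)
  case Nil then show ?case by (simp add: wprod_def map_mat_one)
next
  case (Cons k ks)
  then have "w = Word (k # ks)" by (metis word.collapse)
  with Cons.hyps(1)[of "Word ks"] Cons.prems show ?case by (simp add: wprod_Cons map_mat_mult)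
qed

lemma geval_zero [simp]: "geval phi A 0 = 0"
  by (simp add: geval_def vec_eq_iff)

lemma geval_single:
  assumes "ring_hom phi"
  shows "geval phi A (single (m, w) c) $ i $ j = phi c * mon_eval A m * wprod A w $ i $ j"
  using assms by (cases "c = 0") (auto simp: geval_def ring_homD)

lemma geval_add: "ring_hom phi \<Longrightarrow> geval phi A (p + q) = geval phi A p + geval phi A q"
  unfolding geval_def vec_eq_iff plus_vec_def vec_lambda_beta
  by (intro allI keys_sum_add) (simp_all add: ring_homD distrib_right)

lemma geval_sum: "ring_hom phi \<Longrightarrow> geval phi A (sum f S) = (\<Sum>x\<in>S. geval phi A (f x))"
  by (induction S rule: infinite_finite_induct) (auto simp: geval_add)

lemma matrix_mult_distribs:
  fixes A B C :: "'r::comm_ring_1^'n^'n"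
  shows "(A + B) ** C = A ** C + B ** C" "C ** (A + B) = C ** A + C ** B" "0 ** C = 0" "C ** 0 = 0"
  by (auto simp: vec_eq_iff matrix_matrix_mult_def algebra_simps sum.distrib)

lemma geval_mult: "ring_hom phi \<Longrightarrow> geval phi A (p * q) = geval phi A p ** geval phi A q"
proof (induction p rule: poly_mapping_single_induct)
  case (add k c p)
  have "geval phi A (single k c * q) = geval phi A (single k c) ** geval phi A q"
  proof (induction q rule: poly_mapping_single_induct)
    case (add l d q)
    have "geval phi A (single k c * single l d)
        = geval phi A (single k c) ** geval phi A (single l d)"
    proof (cases k; cases l)
      fix m w m' w' assume "k = (m, w)" "l = (m', w')"
      then show ?thesis using \<open>ring_hom phi\<close>
        by (simp add: mult_single vec_eq_iff geval_single matrix_matrix_mult_def mon_eval_add wprod_add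
            ring_homD sum_distrib_left sum_distrib_right algebra_simps)
    qed
    then show ?case using add \<open>ring_hom phi\<close> by (simp add: distrib_left geval_add matrix_mult_distribs)
  qed (simp add: matrix_mult_distribs)
  then show ?case using add by (simp add: distrib_right geval_add matrix_mult_distribs)
qed (simp add: matrix_mult_distribs)

lemma geval_const: "ring_hom phi \<Longrightarrow> geval phi A (single 0 c) = mat (phi c)"
  by (simp add: zero_prod_def vec_eq_iff geval_single mat_def)

lemma geval_one: "ring_hom phi \<Longrightarrow> geval phi A 1 = mat 1"
  using geval_const[of phi A 1] by (simp add: ring_homD)

lemma geval_hom:
  assumes "ring_hom phi" "ring_hom h"
  shows "map_mat h (geval phi A p) = geval (h \<circ> phi) (\<lambda>k. map_mat h (A k)) p"
  unfolding geval_def vec_eq_iff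
  using assms by (simp add: ring_hom_sum ring_homD mon_eval_hom wprod_hom[symmetric])

definition ceval :: "('a::field \<Rightarrow> 'r::comm_ring_1) \<Rightarrow> (nat \<Rightarrow> 'r^'n::finite^'n) \<Rightarrow> ('a, 'n) cpoly \<Rightarrow> 'r" where
  "ceval phi A c = (\<Sum>m\<in>keys c. phi (lookup c m) * mon_eval A m)"

lemma ceval_single: "ring_hom phi \<Longrightarrow> ceval phi A (single m c) = phi c * mon_eval A m"
  by (cases "c = 0") (auto simp: ceval_def ring_homD)

lemma ring_hom_singleI:
  fixes f :: "('k::monoid_add \<Rightarrow>\<^sub>0 'a::ring_1) \<Rightarrow> 'b::ring_1"
  assumes add: "\<And>x y. f (x + y) = f x + f y" and one: "f 1 = 1"
    and single: "\<And>k c l d. f (single k c * single l d)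
       = f (single k c) * f (single l d)"
  shows "ring_hom f"
proof -
  have z: "f 0 = 0" using add[of 0 0] by simp
  have 1: "f (single k c * q) = f (single k c) * f q" for k c q
    by (induction q rule: poly_mapping_single_induct) (auto simp: z add single distrib_left)
  have "f (p * q) = f p * f q" for p q
    by (induction p rule: poly_mapping_single_induct) (auto simp: z add 1 distrib_right)
  then show ?thesis using add one by (auto simp: ring_hom_def)
qed

lemma ring_hom_ceval: "ring_hom phi \<Longrightarrow> ring_hom (ceval phi A)"
proof (rule ring_hom_singleI)
  assume phi: "ring_hom phi"
  show "ceval phi A (x + y) = ceval phi A x + ceval phi A y" for x y
    unfolding ceval_def by (rule keys_sum_add) (auto simp: ring_homD[OF phi] algebra_simps)
  show "ceval phi A 1 = 1"
    unfolding single_one[symmetric] by (simp add: ceval_single[OF phi] ring_homD[OF phi] del: single_one)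
  show "ceval phi A (single k c * single l d)
      = ceval phi A (single k c) * ceval phi A (single l d)" for k c l d
    by (simp add: mult_single ceval_single[OF phi] ring_homD[OF phi] mon_eval_add algebra_simps)
qed

lemma cembed_single: "cembed (single m c) = single (m, 0) c"
  by (cases "c = 0") (auto simp: cembed_def)

lemma ring_hom_cembed: "ring_hom cembed"
proof (rule ring_hom_singleI)
  show "cembed (x + y) = cembed x + cembed y" for x y :: "('b, 'a) cpoly"
    unfolding cembed_def by (rule keys_sum_add) (auto simp: single_add)
  show "cembed (1 :: ('b, 'a) cpoly) = 1"
    unfolding single_one[symmetric] by (simp add: cembed_single single_zero_pair del: single_one)
qed (simp add: cembed_single mult_single)

lemma cembed_commute: "cembed c * p = p * cembed c"
proof (induction c rule: poly_mapping_single_induct)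
  case (add m a c)
  have "cembed (single m a) * p = p * cembed (single m a)"
  proof (induction p rule: poly_mapping_single_induct)
    case (add k b p)
    then show ?case
      by (cases k) (simp add: cembed_single distrib_left distrib_right mult_single add.commute mult.commute)
  qed simp
  with add show ?case by (simp add: ring_homD[OF ring_hom_cembed] distrib_left distrib_right)
qed (simp add: ring_homD[OF ring_hom_cembed])

lemma const_commute: "single 0 c * p = p * single 0 c"
  for p :: "('a::field, 'n::finite) qpoly"
  using cembed_commute[of "single 0 c" p] by (simp add: cembed_single single_zero_pair)

lemma geval_cembed: "ring_hom phi \<Longrightarrow> geval phi A (cembed c) = mat (ceval phi A c)"
proof (induction c rule: poly_mapping_single_induct)
  case zero
  show ?case by (simp add: ring_homD[OF ring_hom_cembed] vec_eq_iff mat_def ceval_def)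
next
  case (add m a c)
  have "geval phi A (cembed (single m a)) = mat (ceval phi A (single m a))"
    using add.prems by (simp add: cembed_single vec_eq_iff geval_single ceval_single mat_def)
  with add show ?case
    by (simp add: ring_homD[OF ring_hom_cembed] geval_add ring_homD[OF ring_hom_ceval] vec_eq_iff mat_def)
qed

definition var :: "nat \<Rightarrow> ('a::field, 'n::finite) qpoly" where
  "var k = single (0, Word [k]) 1"

definition wsubst :: "(nat \<Rightarrow> 'r::ring_1) \<Rightarrow> nat list \<Rightarrow> 'r" where
  "wsubst H w = prod_list (map H w)"

lemma wsubst_simps [simp]: "wsubst H [] = 1" "wsubst H (k # w) = H k * wsubst H w"
  "wsubst H (u @ v) = wsubst H u * wsubst H v"
  by (simp_all add: wsubst_def)

lemma foldr_wsubst: "foldr (\<lambda>k q. H k * q) w 1 = wsubst H w"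
  by (induction w) auto

lemma wsubst_hom: "ring_hom f \<Longrightarrow> f (wsubst H w) = wsubst (\<lambda>k. f (H k)) w"
  by (simp add: wsubst_def ring_hom_prod_list o_def)

lemma wsubst_var: "wsubst var u = single (0, Word u) 1"
  by (induction u) (simp_all add: single_zero_pair var_def mult_single plus_word_def)

lemma single_eq: "single (m, w) c = single 0 c * cembed (single m 1) * wsubst var (unword w)"
  by (simp add: wsubst_var cembed_single mult_single)

lemma qsubst_eq: "qsubst H p = (\<Sum>mw\<in>keys p. single 0 (lookup p mw)
      * cembed (mon_eval (\<lambda>k. Phi (H k)) (fst mw)) * wsubst H (unword (snd mw)))"
  unfolding qsubst_def by (simp add: foldr_wsubst case_prod_unfold)

lemma qsubst_single:
  "qsubst H (single (m, w) c)
    = single 0 c * cembed (mon_eval (\<lambda>k. Phi (H k)) m) * wsubst H (unword w)"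
  by (cases "c = 0") (auto simp: qsubst_eq)

lemma ring_hom_qsubst: "ring_hom (qsubst H)"
proof (rule ring_hom_singleI)
  show "qsubst H (x + y) = qsubst H x + qsubst H y" for x y
    unfolding qsubst_eq by (rule keys_sum_add) (auto simp: single_add algebra_simps)
  show "qsubst H 1 = 1"
    unfolding single_one[symmetric] zero_prod_def
    by (simp add: qsubst_single ring_homD[OF ring_hom_cembed] zero_word_def del: single_one) (simp add: single_zero_pair)
  fix k l :: "'a cmon \<times> word" and c d :: 'b
  obtain m w m' w' where kl: "k = (m, w)" "l = (m', w')" by (cases k, cases l)
  let ?C = "\<lambda>m. cembed (mon_eval (\<lambda>k. Phi (H k)) m)" and ?W = "\<lambda>w. wsubst H (unword w)"
    and ?s = "\<lambda>c. single 0 c"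
  have "qsubst H (single k c * single l d)
      = ?s c * (?s d * ?C m) * (?C m' * ?W w) * ?W w'"
    by (simp add: kl mult_single qsubst_single mon_eval_add ring_homD[OF ring_hom_cembed]
        plus_word_def mult.assoc) (simp add: mult.assoc[symmetric] mult_single)
  also have "\<dots> = ?s c * (?C m * ?s d) * (?W w * ?C m') * ?W w'"
    by (simp only: const_commute[of d "?C m"] cembed_commute[of _ "?W w"])
  also have "\<dots> = ?s c * ?C m * (?s d * ?W w) * ?C m' * ?W w'" by (simp only: mult.assoc)
  also have "\<dots> = ?s c * ?C m * (?W w * ?s d) * ?C m' * ?W w'"
    by (simp only: const_commute[of d "?W w"])
  also have "\<dots> = qsubst H (single k c) * qsubst H (single l d)"
    by (simp only: kl qsubst_single mult.assoc)
  finally show "qsubst H (single k c * single l d)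
      = qsubst H (single k c) * qsubst H (single l d)" .
qed

lemmas qsubst_simps = ring_homD[OF ring_hom_qsubst] ring_hom_sum[OF ring_hom_qsubst]
lemmas cembed_simps = ring_homD[OF ring_hom_cembed] ring_hom_sum[OF ring_hom_cembed]

lemma qsubst_cembed: "qsubst H (cembed c) = cembed (ceval (single 0) (\<lambda>k. Phi (H k)) c)"
proof (induction c rule: poly_mapping_single_induct)
  case zero
  then show ?case by (simp add: qsubst_simps cembed_simps ceval_def)
next
  case (add m a c)
  have "qsubst H (cembed (single m a)) = cembed (ceval (single 0) (\<lambda>k. Phi (H k)) (single m a))"
    by (simp add: cembed_single qsubst_single ceval_single[OF ring_hom_const] zero_word_def cembed_simps single_zero_pair mult_single)
  with add show ?case
    by (simp add: qsubst_simps cembed_simps ring_homD[OF ring_hom_ceval[OF ring_hom_const]])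
qed

lemma qsubst_const [simp]: "qsubst H (single 0 c) = single 0 c"
  using qsubst_single[of H 0 0 c] by (simp add: single_zero_pair zero_word_def cembed_simps)

lemma geval_var [simp]: "ring_hom phi \<Longrightarrow> geval phi A (var k) = A k"
  by (simp add: var_def vec_eq_iff geval_single ring_homD wprod_def)

lemma Phi_var [simp]: "Phi (var k) = generic k"
  unfolding Phi_def by (rule geval_var[OF ring_hom_const])

lemma qsubst_var [simp]: "qsubst H (var k) = H k"
  unfolding var_def by (simp add: qsubst_single cembed_simps)

lemma Phi_mult: "Phi (p * q) = Phi p ** Phi q"
  and Phi_add: "Phi (p + q) = Phi p + Phi q"
  by (simp_all add: Phi_def geval_mult[OF ring_hom_const] geval_add[OF ring_hom_const])

lemma Phi_zero [simp]: "Phi 0 = 0" by (simp add: Phi_def)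

lemma ceval_generic:
  "ring_hom phi \<Longrightarrow> map_mat (ceval phi A) (generic k) = A k"
  by (simp add: vec_eq_iff generic_def ceval_single ring_homD)

text \<open>Generic matrices are universal: every evaluation arises by specialising the entries of
  \<open>Phi p\<close>.\<close>

lemma geval_Phi:
  assumes phi: "ring_hom phi"
  shows "geval phi A p = map_mat (ceval phi A) (Phi p)"
proof -
  have "ceval phi A \<circ> single 0 = phi"
    by (simp add: fun_eq_iff ceval_single[OF phi])
  then show ?thesis
    unfolding Phi_def geval_hom[OF ring_hom_const ring_hom_ceval[OF phi]] ceval_generic[OF phi] by simp
qed

lemma geval_wsubst: "ring_hom phi \<Longrightarrow> geval phi A (wsubst H w) = wprod (\<lambda>k. geval phi A (H k)) (Word w)"
  by (induction w) (auto simp: geval_one geval_mult wprod_Cons wprod_def)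

lemma mat_mult_nth:
  fixes M :: "'r::comm_ring_1^'n^'n"
  shows "(mat c ** M) $ i $ j = c * M $ i $ j" "(M ** mat c) $ i $ j = M $ i $ j * c"
proof -
  have "(mat c ** M) $ i $ j = (\<Sum>k\<in>UNIV. if i = k then c * M $ k $ j else 0)"
    by (simp only: matrix_matrix_mult_def mat_def vec_lambda_beta) (rule sum.cong, auto)
  also have "\<dots> = c * M $ i $ j" by (subst sum.delta') auto
  finally show "(mat c ** M) $ i $ j = c * M $ i $ j" .
  have "(M ** mat c) $ i $ j = (\<Sum>k\<in>UNIV. if k = j then M $ i $ k * c else 0)"
    by (simp only: matrix_matrix_mult_def mat_def vec_lambda_beta) (rule sum.cong, auto)
  also have "\<dots> = M $ i $ j * c" by (subst sum.delta) auto
  finally show "(M ** mat c) $ i $ j = M $ i $ j * c" .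
qed

text \<open>Letters and coordinates are replaced consistently, because the coordinates receive the
  entries of \<open>Phi (H k)\<close> and these specialise to the entries of
  \<open>geval phi A (H k)\<close>. Hence quasi-identities are stable under substitution.\<close>

lemma geval_qsubst:
  assumes phi: "ring_hom phi"
  shows "geval phi A (qsubst H p) = geval phi (\<lambda>k. geval phi A (H k)) p"
proof (induction p rule: poly_mapping_single_induct)
  case zero
  then show ?case by (simp add: qsubst_simps)
next
  case (add k c p)
  obtain m w where k: "k = (m, w)" by (cases k)
  have m: "ceval phi A (mon_eval (\<lambda>k. Phi (H k)) m) = mon_eval (\<lambda>k. geval phi A (H k)) m"
    by (simp only: mon_eval_hom[OF ring_hom_ceval[OF phi]] geval_Phi[OF phi])
  have "geval phi A (qsubst H (single k c)) = geval phi (\<lambda>k. geval phi A (H k)) (single k c)"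
    unfolding k qsubst_single vec_eq_iff geval_mult[OF phi] geval_const[OF phi] geval_cembed[OF phi]
      geval_wsubst[OF phi] m matrix_mul_assoc[symmetric]
    by (simp add: mat_mult_nth geval_single[OF phi] mult.assoc)
  with add show ?case by (simp add: qsubst_simps geval_add phi)
qed

lemma Phi_qsubst: "Phi (qsubst H p) = map_mat (ceval (single 0) (\<lambda>k. Phi (H k))) (Phi p)"
  using geval_qsubst[OF ring_hom_const, of generic H p] geval_Phi[OF ring_hom_const, of "\<lambda>k. Phi (H k)" p]
  by (simp add: Phi_def)

lemma qsubst_qsubst: "qsubst H (qsubst G p) = qsubst (\<lambda>k. qsubst H (G k)) p"
proof (induction p rule: poly_mapping_single_induct)
  case zero
  then show ?case by (simp add: qsubst_simps)
next
  case (add k c p)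
  obtain m w where k: "k = (m, w)" by (cases k)
  have "qsubst H (qsubst G (single k c)) = qsubst (\<lambda>k. qsubst H (G k)) (single k c)"
    unfolding k qsubst_single
    by (simp add: qsubst_simps qsubst_cembed Phi_qsubst wsubst_hom[OF ring_hom_qsubst]
        mon_eval_hom[OF ring_hom_ceval[OF ring_hom_const]])
  with add show ?case by (simp add: qsubst_simps)
qed

lemma mon_eval_generic: "mon_eval generic m = single m 1"
proof (induction m rule: poly_mapping_single_induct)
  case (add v e m)
  obtain l i j where v: "v = (l, i, j)" by (cases v)
  have "generic l $ i $ j ^ e = (single (single v e) 1 :: ('b::field, 'a) cpoly)"
    by (induction e) (auto simp: v generic_def mult_single single_add[symmetric])
  with add show ?case by (simp add: mon_eval_add mult_single v)
qed simp

lemma qsubst_ident [simp]: "qsubst var p = p"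
proof (induction p rule: poly_mapping_single_induct)
  case zero
  then show ?case by (simp add: qsubst_simps)
next
  case (add k c p)
  obtain m w where k: "k = (m, w)" by (cases k)
  have "qsubst var (single k c) = single k c"
    unfolding k qsubst_single Phi_var mon_eval_generic by (rule single_eq[symmetric])
  with add show ?case by (simp add: qsubst_simps)
qed

section \<open>T-ideals\<close>

lemma T_idealD:
  assumes "T_ideal I"
  shows "0 \<in> I" "\<And>a b. a \<in> I \<Longrightarrow> b \<in> I \<Longrightarrow> a + b \<in> I" "\<And>a r. a \<in> I \<Longrightarrow> r * a \<in> I"
    "\<And>a r. a \<in> I \<Longrightarrow> a * r \<in> I" "\<And>H p. p \<in> I \<Longrightarrow> qsubst H p \<in> I"
    "\<And>a. a \<in> I \<Longrightarrow> - a \<in> I" "\<And>a b. a \<in> I \<Longrightarrow> b \<in> I \<Longrightarrow> a - b \<in> I"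
proof -
  show 0: "0 \<in> I" and add: "\<And>a b. a \<in> I \<Longrightarrow> b \<in> I \<Longrightarrow> a + b \<in> I" and l: "\<And>a r. a \<in> I \<Longrightarrow> r * a \<in> I"
    and "\<And>a r. a \<in> I \<Longrightarrow> a * r \<in> I" and "\<And>H p. p \<in> I \<Longrightarrow> qsubst H p \<in> I"
    using assms by (auto simp: T_ideal_def is_ideal_def)
  show u: "- a \<in> I" if "a \<in> I" for a using l[OF that, of "-1"] by simp
  show "a - b \<in> I" if "a \<in> I" "b \<in> I" for a b using add[OF that(1) u[OF that(2)]] by simp
qed

lemma T_ideal_sum: "T_ideal I \<Longrightarrow> (\<And>i. i \<in> A \<Longrightarrow> f i \<in> I) \<Longrightarrow> sum f A \<in> I"
  by (induction A rule: infinite_finite_induct) (auto simp: T_idealD)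

lemma of_nat_cancel:
  fixes x :: "('a::field_char_0, 'n::finite) qpoly"
  assumes "k > 0"
  shows "single 0 (1 / of_nat k) * (of_nat k * x) = x"
proof -
  have "single 0 (1 / of_nat k) * (of_nat k :: ('a, 'n) qpoly) = 1"
    using assms by (simp add: single_of_nat[symmetric] mult_single del: single_of_nat)
  then show ?thesis by (simp add: mult.assoc[symmetric])
qed

lemma divisible_subgroup_T_ideal:
  fixes I :: "('a::field_char_0, 'n::finite) qpoly set"
  assumes "T_ideal I"
  shows "divisible_subgroup I"
  unfolding divisible_subgroup_def
proof (intro conjI ballI allI impI)
  fix k :: nat and x :: "('a, 'n) qpoly" assume "0 < k" "of_nat k * x \<in> I"
  then show "x \<in> I" using T_idealD(3)[OF assms, of "of_nat k * x" "single 0 (1 / of_nat k)"]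
    by (simp add: of_nat_cancel)
qed (use T_idealD[OF assms] in auto)

lemma T_ideal_T_gen: "T_ideal (T_gen S)"
  unfolding T_gen_def T_ideal_def is_ideal_def by blast

lemma T_gen_superset: "S \<subseteq> T_gen S"
  unfolding T_gen_def by blast

lemma T_gen_least: "T_ideal I \<Longrightarrow> S \<subseteq> I \<Longrightarrow> T_gen S \<subseteq> I"
  unfolding T_gen_def by blast

lemma T_ideal_quasi_ids: "T_ideal quasi_ids"
  unfolding T_ideal_def is_ideal_def quasi_ids_def
  by (auto simp: geval_add geval_mult geval_qsubst ring_hom_id matrix_mult_distribs)

section \<open>Homogeneous components of T-ideals\<close>

definition restrict_keys :: "('k \<Rightarrow> bool) \<Rightarrow> ('k \<Rightarrow>\<^sub>0 'b::comm_monoid_add) \<Rightarrow> ('k \<Rightarrow>\<^sub>0 'b)" where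
  "restrict_keys Q p = (\<Sum>k\<in>{k\<in>keys p. Q k}. single k (lookup p k))"

lemma lookup_restrict_keys: "lookup (restrict_keys Q p) k = (if Q k then lookup p k else 0)"
  by (auto simp: restrict_keys_def lookup_sum lookup_single when_def sum.delta in_keys_iff)

lemma keys_restrict_keys: "keys (restrict_keys Q p) = {k\<in>keys p. Q k}"
  by (auto simp: in_keys_iff lookup_restrict_keys split: if_splits)

lemma restrict_keys_zero [simp]: "restrict_keys Q 0 = 0"
  by (simp add: restrict_keys_def)

lemma restrict_keys_add: "restrict_keys Q (p + q) = restrict_keys Q p + restrict_keys Q q"
  by (rule poly_mapping_eqI) (simp add: lookup_restrict_keys lookup_add)

lemma restrict_keys_sum: "restrict_keys Q (sum f A) = (\<Sum>i\<in>A. restrict_keys Q (f i))"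
  by (induction A rule: infinite_finite_induct) (auto simp: restrict_keys_add)

lemma restrict_keys_all: "(\<And>k. k \<in> keys p \<Longrightarrow> Q k) \<Longrightarrow> restrict_keys Q p = p"
  by (rule poly_mapping_eqI) (auto simp: lookup_restrict_keys in_keys_iff)

lemma restrict_keys_none: "(\<And>k. k \<in> keys p \<Longrightarrow> \<not> Q k) \<Longrightarrow> restrict_keys Q p = 0"
  by (rule poly_mapping_eqI) (auto simp: lookup_restrict_keys in_keys_iff)

lemma of_nat_mult_left_commute: "x * (of_nat a * y) = of_nat a * (x * y)" for x :: "'r::ring_1"
  by (simp only: mult.assoc[symmetric] mult_of_nat_commute[of a x])

lemma of_nat_collect: "s * (of_nat a * x) * (of_nat b * y) = of_nat a * of_nat b * (s * x * y)" for s :: "'r::ring_1"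
  by (simp only: of_nat_mult_left_commute[of s] of_nat_mult_left_commute[of x] mult.assoc)

text \<open>A coordinate of \<open>x_k\<close> weighs as much as the letter \<open>x_k\<close>,
  because a substitution rescales both. Constant \<open>\<omega>\<close> equal to one gives the
  total degree, an indicator function the degree in a single variable.\<close>

definition weight :: "(nat \<Rightarrow> nat) \<Rightarrow> 'n cmon \<times> word \<Rightarrow> nat" where
  "weight \<omega> mw = (\<Sum>v\<in>keys (fst mw). lookup (fst mw) v * \<omega> (fst v))
     + (\<Sum>k\<leftarrow>unword (snd mw). \<omega> k)"

lemma qsubst_scale_single:
  fixes c :: "'a::field"
  shows "qsubst (\<lambda>k. of_nat (t ^ \<omega> k) * var k) (single mw c)
    = of_nat (t ^ weight \<omega> mw) * single mw (c :: 'a::field)"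
proof (cases mw)
  case (Pair m w)
  have Ph: "Phi (of_nat a * var k) $ i $ j = of_nat a * generic k $ i $ j" for a k i j
    by (simp add: single_of_nat[symmetric] geval_const[OF ring_hom_const] Phi_def mat_mult_nth
        geval_var[OF ring_hom_const] geval_mult[OF ring_hom_const] del: single_of_nat)
  have w: "wsubst (\<lambda>k. of_nat (t ^ \<omega> k) * var k) u = of_nat (t ^ (\<Sum>k\<leftarrow>u. \<omega> k)) * (wsubst var u :: ('a, 'b) qpoly)" for u
    by (induction u) (simp_all add: power_add mult.assoc of_nat_mult_left_commute[of "var _"] del: of_nat_power)
  have m: "mon_eval (\<lambda>k. Phi (of_nat (t ^ \<omega> k) * var k)) m
      = of_nat (t ^ (\<Sum>v\<in>keys m. lookup m v * \<omega> (fst v))) * (mon_eval generic m :: ('a, 'b) cpoly)"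
    unfolding mon_eval_def Ph power_mult_distrib prod.distrib
    by (simp add: power_sum power_mult[symmetric] mult.commute)
  have cn: "cembed (of_nat n) = of_nat n" for n
    by (rule ring_hom_of_nat[OF ring_hom_cembed])
  show ?thesis
    unfolding Pair qsubst_single m w cembed_simps mon_eval_generic cn weight_def fst_conv snd_conv power_add of_nat_mult
    by (subst single_eq[of m w c]) (rule of_nat_collect)
qed

text \<open>Rescaling each \<open>x_k\<close> by \<open>t ^ \<omega> k\<close> multiplies the
  component of weight \<open>e\<close> by \<open>t ^ e\<close>. Letting \<open>t\<close> vary
  separates the components inside \<open>I\<close>.\<close>

lemma weight_component_T_ideal:
  fixes I :: "('a::field_char_0, 'n::finite) qpoly set"
  assumes I: "T_ideal I" and p: "p \<in> I"
  shows "restrict_keys (\<lambda>mw. weight \<omega> mw = e) p \<in> I"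
proof -
  define D where "D = e + (\<Sum>mw\<in>keys p. weight \<omega> mw)"
  have D: "weight \<omega> mw \<le> D" if "mw \<in> keys p" for mw
    using member_le_sum[OF that, of "weight \<omega>"] by (simp add: D_def)
  let ?v = "\<lambda>e. restrict_keys (\<lambda>mw. weight \<omega> mw = e) p"
  have "(\<Sum>e\<le>D. of_nat (t ^ e) * ?v e) \<in> I" for t
  proof -
    have "(\<Sum>e\<le>D. of_nat (t ^ e) * ?v e) = (\<Sum>e\<le>D. \<Sum>mw\<in>keys p.
        if weight \<omega> mw = e then of_nat (t ^ weight \<omega> mw) * single mw (lookup p mw) else 0)"
      by (intro sum.cong) (auto simp: restrict_keys_def sum_distrib_left sum.inter_filter intro!: sum.cong)
    also have "\<dots> = (\<Sum>mw\<in>keys p. of_nat (t ^ weight \<omega> mw) * single mw (lookup p mw))"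
      by (subst sum.swap) (use D in \<open>auto intro!: sum.cong simp: sum.delta\<close>)
    also have "\<dots> = qsubst (\<lambda>k. of_nat (t ^ \<omega> k) * var k) (\<Sum>mw\<in>keys p. single mw (lookup p mw))"
      by (simp add: qsubst_simps qsubst_scale_single del: of_nat_power)
    finally show ?thesis using T_idealD(5)[OF I p] by (simp add: poly_mapping_single_sum)
  qed
  then show ?thesis
    by (intro polynomial_coefficients_mem[OF divisible_subgroup_T_ideal[OF I], of ?v D e]) (auto simp: D_def)
qed

abbreviation degree_in :: "nat \<Rightarrow> 'n cmon \<times> word \<Rightarrow> nat" where
  "degree_in k \<equiv> weight (\<lambda>l. if l = k then 1 else 0)"

lemma multidegree_component_T_ideal:
  fixes I :: "('a::field_char_0, 'n::finite) qpoly set"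
  assumes "finite K" and I: "T_ideal I" and p: "p \<in> I"
  shows "restrict_keys (\<lambda>mw. \<forall>k\<in>K. degree_in k mw = e k) p \<in> I"
  using assms(1)
proof induction
  case empty
  then show ?case using p by (simp add: restrict_keys_all)
next
  case (insert l K)
  have "restrict_keys (\<lambda>mw. \<forall>k\<in>insert l K. degree_in k mw = e k) p
      = restrict_keys (\<lambda>mw. degree_in l mw = e l) (restrict_keys (\<lambda>mw. \<forall>k\<in>K. degree_in k mw = e k) p)"
    by (rule poly_mapping_eqI) (auto simp: lookup_restrict_keys)
  then show ?case using weight_component_T_ideal[OF I insert.IH] by simp
qed

section \<open>Cycles\<close>

text \<open>With an explicit target \<open>t\<close> for the last entry, closed cycles and segments
  cut out of them are instances of one notion.\<close>

fun chain :: "('x \<Rightarrow> 'x) \<Rightarrow> 'x list \<Rightarrow> 'x \<Rightarrow> bool" where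
  "chain \<sigma> [] t \<longleftrightarrow> True"
| "chain \<sigma> (a # l) t \<longleftrightarrow> \<sigma> a = hd (l @ [t]) \<and> chain \<sigma> l t"

definition is_cycle :: "('x \<Rightarrow> 'x) \<Rightarrow> 'x list \<Rightarrow> bool" where
  "is_cycle \<sigma> l \<longleftrightarrow> l \<noteq> [] \<and> distinct l \<and> chain \<sigma> l (hd l)"

text \<open>The start is prescribed because a trace monomial reads a word off this cycle, not merely
  a word up to rotation.\<close>

definition cycle_from :: "('x \<Rightarrow> 'x) \<Rightarrow> 'x \<Rightarrow> 'x list" where
  "cycle_from \<sigma> s = (THE l. is_cycle \<sigma> l \<and> hd l = s)"

lemma chain_append: "chain \<sigma> (l @ l') t \<longleftrightarrow> chain \<sigma> l (hd (l' @ [t])) \<and> chain \<sigma> l' t"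
proof (induction l)
  case (Cons a l)
  have "hd ((l @ l') @ [t]) = hd (l @ [hd (l' @ [t])])" by (cases l) auto
  with Cons show ?case by auto
qed auto

lemma chain_cong: "(\<And>a. a \<in> set l \<Longrightarrow> \<sigma> a = \<sigma>' a) \<Longrightarrow> chain \<sigma> l t = chain \<sigma>' l t"
  by (induction l) auto

lemma chain_image: "chain \<sigma> l t \<Longrightarrow> a \<in> set l \<Longrightarrow> \<sigma> a \<in> insert t (set l)"
proof (induction l)
  case (Cons b l)
  then show ?case by (cases l) auto
qed auto

text \<open>Each list follows the orbit of its head; the conditions on \<open>t\<close> make both
  stop at the first arrival at \<open>t\<close>.\<close>

lemma chain_unique:
  assumes "chain \<sigma> l t" "chain \<sigma> l' t" "l \<noteq> []" "l' \<noteq> []" "hd l = hd l'"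
    "t \<notin> set (tl l)" "t \<notin> set (tl l')"
  shows "l = l'"
  using assms
proof (induction l arbitrary: l')
  case (Cons a l)
  obtain m where l': "l' = a # m" using Cons.prems by (cases l') auto
  show ?case
  proof (cases l; cases m)
    fix b k b' k' assume eq: "l = b # k" "m = b' # k'"
    then have "l = m" using Cons.prems l' by (intro Cons.IH) auto
    then show ?thesis by (simp add: l')
  qed (use Cons.prems l' in auto)
qed auto

lemma cycle_from_eq:
  assumes "is_cycle \<sigma> l" "hd l = s"
  shows "cycle_from \<sigma> s = l"
  unfolding cycle_from_def
proof (rule the_equality)
  fix l' assume "is_cycle \<sigma> l' \<and> hd l' = s"
  with assms show "l' = l"
    by (intro chain_unique[of \<sigma> l' s l]) (auto simp: is_cycle_def distinct_tl hd_in_set neq_Nil_conv)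
qed (use assms in auto)

fun insert_after :: "'x \<Rightarrow> 'x \<Rightarrow> 'x list \<Rightarrow> 'x list" where
  "insert_after z y [] = []"
| "insert_after z y (a # l) = (if a = z then z # y # l else a # insert_after z y l)"

lemma insert_after_simps:
  "set (insert_after z y l) = (if z \<in> set l then insert y (set l) else set l)"
  "insert_after z y l = [] \<longleftrightarrow> l = []" "l \<noteq> [] \<Longrightarrow> hd (insert_after z y l) = hd l"
  "distinct l \<Longrightarrow> y \<notin> set l \<Longrightarrow> distinct (insert_after z y l)"
  by (induction l) auto

lemma wsubst_cong: "(\<And>a. a \<in> set l \<Longrightarrow> b a = b' a) \<Longrightarrow> wsubst b l = wsubst b' l"
  by (induction l) auto

lemma wsubst_insert_after:
  "distinct l \<Longrightarrow> y \<notin> set l \<Longrightarrow> z \<in> set l \<Longrightarrow> wsubst b (insert_after z y l) = wsubst (b(z := b z * b y)) l"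
proof (induction l)
  case (Cons a l)
  show ?case
  proof (cases "a = z")
    case True
    have "wsubst (b(z := b z * b y)) l = wsubst b l"
      using True Cons.prems by (intro wsubst_cong) auto
    then have "wsubst (b(z := b z * b y)) (a # l) = b z * b y * wsubst b l"
      by (simp only: wsubst_simps True fun_upd_same)
    moreover have "wsubst b (insert_after z y (a # l)) = b z * b y * wsubst b l"
      by (simp add: True mult.assoc)
    ultimately show ?thesis by (simp only:)
  next
    case False
    then show ?thesis using Cons by auto
  qed
qed simp

lemma chain_insert_after:
  assumes "chain \<sigma>' l t" "distinct l" "y \<notin> set l" "y \<noteq> z" "\<sigma> z = y" "\<sigma> y = \<sigma>' z"
    "\<And>x. x \<noteq> y \<Longrightarrow> x \<noteq> z \<Longrightarrow> \<sigma> x = \<sigma>' x"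
  shows "chain \<sigma> (insert_after z y l) t"
  using assms(1-3)
proof (induction l)
  case (Cons a l)
  have hd: "hd (insert_after z y l @ [t]) = hd (l @ [t])" by (cases l) auto
  show ?case
  proof (cases "a = z")
    case True
    have "chain \<sigma> l t = chain \<sigma>' l t"
    proof (rule chain_cong)
      fix x assume "x \<in> set l"
      then have "x \<noteq> y" "x \<noteq> z" using Cons.prems True by auto
      then show "\<sigma> x = \<sigma>' x" by (rule assms(7))
    qed
    then show ?thesis using Cons.prems True assms by auto
  next
    case False
    then show ?thesis using Cons assms(7)[of a] hd by auto
  qed
qed simp

text \<open>Under \<open>\<sigma> \<circ> transpose z y\<close> the point \<open>z\<close> goes
  directly to \<open>\<sigma> y\<close>, so \<open>y\<close> is skipped; reinserting it behind
  \<open>z\<close> restores the cycle of \<open>\<sigma>\<close>. This contraction drives the later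
  inductions on the set of points.\<close>

lemma is_cycle_insert_after:
  assumes "is_cycle (\<sigma> \<circ> transpose z y) l" "y \<notin> set l" "y \<noteq> z" "\<sigma> z = y"
  shows "is_cycle \<sigma> (insert_after z y l)"
proof -
  have "chain \<sigma> (insert_after z y l) (hd l)"
    using assms by (intro chain_insert_after[where \<sigma>' = "\<sigma> \<circ> transpose z y"]) (auto simp: is_cycle_def)
  then show ?thesis using assms by (auto simp: is_cycle_def insert_after_simps)
qed

lemma permutes_remove_fixed: "\<sigma> permutes P \<Longrightarrow> \<sigma> y = y \<Longrightarrow> \<sigma> permutes (P - {y})"
  by (erule permutes_superset) auto

lemma permutes_contract:
  assumes "\<sigma> permutes P" "z \<in> P" "y \<in> P" "\<sigma> z = y"
  shows "\<sigma> \<circ> transpose z y permutes (P - {y})"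
proof (rule permutes_remove_fixed)
  show "\<sigma> \<circ> transpose z y permutes P"
    using permutes_swap_id[OF assms(2,3)] assms(1) by (rule permutes_compose)
  show "(\<sigma> \<circ> transpose z y) y = y" using assms(4) by simp
qed

lemma cycle_exists:
  assumes "finite P" "\<sigma> permutes P" "s \<in> P"
  shows "\<exists>l. is_cycle \<sigma> l \<and> hd l = s \<and> set l \<subseteq> P"
  using assms
proof (induction "card P" arbitrary: P \<sigma> rule: less_induct)
  case less
  show ?case
  proof (cases "P = {s}")
    case True
    then show ?thesis using less.prems by (intro exI[of _ "[s]"]) (auto simp: is_cycle_def)
  next
    case False
    then obtain y where y: "y \<in> P" "y \<noteq> s" using less.prems by auto
    have card: "card (P - {y}) < card P" using y less.prems by (metis card_Diff1_less)
    define z where "z = inv \<sigma> y"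
    have z: "\<sigma> z = y" "z \<in> P"
      using less.prems y by (auto simp: z_def permutes_inverses permutes_in_image[OF permutes_inv])
    show ?thesis
    proof (cases "z = y")
      case True
      then have "\<sigma> permutes (P - {y})" using permutes_remove_fixed[OF less.prems(2)] z by auto
      then show ?thesis using less.hyps[OF card, of \<sigma>] y less.prems by auto
    next
      case False
      obtain l where l: "is_cycle (\<sigma> \<circ> transpose z y) l" "hd l = s" "set l \<subseteq> P - {y}"
        using less.hyps[OF card _ permutes_contract[OF less.prems(2) z(2) y(1) z(1)]] y less.prems by auto
      have "is_cycle \<sigma> (insert_after z y l)"
        using is_cycle_insert_after[OF l(1)] l(3) False z(1) by auto
      then show ?thesis using l y by (intro exI[of _ "insert_after z y l"]) (auto simp: insert_after_simps is_cycle_def)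
    qed
  qed
qed

lemma cycle_from_props:
  assumes "finite P" "\<sigma> permutes P" "s \<in> P"
  shows "is_cycle \<sigma> (cycle_from \<sigma> s)" "hd (cycle_from \<sigma> s) = s" "set (cycle_from \<sigma> s) \<subseteq> P"
    "\<And>p. p \<in> P - set (cycle_from \<sigma> s) \<Longrightarrow> \<sigma> p \<in> P - set (cycle_from \<sigma> s)"
proof -
  obtain l where l: "is_cycle \<sigma> l" "hd l = s" "set l \<subseteq> P" using cycle_exists[OF assms] by blast
  have eq: "cycle_from \<sigma> s = l" by (rule cycle_from_eq[OF l(1,2)])
  show "is_cycle \<sigma> (cycle_from \<sigma> s)" "hd (cycle_from \<sigma> s) = s" "set (cycle_from \<sigma> s) \<subseteq> P"
    using l eq by auto
  \<comment> \<open>An injective map of a finite set into itself is onto, so no point from outside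
    can enter the cycle.\<close>
  have "\<sigma> ` set l \<subseteq> set l" using l(1) chain_image[of \<sigma> l "hd l"] hd_in_set[of l] by (auto simp: is_cycle_def insert_absorb)
  then have im: "\<sigma> ` set l = set l"
    using endo_inj_surj[of "set l" \<sigma>] permutes_inj_on[OF assms(2)] by auto
  fix p assume p: "p \<in> P - set (cycle_from \<sigma> s)"
  have "\<sigma> p \<notin> set l"
  proof
    assume "\<sigma> p \<in> set l"
    then obtain q where "q \<in> set l" "\<sigma> q = \<sigma> p" using im by (metis imageE)
    then show False using p eq permutes_inj[OF assms(2)] by (auto simp: inj_def)
  qed
  then show "\<sigma> p \<in> P - set (cycle_from \<sigma> s)" using p eq assms(2) by (auto simp: permutes_in_image)
qed

lemma cycle_from_contract:
  assumes "finite P" "\<sigma> permutes P" "s \<in> P" "y \<in> P" "y \<noteq> s" "\<sigma> z = y" "z \<noteq> y"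
  shows "cycle_from \<sigma> s = insert_after z y (cycle_from (\<sigma> \<circ> transpose z y) s)"
    "y \<notin> set (cycle_from (\<sigma> \<circ> transpose z y) s)"
proof -
  have "z \<in> P" using assms by (metis permutes_in_image)
  then have p: "\<sigma> \<circ> transpose z y permutes (P - {y})" using assms permutes_contract by metis
  note c = cycle_from_props[OF _ p, of s]
  show ny: "y \<notin> set (cycle_from (\<sigma> \<circ> transpose z y) s)" using c(3) assms by auto
  have "is_cycle \<sigma> (insert_after z y (cycle_from (\<sigma> \<circ> transpose z y) s))"
    using is_cycle_insert_after[OF _ ny] c(1) assms by auto
  moreover have "hd (insert_after z y (cycle_from (\<sigma> \<circ> transpose z y) s)) = s"
    using c(1,2) assms by (auto simp: insert_after_simps is_cycle_def)
  ultimately show "cycle_from \<sigma> s = insert_after z y (cycle_from (\<sigma> \<circ> transpose z y) s)"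
    by (rule cycle_from_eq)
qed

section \<open>Traces along permutations\<close>

lemma sum_PiE_insert:
  fixes f :: "('x \<Rightarrow> 'y) \<Rightarrow> 'r::comm_monoid_add"
  assumes "x \<notin> S"
  shows "(\<Sum>\<iota>\<in>PiE (insert x S) A. f \<iota>) = (\<Sum>\<kappa>\<in>PiE S A. \<Sum>j\<in>A x. f (\<kappa>(x := j)))"
proof -
  have "(\<Sum>\<iota>\<in>PiE (insert x S) A. f \<iota>) = (\<Sum>(j, \<kappa>)\<in>A x \<times> PiE S A. f (\<kappa>(x := j)))"
    unfolding PiE_insert_eq
    by (subst sum.reindex) (use inj_combinator[OF assms, of A] in \<open>auto simp: case_prod_unfold intro!: sum.cong\<close>)
  also have "\<dots> = (\<Sum>j\<in>A x. \<Sum>\<kappa>\<in>PiE S A. f (\<kappa>(x := j)))"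
    by (simp add: sum.cartesian_product)
  also have "\<dots> = (\<Sum>\<kappa>\<in>PiE S A. \<Sum>j\<in>A x. f (\<kappa>(x := j)))"
    by (rule sum.swap)
  finally show ?thesis .
qed

text \<open>For a permutation \<open>\<sigma>\<close> of \<open>S\<close> this is the product over the cycles of \<open>\<sigma>\<close> of the traces of the
matrix products along the cycles.\<close>

definition perm_trace :: "nat set \<Rightarrow> (nat \<Rightarrow> 'r::comm_ring_1^'n::finite^'n) \<Rightarrow> (nat \<Rightarrow> nat) \<Rightarrow> 'r" where
  "perm_trace S B \<sigma> = (\<Sum>\<iota>\<in>PiE S (\<lambda>_. UNIV). \<Prod>p\<in>S. B p $ \<iota> p $ \<iota> (\<sigma> p))"

lemma perm_trace_cong:
  assumes "\<And>p. p \<in> S \<Longrightarrow> B p = B' p" "\<And>p. p \<in> S \<Longrightarrow> \<sigma> p = \<sigma>' p"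
  shows "perm_trace S B \<sigma> = perm_trace S B' \<sigma>'"
  unfolding perm_trace_def using assms by (auto intro!: sum.cong prod.cong)

lemma perm_trace_empty [simp]: "perm_trace {} B \<sigma> = 1"
  by (simp add: perm_trace_def)

lemma perm_trace_insert:
  assumes "finite S" "y \<notin> S"
  shows "perm_trace (insert y S) B \<sigma> = (\<Sum>\<kappa>\<in>PiE S (\<lambda>_. UNIV). \<Sum>j\<in>UNIV.
      B y $ j $ (\<kappa>(y := j)) (\<sigma> y) * (\<Prod>p\<in>S. B p $ \<kappa> p $ (\<kappa>(y := j)) (\<sigma> p)))"
  unfolding perm_trace_def sum_PiE_insert[OF assms(2)]
proof (intro sum.cong refl)
  fix \<kappa> :: "nat \<Rightarrow> 'b" and j
  have "(\<Prod>p\<in>S. B p $ (\<kappa>(y := j)) p $ (\<kappa>(y := j)) (\<sigma> p)) = (\<Prod>p\<in>S. B p $ \<kappa> p $ (\<kappa>(y := j)) (\<sigma> p))"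
    using assms(2) by (intro prod.cong) auto
  then show "(\<Prod>p\<in>insert y S. B p $ (\<kappa>(y := j)) p $ (\<kappa>(y := j)) (\<sigma> p))
      = B y $ j $ (\<kappa>(y := j)) (\<sigma> y) * (\<Prod>p\<in>S. B p $ \<kappa> p $ (\<kappa>(y := j)) (\<sigma> p))"
    using assms by simp
qed

lemma perm_trace_fixed:
  assumes "finite S" "y \<in> S" "\<sigma> y = y" "\<And>p. p \<in> S \<Longrightarrow> p \<noteq> y \<Longrightarrow> \<sigma> p \<noteq> y"
  shows "perm_trace S B \<sigma> = (\<Sum>j\<in>UNIV. B y $ j $ j) * perm_trace (S - {y}) B \<sigma>"
proof -
  obtain T where T: "S = insert y T" "y \<notin> T" using assms(2) by (rule mk_disjoint_insert[THEN exE]) auto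
  have fin: "finite T" using assms(1) T by simp
  have ny: "\<sigma> p \<noteq> y" if "p \<in> T" for p
  proof -
    have "p \<noteq> y" using that T by blast
    then show ?thesis using assms(4)[of p] that T by blast
  qed
  have "perm_trace S B \<sigma> = (\<Sum>\<kappa>\<in>PiE T (\<lambda>_. UNIV). \<Sum>j\<in>UNIV. B y $ j $ j * (\<Prod>p\<in>T. B p $ \<kappa> p $ \<kappa> (\<sigma> p)))"
    unfolding T(1) perm_trace_insert[OF fin T(2)]
    using assms(3) ny by (intro sum.cong refl arg_cong2[where f = "(*)"] prod.cong) auto
  also have "\<dots> = (\<Sum>j\<in>UNIV. B y $ j $ j) * perm_trace T B \<sigma>"
    unfolding perm_trace_def sum_distrib_right sum_distrib_left by (rule refl)
  finally show ?thesis using T by simp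
qed

text \<open>Only \<open>z\<close> is sent to \<open>y\<close>, so the index at \<open>y\<close>
  occurs in the factors of \<open>z\<close> and \<open>y\<close> alone. Summing over it yields the
  matrix product \<open>B z ** B y\<close>.\<close>

lemma perm_trace_contract:
  assumes "finite S" "y \<in> S" "z \<in> S" "z \<noteq> y" "\<sigma> z = y" "inj_on \<sigma> S"
  shows "perm_trace S B \<sigma> = perm_trace (S - {y}) (B(z := B z ** B y)) (\<sigma> \<circ> transpose z y)"
proof -
  define T where "T = S - {y, z}"
  have T: "S = insert y (insert z T)" "y \<notin> insert z T" "z \<notin> T" "finite T" using assms by (auto simp: T_def)
  have ny: "\<sigma> p \<noteq> y" if "p \<in> S" "p \<noteq> z" for p using assms that by (auto simp: inj_on_def)
  have "perm_trace S B \<sigma> = (\<Sum>\<kappa>\<in>PiE (insert z T) (\<lambda>_. UNIV). \<Sum>j\<in>UNIV.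
      B y $ j $ \<kappa> (\<sigma> y) * (B z $ \<kappa> z $ j * (\<Prod>p\<in>T. B p $ \<kappa> p $ \<kappa> (\<sigma> p))))"
    unfolding T(1) perm_trace_insert[OF finite.insertI[OF T(4)] T(2)] prod.insert[OF T(4,3)]
    using assms(2-5) ny T by (intro sum.cong refl arg_cong2[where f = "(*)"] prod.cong) auto
  also have "\<dots> = (\<Sum>\<kappa>\<in>PiE (insert z T) (\<lambda>_. UNIV).
      (B z ** B y) $ \<kappa> z $ \<kappa> (\<sigma> y) * (\<Prod>p\<in>T. B p $ \<kappa> p $ \<kappa> (\<sigma> p)))"
    by (simp add: matrix_matrix_mult_def sum_distrib_left sum_distrib_right mult_ac)
  also have "\<dots> = perm_trace (insert z T) (B(z := B z ** B y)) (\<sigma> \<circ> transpose z y)"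
    unfolding perm_trace_def
  proof (rule sum.cong[OF refl])
    fix \<kappa> :: "nat \<Rightarrow> 'b"
    let ?f = "\<lambda>p. (B(z := B z ** B y)) p $ \<kappa> p $ \<kappa> ((\<sigma> \<circ> transpose z y) p)"
    have "(\<Prod>p\<in>T. ?f p) = (\<Prod>p\<in>T. B p $ \<kappa> p $ \<kappa> (\<sigma> p))"
      by (rule prod.cong[OF refl]) (use T in \<open>auto simp: Transposition.transpose_def\<close>)
    then show "(B z ** B y) $ \<kappa> z $ \<kappa> (\<sigma> y) * (\<Prod>p\<in>T. B p $ \<kappa> p $ \<kappa> (\<sigma> p)) = (\<Prod>p\<in>insert z T. ?f p)"
      unfolding prod.insert[OF T(4,3)] by simp
  qed
  also have "insert z T = S - {y}" using T by auto
  finally show ?thesis .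
qed

text \<open>There are only \<open>CARD('n)\<close> index values, so two points of \<open>X\<close>
  share an index, and exchanging them as targets changes no product. This is the source of the trace
  identities below.\<close>

lemma perm_trace_alternating:
  fixes B :: "nat \<Rightarrow> 'r::comm_ring_1^'n::finite^'n"
  assumes "finite X" "card X > CARD('n)"
  shows "(\<Sum>\<tau> | \<tau> permutes X. of_int (sign \<tau>) * perm_trace X B (\<tau> \<circ> g)) = 0"
proof -
  have "(\<Sum>\<tau> | \<tau> permutes X. of_int (sign \<tau>) * perm_trace X B (\<tau> \<circ> g))
      = (\<Sum>\<iota>\<in>PiE X (\<lambda>_. UNIV). \<Sum>\<tau> | \<tau> permutes X. of_int (sign \<tau>) * (\<Prod>p\<in>X. B p $ \<iota> p $ \<iota> (\<tau> (g p))))"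
    unfolding perm_trace_def sum_distrib_left o_def by (rule sum.swap)
  also have "\<dots> = 0"
  proof (rule sum.neutral, rule ballI)
    fix \<iota> :: "nat \<Rightarrow> 'n"
    have "card (\<iota> ` X) \<le> CARD('n)" by (rule card_mono) auto
    then have "\<not> inj_on \<iota> X" using assms card_image by fastforce
    then obtain x y where xy: "x \<in> X" "y \<in> X" "x \<noteq> y" "\<iota> x = \<iota> y" by (auto simp: inj_on_def)
    have "\<iota> (transpose x y q) = \<iota> q" for q using xy(4) by (auto simp: Transposition.transpose_def)
    then show "(\<Sum>\<tau> | \<tau> permutes X. of_int (sign \<tau>) * (\<Prod>p\<in>X. B p $ \<iota> p $ \<iota> (\<tau> (g p)))) = 0"
      by (intro alternating_sum_vanishes_left[OF assms(1) xy(1-3)]) simp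
  qed
  finally show ?thesis .
qed

section \<open>Trace monomials\<close>

text \<open>The trace monomial of \<open>\<sigma>\<close>: the cycle through \<open>s\<close> contributes a word starting at \<open>s\<close>, every other
cycle contributes the trace of its generic matrix product as a coefficient.\<close>

definition trace_monomial ::
  "nat set \<Rightarrow> nat \<Rightarrow> (nat \<Rightarrow> ('a::field, 'n::finite) qpoly) \<Rightarrow> (nat \<Rightarrow> nat) \<Rightarrow> ('a, 'n) qpoly" where
  "trace_monomial P s b \<sigma> = cembed (perm_trace (P - set (cycle_from \<sigma> s)) (\<lambda>p. Phi (b p)) \<sigma>)
     * wsubst b (cycle_from \<sigma> s)"

text \<open>The two kinds of cycles allow the same contraction. On the cycle through
  \<open>s\<close> two neighbouring letters merge; on any other cycle multiplicativity of
  \<open>Phi\<close> turns the merged letter into a product of matrices.\<close>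

lemma trace_monomial_contract:
  assumes P: "finite P" "\<sigma> permutes P" "s \<in> P" and y: "y \<in> P" "y \<noteq> s" "\<sigma> z = y" "z \<noteq> y"
  shows "trace_monomial P s b \<sigma> = trace_monomial (P - {y}) s (b(z := b z * b y)) (\<sigma> \<circ> transpose z y)"
proof -
  let ?\<sigma> = "\<sigma> \<circ> transpose z y" and ?b = "b(z := b z * b y)"
  let ?l = "cycle_from ?\<sigma> s"
  have z: "z \<in> P" using P y by (metis permutes_in_image)
  have p: "?\<sigma> permutes (P - {y})" using permutes_contract[OF P(2) z y(1,3)] .
  note l = cycle_from_props[OF _ p, of s]
  have dist: "distinct ?l" using l(1) P y by (auto simp: is_cycle_def)
  have ins: "cycle_from \<sigma> s = insert_after z y ?l" and ny: "y \<notin> set ?l"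
    using cycle_from_contract[OF P y] by auto
  show ?thesis
  proof (cases "z \<in> set ?l")
    case True
    have "P - set (cycle_from \<sigma> s) = P - {y} - set ?l"
      unfolding ins insert_after_simps using True by auto
    moreover have "perm_trace (P - {y} - set ?l) (\<lambda>p. Phi (b p)) \<sigma> = perm_trace (P - {y} - set ?l) (\<lambda>p. Phi (?b p)) ?\<sigma>"
      using True by (intro perm_trace_cong) (auto simp: Transposition.transpose_def)
    ultimately show ?thesis
      unfolding trace_monomial_def ins wsubst_insert_after[OF dist ny True] by simp
  next
    case False
    have eq: "insert_after z y k = k" if "z \<notin> set k" for k using that by (induction k) auto
    have c: "cycle_from \<sigma> s = ?l" unfolding ins using eq False by blast
    have B: "(\<lambda>p. Phi (?b p)) = (\<lambda>p. Phi (b p))(z := Phi (b z) ** Phi (b y))"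
      by (auto simp: fun_eq_iff Phi_mult)
    have "perm_trace (P - set ?l) (\<lambda>p. Phi (b p)) \<sigma> = perm_trace (P - set ?l - {y}) (\<lambda>p. Phi (?b p)) ?\<sigma>"
      unfolding B using P y z ny False permutes_inj_on[OF P(2)] by (intro perm_trace_contract) auto
    moreover have "P - set ?l - {y} = P - {y} - set ?l" by auto
    moreover have "wsubst b ?l = wsubst ?b ?l" using False by (intro wsubst_cong) auto
    ultimately show ?thesis unfolding trace_monomial_def c by simp
  qed
qed

lemma trace_monomial_fixed:
  assumes P: "finite P" "\<sigma> permutes P" "s \<in> P" and y: "y \<in> P" "y \<noteq> s" "\<sigma> y = y"
  shows "trace_monomial P s b \<sigma> = cembed (\<Sum>j\<in>UNIV. Phi (b y) $ j $ j) * trace_monomial (P - {y}) s b \<sigma>"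
proof -
  have p: "\<sigma> permutes (P - {y})" using permutes_remove_fixed[OF P(2) y(3)] .
  let ?l = "cycle_from \<sigma> s"
  have ny: "y \<notin> set ?l" using cycle_from_props(3)[OF _ p, of s] P y by auto
  have "perm_trace (P - set ?l) (\<lambda>p. Phi (b p)) \<sigma>
      = (\<Sum>j\<in>UNIV. Phi (b y) $ j $ j) * perm_trace (P - set ?l - {y}) (\<lambda>p. Phi (b p)) \<sigma>"
    using P y ny permutes_inj[OF P(2)] by (intro perm_trace_fixed) (auto dest: injD[of \<sigma> _ y])
  moreover have "P - set ?l - {y} = P - {y} - set ?l" by auto
  ultimately show ?thesis by (simp add: trace_monomial_def cembed_simps mult.assoc)
qed

text \<open>The start cannot be contracted. Instead its predecessor \<open>z\<close> becomes the new
  start and takes over the letter \<open>b s\<close>, while the letter \<open>b z\<close>, the last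
  one of the word, is split off on the right.\<close>

lemma trace_monomial_move_start:
  assumes P: "finite P" "\<sigma> permutes P" "s \<in> P" and z: "\<sigma> z = s" "z \<noteq> s"
  shows "trace_monomial P s b \<sigma> = trace_monomial (P - {s}) z (b(z := b s)) (\<sigma> \<circ> transpose z s) * b z"
proof -
  let ?\<sigma> = "\<sigma> \<circ> transpose z s"
  have zP: "z \<in> P" using P z by (metis permutes_in_image)
  have p: "?\<sigma> permutes (P - {s})" using permutes_contract[OF P(2) zP P(3) z(1)] .
  note l = cycle_from_props[OF _ p, of z]
  obtain k where k: "cycle_from ?\<sigma> z = z # k"
    using l(1,2) P z zP by (cases "cycle_from ?\<sigma> z") (auto simp: is_cycle_def)
  have dist: "distinct (z # k)" and ch: "chain ?\<sigma> (z # k) z" and sub: "set (z # k) \<subseteq> P - {s}"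
    using l(1,3) P z zP unfolding k by (auto simp: is_cycle_def)
  have "chain \<sigma> k z = chain ?\<sigma> k z"
    using dist sub by (intro chain_cong) (auto simp: Transposition.transpose_def)
  moreover have hd2: "hd (k @ [z, s]) = hd (k @ [z])" by (cases k) auto
  ultimately have "chain \<sigma> (s # k @ [z]) s"
    using ch z hd2 by (auto simp: chain_append)
  moreover have "distinct (s # k @ [z])" using dist sub by auto
  ultimately have "is_cycle \<sigma> (s # k @ [z])" by (simp add: is_cycle_def)
  then have c: "cycle_from \<sigma> s = s # k @ [z]" by (rule cycle_from_eq) simp
  have "P - set (s # k @ [z]) = P - {s} - set (z # k)" by auto
  moreover have "perm_trace (P - {s} - set (z # k)) (\<lambda>p. Phi (b p)) \<sigma>
      = perm_trace (P - {s} - set (z # k)) (\<lambda>p. Phi ((b(z := b s)) p)) ?\<sigma>"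
    by (intro perm_trace_cong) (auto simp: Transposition.transpose_def)
  moreover have "wsubst b (s # k @ [z]) = wsubst (b(z := b s)) (z # k) * b z"
  proof -
    have "wsubst (b(z := b s)) k = wsubst b k" using dist by (intro wsubst_cong) auto
    then show ?thesis by (simp only: wsubst_simps fun_upd_same mult.assoc mult_1_right)
  qed
  ultimately show ?thesis unfolding trace_monomial_def c k by (simp only: mult.assoc)
qed

lemma qsubst_trace_monomial:
  "qsubst H (trace_monomial P s b \<sigma>) = trace_monomial P s (\<lambda>p. qsubst H (b p)) \<sigma>"
  unfolding trace_monomial_def perm_trace_def
  by (simp add: qsubst_simps qsubst_cembed wsubst_hom[OF ring_hom_qsubst] Phi_qsubst
      ring_hom_sum[OF ring_hom_ceval[OF ring_hom_const]] ring_hom_prod[OF ring_hom_ceval[OF ring_hom_const]])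

lemma chain_map:
  assumes "chain \<sigma> l t" "\<And>a. a \<in> set l \<Longrightarrow> \<sigma>' (h a) = h (\<sigma> a)"
  shows "chain \<sigma>' (map h l) (h t)"
  using assms
proof (induction l)
  case (Cons a l)
  then show ?case by (cases l) auto
qed simp

lemma is_cycle_map:
  assumes "is_cycle \<sigma> l" "inj_on h (set l)" "\<And>a. a \<in> set l \<Longrightarrow> \<sigma>' (h a) = h (\<sigma> a)"
  shows "is_cycle \<sigma>' (map h l)"
  using assms chain_map[of \<sigma> l "hd l" \<sigma>' h] by (auto simp: is_cycle_def distinct_map hd_map)

text \<open>This lets the Cayley-Hamilton polynomial, whose points are \<open>{..CARD('n)}\<close>,
  act on any set of the same size.\<close>

lemma trace_monomial_relabel:
  fixes b :: "nat \<Rightarrow> ('a::field, 'n::finite) qpoly"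
  assumes P: "finite P" "\<sigma> permutes P" "s \<in> P" and h: "inj_on h P"
    and \<sigma>': "\<And>p. p \<in> P \<Longrightarrow> \<sigma>' (h p) = h (\<sigma> p)"
  shows "trace_monomial (h ` P) (h s) b \<sigma>' = trace_monomial P s (b \<circ> h) \<sigma>"
proof -
  let ?l = "cycle_from \<sigma> s"
  note l = cycle_from_props[OF P]
  have "is_cycle \<sigma>' (map h ?l)"
    using l h \<sigma>' by (intro is_cycle_map[of \<sigma>]) (auto intro: inj_on_subset)
  then have c: "cycle_from \<sigma>' (h s) = map h ?l"
    using l(1,2) by (intro cycle_from_eq) (auto simp: is_cycle_def hd_map)
  let ?O = "P - set ?l"
  have O: "h ` P - set (map h ?l) = h ` ?O" using h l(3) by (auto simp: inj_on_def)
  have inj: "inj_on h ?O" using h by (rule inj_on_subset) auto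
  have tr: "perm_trace (h ` ?O) B \<sigma>' = perm_trace ?O (B \<circ> h) \<sigma>" for B :: "nat \<Rightarrow> ('a, 'n) cpoly^'n^'n"
    unfolding perm_trace_def
  proof (rule sum.reindex_bij_witness[where i = "\<lambda>\<kappa>. restrict (\<lambda>q. \<kappa> (inv_into ?O h q)) (h ` ?O)"
        and j = "\<lambda>\<iota>. restrict (\<lambda>p. \<iota> (h p)) ?O"])
    fix \<iota> assume \<iota>: "\<iota> \<in> PiE (h ` ?O) (\<lambda>_. UNIV :: 'n set)"
    show "restrict (\<lambda>q. (restrict (\<lambda>p. \<iota> (h p)) ?O) (inv_into ?O h q)) (h ` ?O) = \<iota>"
      using \<iota> inj by (auto simp: fun_eq_iff restrict_def PiE_def extensional_def inv_into_into f_inv_into_f)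
    show "restrict (\<lambda>p. \<iota> (h p)) ?O \<in> PiE ?O (\<lambda>_. UNIV)" by auto
    show "(\<Prod>p\<in>?O. (B \<circ> h) p $ restrict (\<lambda>p. \<iota> (h p)) ?O p $ restrict (\<lambda>p. \<iota> (h p)) ?O (\<sigma> p))
        = (\<Prod>p\<in>h ` ?O. B p $ \<iota> p $ \<iota> (\<sigma>' p))"
      unfolding prod.reindex[OF inj] using l(4) \<sigma>' by (intro prod.cong) auto
  next
    fix \<kappa> assume \<kappa>: "\<kappa> \<in> PiE ?O (\<lambda>_. UNIV :: 'n set)"
    show "restrict (\<lambda>p. (restrict (\<lambda>q. \<kappa> (inv_into ?O h q)) (h ` ?O)) (h p)) ?O = \<kappa>"
      using \<kappa> inj by (auto simp: fun_eq_iff restrict_def PiE_def extensional_def)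
    show "restrict (\<lambda>q. \<kappa> (inv_into ?O h q)) (h ` ?O) \<in> PiE (h ` ?O) (\<lambda>_. UNIV)" by auto
  qed
  show ?thesis unfolding trace_monomial_def c O tr by (simp add: wsubst_def o_def)
qed

definition matrix_unit_mult :: "'n \<Rightarrow> 'n \<Rightarrow> 'r::comm_ring_1^'n::finite^'n \<Rightarrow> 'r^'n^'n" where
  "matrix_unit_mult j i M = (\<chi> a c. if a = j then M $ i $ c else 0)"

lemma matrix_unit_mult_mult: "matrix_unit_mult j i M ** M' = matrix_unit_mult j i (M ** M')"
  by (simp add: vec_eq_iff matrix_matrix_mult_def matrix_unit_mult_def)

text \<open>Entry \<open>(i, j)\<close> of a matrix \<open>M\<close> is the trace of \<open>E\<^sub>j\<^sub>i M\<close>.\<close>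

lemma geval_trace_monomial:
  fixes A :: "nat \<Rightarrow> 'r::comm_ring_1^'n::finite^'n" and b :: "nat \<Rightarrow> ('a::field, 'n) qpoly"
  assumes phi: "ring_hom phi" and "finite P" "\<sigma> permutes P" "s \<in> P"
  shows "geval phi A (trace_monomial P s b \<sigma>) $ i $ j
    = perm_trace P (\<lambda>p. if p = s then matrix_unit_mult j i (geval phi A (b s)) else geval phi A (b p)) \<sigma>"
  using assms(2-4)
proof (induction "card P" arbitrary: P \<sigma> b rule: less_induct)
  case less
  let ?B = "\<lambda>b p. if p = s then matrix_unit_mult j i (geval phi A (b s)) else geval phi A (b p)"
  show ?case
  proof (cases "P = {s}")
    case True
    then have \<sigma>: "\<sigma> s = s" using less.prems by auto
    have "is_cycle \<sigma> [s]" using \<sigma> by (simp add: is_cycle_def)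
    then have "cycle_from \<sigma> s = [s]" by (rule cycle_from_eq) simp
    then have "trace_monomial P s b \<sigma> = b s" by (simp add: trace_monomial_def True cembed_simps)
    moreover have "perm_trace {s} (?B b) \<sigma> = (\<Sum>a\<in>UNIV. if a = j then geval phi A (b s) $ i $ a else 0)"
      using \<sigma> by (subst perm_trace_fixed[where y = s]) (auto simp: matrix_unit_mult_def)
    ultimately show ?thesis using True by simp
  next
    case False
    then obtain y where y: "y \<in> P" "y \<noteq> s" using less.prems by auto
    have card: "card (P - {y}) < card P" "finite (P - {y})" "s \<in> P - {y}"
      using y less.prems card_Diff1_less[OF less.prems(1) y(1)] by auto
    define z where "z = inv \<sigma> y"
    have z: "\<sigma> z = y" "z \<in> P"
      using less.prems y by (auto simp: z_def permutes_inverses permutes_in_image[OF permutes_inv])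
    show ?thesis
    proof (cases "z = y")
      case True
      then have \<sigma>y: "\<sigma> y = y" using z by simp
      have "geval phi A (trace_monomial P s b \<sigma>) $ i $ j
          = ceval phi A (\<Sum>j\<in>UNIV. Phi (b y) $ j $ j) * geval phi A (trace_monomial (P - {y}) s b \<sigma>) $ i $ j"
        by (simp add: trace_monomial_fixed[OF less.prems y \<sigma>y] geval_mult[OF phi] geval_cembed[OF phi] mat_mult_nth)
      also have "geval phi A (trace_monomial (P - {y}) s b \<sigma>) $ i $ j = perm_trace (P - {y}) (?B b) \<sigma>"
        by (rule less.hyps[OF card(1,2) permutes_remove_fixed[OF less.prems(2) \<sigma>y] card(3)])
      also have "ceval phi A (\<Sum>j\<in>UNIV. Phi (b y) $ j $ j) = (\<Sum>j\<in>UNIV. ?B b y $ j $ j)"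
        using y by (simp add: ring_hom_sum[OF ring_hom_ceval[OF phi]] geval_Phi[OF phi])
      also have "\<dots> * perm_trace (P - {y}) (?B b) \<sigma> = perm_trace P (?B b) \<sigma>"
        using less.prems y \<sigma>y permutes_inj[OF less.prems(2)]
        by (intro perm_trace_fixed[symmetric]) (auto dest: injD[of \<sigma> _ y])
      finally show ?thesis .
    next
      case False
      let ?b = "b(z := b z * b y)"
      have "geval phi A (trace_monomial P s b \<sigma>) $ i $ j = perm_trace (P - {y}) (?B ?b) (\<sigma> \<circ> transpose z y)"
        unfolding trace_monomial_contract[OF less.prems y z(1) False]
        by (rule less.hyps[OF card(1,2) permutes_contract[OF less.prems(2) z(2) y(1) z(1)] card(3)])
      also have "perm_trace (P - {y}) (?B ?b) (\<sigma> \<circ> transpose z y)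
          = perm_trace (P - {y}) ((?B b)(z := ?B b z ** ?B b y)) (\<sigma> \<circ> transpose z y)"
      proof (rule perm_trace_cong[OF _ refl])
        fix p
        show "?B ?b p = ((?B b)(z := ?B b z ** ?B b y)) p"
        proof (cases "z = s")
          case True
          then show ?thesis using y by (simp add: geval_mult[OF phi] matrix_unit_mult_mult)
        next
          case False
          then show ?thesis using y by (simp add: geval_mult[OF phi])
        qed
      qed
      also have "\<dots> = perm_trace P (?B b) \<sigma>"
        using less.prems y z False permutes_inj_on[OF less.prems(2)]
        by (intro perm_trace_contract[symmetric]) auto
      finally show ?thesis .
    qed
  qed
qed

section \<open>The Cayley--Hamilton polynomial\<close>

text \<open>The multilinear Cayley--Hamilton polynomial, multiplied from the left by the variable \<open>x\<^sub>0\<close>.\<close>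

definition cayley_hamilton :: "('a::field_char_0, 'n::finite) qpoly" where
  "cayley_hamilton = (\<Sum>\<tau> | \<tau> permutes {..CARD('n)}. of_int (sign \<tau>) * trace_monomial {..CARD('n)} 0 var \<tau>)"

lemma geval_of_int_mult: "ring_hom phi \<Longrightarrow> geval phi A (of_int k * p) $ i $ j = of_int k * geval phi A p $ i $ j"
  by (simp add: geval_mult geval_const single_of_int[symmetric] mat_mult_nth ring_hom_of_int del: single_of_int)

text \<open>By \<open>geval_trace_monomial\<close>, each entry of the value is an alternating sum of
  traces along permutations of \<open>n + 1\<close> points, one more than there are index
  values.\<close>

lemma cayley_hamilton_quasi_id: "(cayley_hamilton :: ('a::field_char_0, 'n::finite) qpoly) \<in> quasi_ids"
  unfolding quasi_ids_def
proof (rule CollectI, rule allI)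
  fix A :: "nat \<Rightarrow> 'a^'n^'n"
  have "geval id A cayley_hamilton $ i $ j = 0" for i j
  proof -
    let ?B = "\<lambda>p. if p = 0 then matrix_unit_mult j i (geval id A (var 0)) else geval id A (var p)"
    have "geval id A cayley_hamilton $ i $ j
        = (\<Sum>\<tau> | \<tau> permutes {..CARD('n)}. of_int (sign \<tau>) * perm_trace {..CARD('n)} ?B (\<tau> \<circ> id))"
      unfolding cayley_hamilton_def
      by (auto simp: geval_sum ring_hom_id geval_of_int_mult geval_trace_monomial[OF ring_hom_id(1)] intro!: sum.cong)
    also have "\<dots> = 0" by (rule perm_trace_alternating) auto
    finally show ?thesis .
  qed
  then show "geval id A cayley_hamilton = 0" by (simp add: vec_eq_iff)
qed

text \<open>If all points alternate, the sum is a substitution instance of the Cayley-Hamilton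
  polynomial up to sign: a bijection renames the points, and reindexing absorbs \<open>g\<close> at
  the cost of \<open>sign g\<close>.\<close>

lemma trace_monomials_alternating_base:
  fixes b :: "nat \<Rightarrow> ('a::field_char_0, 'n::finite) qpoly"
  assumes I: "T_ideal I" "cayley_hamilton \<in> I" and X: "finite X" "card X = Suc CARD('n)" "s \<in> X"
    and g: "g permutes X"
  shows "(\<Sum>\<tau> | \<tau> permutes X. of_int (sign \<tau>) * trace_monomial X s b (\<tau> \<circ> g)) \<in> I"
proof -
  let ?N = "{..CARD('n)}"
  have gp: "permutation g" using g X(1) permutation_permutes by blast
  obtain h0 where h0: "bij_betw h0 ?N X"
    using finite_same_card_bij[of ?N X] X by auto
  \<comment> \<open>The bijection is corrected so that \<open>0\<close>, where the words of the
    Cayley-Hamilton polynomial start, goes to \<open>s\<close>.\<close>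
  define h where "h = transpose (h0 0) s \<circ> h0"
  have "h0 0 \<in> X" using h0 by (auto simp: bij_betw_def)
  then have "transpose (h0 0) s permutes X" using X(3) by (rule permutes_swap_id)
  then have h: "bij_betw h ?N X" unfolding h_def using h0 by (meson bij_betw_trans permutes_imp_bij)
  have h_0: "h 0 = s" by (simp add: h_def)
  have inj: "inj_on h ?N" and im: "h ` ?N = X" using h by (auto simp: bij_betw_def)
  let ?m = "map_permutation ?N h"
  have bij: "bij_betw ?m {\<tau>. \<tau> permutes ?N} {\<tau>. \<tau> permutes X}"
  proof -
    have "?m = (\<lambda>\<pi> x. if x \<in> X then h (\<pi> (inv_into ?N h x)) else x)"
      by (auto simp: map_permutation_def restrict_id_def im fun_eq_iff)
    then show ?thesis using bij_betw_permutations[OF h] by simp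
  qed
  have "qsubst (\<lambda>k. b (h k)) cayley_hamilton
      = (\<Sum>\<tau> | \<tau> permutes ?N. of_int (sign \<tau>) * trace_monomial ?N 0 (b \<circ> h) \<tau>)"
    by (simp add: cayley_hamilton_def qsubst_simps ring_hom_of_int[OF ring_hom_qsubst] qsubst_trace_monomial o_def)
  also have "\<dots> = (\<Sum>\<tau> | \<tau> permutes ?N. of_int (sign (?m \<tau>)) * trace_monomial X s b (?m \<tau>))"
  proof (rule sum.cong[OF refl])
    fix \<tau> assume "\<tau> \<in> {\<tau>. \<tau> permutes ?N}"
    then have \<tau>: "\<tau> permutes ?N" by simp
    have "trace_monomial (h ` ?N) (h 0) b (?m \<tau>) = trace_monomial ?N 0 (b \<circ> h) \<tau>"
      using \<tau> inj by (intro trace_monomial_relabel) (auto simp: map_permutation_apply)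
    then show "of_int (sign \<tau>) * trace_monomial ?N 0 (b \<circ> h) \<tau> = of_int (sign (?m \<tau>)) * trace_monomial X s b (?m \<tau>)"
      using sign_map_permutation[OF inj \<tau>] by (simp add: im h_0)
  qed
  also have "\<dots> = (\<Sum>\<tau> | \<tau> permutes X. of_int (sign \<tau>) * trace_monomial X s b \<tau>)"
    using sum.reindex_bij_betw[OF bij, of "\<lambda>\<tau>. of_int (sign \<tau>) * trace_monomial X s b \<tau>"] .
  finally have mem: "(\<Sum>\<tau> | \<tau> permutes X. of_int (sign \<tau>) * trace_monomial X s b \<tau>) \<in> I"
    using T_idealD(5)[OF I] by metis
  have "(\<Sum>\<tau> | \<tau> permutes X. of_int (sign \<tau>) * trace_monomial X s b (\<tau> \<circ> g))
      = (\<Sum>\<tau> | \<tau> permutes X. of_int (sign g * sign (\<tau> \<circ> g)) * trace_monomial X s b (\<tau> \<circ> g))"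
  proof (rule sum.cong[OF refl])
    fix \<tau> assume "\<tau> \<in> {\<tau>. \<tau> permutes X}"
    then have "permutation \<tau>" using X(1) permutation_permutes by blast
    then have "sign g * sign (\<tau> \<circ> g) = sign \<tau>" using gp by (simp add: sign_compose)
    then show "of_int (sign \<tau>) * trace_monomial X s b (\<tau> \<circ> g) = of_int (sign g * sign (\<tau> \<circ> g)) * trace_monomial X s b (\<tau> \<circ> g)"
      by (simp only:)
  qed
  also have "\<dots> = (\<Sum>\<tau> | \<tau> permutes X. of_int (sign g * sign \<tau>) * trace_monomial X s b \<tau>)"
    by (rule sum_permutations_right[OF g, of "\<lambda>\<tau>. of_int (sign g * sign \<tau>) * trace_monomial X s b \<tau>"])
  also have "\<dots> = of_int (sign g) * (\<Sum>\<tau> | \<tau> permutes X. of_int (sign \<tau>) * trace_monomial X s b \<tau>)"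
    by (simp add: sum_distrib_left mult.assoc)
  finally show ?thesis using T_idealD(3)[OF I(1) mem] by simp
qed

text \<open>Points outside \<open>X\<close> are eliminated one at a time. Every
  \<open>\<tau>\<close> fixes such a point \<open>y\<close>, so \<open>g z = y\<close> gives
  \<open>(\<tau> \<circ> g) z = y\<close>: the predecessor of \<open>y\<close> is common to all
  terms, and one contraction serves the whole sum.\<close>

lemma trace_monomials_alternating:
  fixes b :: "nat \<Rightarrow> ('a::field_char_0, 'n::finite) qpoly"
  assumes I: "T_ideal I" "cayley_hamilton \<in> I" and "finite P" "X \<subseteq> P" "card X = Suc CARD('n)" "s \<in> P" "g permutes P"
  shows "(\<Sum>\<tau> | \<tau> permutes X. of_int (sign \<tau>) * trace_monomial P s b (\<tau> \<circ> g)) \<in> I"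
  using assms(3-)
proof (induction "card P" arbitrary: P s b g rule: less_induct)
  case less
  note P = less.prems(1) and X = less.prems(2,3) and s = less.prems(4) and g = less.prems(5)
  have \<tau>P: "\<tau> \<circ> g permutes P" if "\<tau> permutes X" for \<tau>
    using g permutes_subset[OF that X(1)] by (rule permutes_compose)
  have \<tau>fix: "\<tau> y = y" if "\<tau> permutes X" "y \<notin> X" for \<tau> y using that by (rule permutes_not_in)
  have pre: "\<exists>z\<in>P. g z = y" if "y \<in> P" for y
    using that g by (intro bexI[of _ "inv g y"]) (auto simp: permutes_inverses permutes_in_image[OF permutes_inv])
  show ?case
  proof (cases "\<exists>y\<in>P. y \<notin> X \<and> y \<noteq> s")
    case True
    then obtain y where y: "y \<in> P" "y \<notin> X" "y \<noteq> s" by blast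
    have card: "card (P - {y}) < card P" using card_Diff1_less[OF P y(1)] .
    have prems: "finite (P - {y})" "X \<subseteq> P - {y}" "s \<in> P - {y}" using P X s y by auto
    obtain z where z: "z \<in> P" "g z = y" using pre y by blast
    show ?thesis
    proof (cases "z = y")
      case True
      then have gy: "g y = y" using z by simp
      have "(\<Sum>\<tau> | \<tau> permutes X. of_int (sign \<tau>) * trace_monomial P s b (\<tau> \<circ> g))
          = cembed (\<Sum>j\<in>UNIV. Phi (b y) $ j $ j) *
            (\<Sum>\<tau> | \<tau> permutes X. of_int (sign \<tau>) * trace_monomial (P - {y}) s b (\<tau> \<circ> g))"
        unfolding sum_distrib_left
      proof (rule sum.cong[OF refl])
        fix \<tau> assume "\<tau> \<in> {\<tau>. \<tau> permutes X}"
        then have \<tau>: "\<tau> permutes X" by simp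
        have "trace_monomial P s b (\<tau> \<circ> g) = cembed (\<Sum>j\<in>UNIV. Phi (b y) $ j $ j) * trace_monomial (P - {y}) s b (\<tau> \<circ> g)"
          using P s y gy \<tau>P[OF \<tau>] \<tau>fix[OF \<tau>] by (intro trace_monomial_fixed) auto
        then show "of_int (sign \<tau>) * trace_monomial P s b (\<tau> \<circ> g)
          = cembed (\<Sum>j\<in>UNIV. Phi (b y) $ j $ j) * (of_int (sign \<tau>) * trace_monomial (P - {y}) s b (\<tau> \<circ> g))"
          by (cases \<tau> rule: sign_cases) auto
      qed
      moreover have "(\<Sum>\<tau> | \<tau> permutes X. of_int (sign \<tau>) * trace_monomial (P - {y}) s b (\<tau> \<circ> g)) \<in> I"
        by (rule less.hyps[OF card prems(1,2) X(2) prems(3) permutes_remove_fixed[OF g gy]])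
      ultimately show ?thesis using T_idealD(3)[OF I(1)] by simp
    next
      case False
      let ?b = "b(z := b z * b y)"
      have "(\<Sum>\<tau> | \<tau> permutes X. of_int (sign \<tau>) * trace_monomial P s b (\<tau> \<circ> g))
          = (\<Sum>\<tau> | \<tau> permutes X. of_int (sign \<tau>) * trace_monomial (P - {y}) s ?b (\<tau> \<circ> (g \<circ> transpose z y)))"
      proof (rule sum.cong[OF refl])
        fix \<tau> assume "\<tau> \<in> {\<tau>. \<tau> permutes X}"
        then have \<tau>: "\<tau> permutes X" by simp
        have "trace_monomial P s b (\<tau> \<circ> g) = trace_monomial (P - {y}) s ?b (\<tau> \<circ> g \<circ> transpose z y)"
          using P s y z False \<tau>P[OF \<tau>] \<tau>fix[OF \<tau>] by (intro trace_monomial_contract) auto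
        then show "of_int (sign \<tau>) * trace_monomial P s b (\<tau> \<circ> g)
            = of_int (sign \<tau>) * trace_monomial (P - {y}) s ?b (\<tau> \<circ> (g \<circ> transpose z y))"
          by (simp only: comp_assoc)
      qed
      also have "\<dots> \<in> I"
        by (rule less.hyps[OF card prems(1,2) X(2) prems(3) permutes_contract[OF g z(1) y(1) z(2)]])
      finally show ?thesis .
    qed
  next
    case False
    show ?thesis
    proof (cases "s \<in> X")
      case True
      then have "P = X" using False X(1) by auto
      then show ?thesis using trace_monomials_alternating_base[OF I P] X s g by auto
    next
      case sX: False
      then have PX: "P = insert s X" using False X(1) s by auto
      have finX: "finite X" using P PX by simp
      obtain z where z: "z \<in> P" "g z = s" using pre s by blast
      show ?thesis
      proof (cases "z = s")
        \<comment> \<open>Here every word is the single letter \<open>b s\<close>, and the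
          coefficients form an alternating sum of traces over more than \<open>n\<close> points,
          which is zero.\<close>
        case True
        have "trace_monomial P s b (\<tau> \<circ> g) = cembed (perm_trace X (\<lambda>p. Phi (b p)) (\<tau> \<circ> g)) * b s"
          if \<tau>: "\<tau> permutes X" for \<tau>
        proof -
          have "is_cycle (\<tau> \<circ> g) [s]" using z True \<tau>fix[OF \<tau> sX] by (simp add: is_cycle_def)
          then have "cycle_from (\<tau> \<circ> g) s = [s]" by (rule cycle_from_eq) simp
          then show ?thesis using sX by (simp add: trace_monomial_def PX)
        qed
        then have "(\<Sum>\<tau> | \<tau> permutes X. of_int (sign \<tau>) * trace_monomial P s b (\<tau> \<circ> g))
            = cembed (\<Sum>\<tau> | \<tau> permutes X. of_int (sign \<tau>) * perm_trace X (\<lambda>p. Phi (b p)) (\<tau> \<circ> g)) * b s"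
          by (simp add: cembed_simps ring_hom_of_int[OF ring_hom_cembed] sum_distrib_right mult.assoc)
        also have "\<dots> = 0"
          using perm_trace_alternating[OF finX, of "\<lambda>p. Phi (b p)" g] X(2) by (simp add: cembed_simps)
        finally show ?thesis using T_idealD(1)[OF I(1)] by simp
      next
        case False
        let ?b = "b(z := b s)"
        have card: "card (P - {s}) < card P" using card_Diff1_less[OF P s] .
        have "(\<Sum>\<tau> | \<tau> permutes X. of_int (sign \<tau>) * trace_monomial P s b (\<tau> \<circ> g))
            = (\<Sum>\<tau> | \<tau> permutes X. of_int (sign \<tau>) * trace_monomial (P - {s}) z ?b (\<tau> \<circ> (g \<circ> transpose z s))) * b z"
          unfolding sum_distrib_right
        proof (rule sum.cong[OF refl])
          fix \<tau> assume "\<tau> \<in> {\<tau>. \<tau> permutes X}"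
          then have \<tau>: "\<tau> permutes X" by simp
          have "trace_monomial P s b (\<tau> \<circ> g) = trace_monomial (P - {s}) z ?b (\<tau> \<circ> g \<circ> transpose z s) * b z"
            using P s z False \<tau>P[OF \<tau>] \<tau>fix[OF \<tau> sX] by (intro trace_monomial_move_start) auto
          then show "of_int (sign \<tau>) * trace_monomial P s b (\<tau> \<circ> g)
              = of_int (sign \<tau>) * trace_monomial (P - {s}) z ?b (\<tau> \<circ> (g \<circ> transpose z s)) * b z"
            by (simp only: comp_assoc mult.assoc)
        qed
        moreover have "(\<Sum>\<tau> | \<tau> permutes X. of_int (sign \<tau>) * trace_monomial (P - {s}) z ?b (\<tau> \<circ> (g \<circ> transpose z s))) \<in> I"
          using P sX z False PX by (intro less.hyps[OF card _ _ X(2) _ permutes_contract[OF g z(1) s z(2)]]) auto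
        ultimately show ?thesis using T_idealD(4)[OF I(1)] by simp
      qed
    qed
  qed
qed

text \<open>Inserting a letter behind \<open>s\<close> costs one transposition, which accounts for
  the sign.\<close>

lemma cycle_of_distinct_list:
  assumes "distinct (s # w)"
  shows "\<exists>c. c permutes set (s # w) \<and> is_cycle c (s # w) \<and> sign c = (-1) ^ length w"
  using assms
proof (induction w)
  case Nil
  show ?case by (intro exI[of _ id]) (auto simp: is_cycle_def)
next
  case (Cons x w)
  then obtain c where c: "c permutes set (s # w)" "is_cycle c (s # w)" "sign c = (-1) ^ length w" by auto
  have x: "x \<notin> set (s # w)" "x \<noteq> s" using Cons.prems by auto
  let ?c = "c \<circ> transpose s x"
  have "c permutes set (s # x # w)" using c(1) by (rule permutes_subset) auto
  then have "?c permutes set (s # x # w)" using permutes_swap_id[of s "set (s # x # w)" x] by (auto intro: permutes_compose)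
  moreover have "c x = x" using c(1) x permutes_not_in by metis
  then have "is_cycle ?c (insert_after s x (s # w))"
    using c(2) x by (intro is_cycle_insert_after) (auto simp: comp_assoc)
  moreover have "sign ?c = - sign c"
    using x c(1) sign_transpose_comp(2)[of "set (s # w)" c s x] by auto
  ultimately have "?c permutes set (s # x # w) \<and> is_cycle ?c (s # x # w) \<and> sign ?c = (-1) ^ length (x # w)"
    using c(3) by simp
  then show ?case by blast
qed

text \<open>Multilinear polynomials without coefficients that alternate in more than \<open>n\<^sup>2\<close> letters:
the corresponding combination of permutations annihilates all colourings with \<open>n\<close> colours, as two of
the alternating positions carry the same pair of colours.\<close>

theorem alternating_words_in_T_ideal:
  fixes I :: "('a::field_char_0, 'n::finite) qpoly set"
  assumes I: "T_ideal I" "cayley_hamilton \<in> I" and w: "distinct w" and Z: "Z \<subseteq> set w" "card Z > CARD('n)\<^sup>2"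
  shows "(\<Sum>\<tau> | \<tau> permutes Z. of_int (sign \<tau>) * wsubst var (map \<tau> w)) \<in> I"
proof -
  let ?n = "CARD('n)"
  \<comment> \<open>The new point \<open>s\<close>, to which \<open>?b\<close> assigns
    \<open>1\<close>, marks where a cycle is cut open; a word thus becomes the trace monomial of a
    full cycle.\<close>
  obtain s where s: "s \<notin> set w" using ex_new_if_finite[of "set w"] infinite_UNIV_nat by auto
  define P where "P = set (s # w)"
  have P: "finite P" "s \<in> P" "Z \<subseteq> P" using Z by (auto simp: P_def)
  have finZ: "finite Z" using P finite_subset by blast
  obtain c where c: "c permutes P" "is_cycle c (s # w)"
    using cycle_of_distinct_list[of s w] s w by (auto simp: P_def)
  let ?b = "var(s := 1) :: nat \<Rightarrow> ('a, 'n) qpoly"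
  \<comment> \<open>The inverse is taken because \<open>alternators_in\<close> composes on the
    right, whereas \<open>trace_monomials_alternating\<close> composes on the left.\<close>
  define G where "G \<sigma> = trace_monomial P s ?b (inv \<sigma>)" for \<sigma>
  \<comment> \<open>The inverse of \<open>cj \<tau>\<close> is the conjugate of \<open>c\<close> by
    \<open>\<tau>\<close>, the cycle that spells \<open>map \<tau> w\<close> behind
    \<open>s\<close>.\<close>
  define cj where "cj \<tau> = \<tau> \<circ> inv c \<circ> inv \<tau>" for \<tau> :: "nat \<Rightarrow> nat"
  define a :: "(nat \<Rightarrow> nat) \<Rightarrow> ('a, 'n) qpoly" where
    "a \<pi> = (\<Sum>\<tau> | \<tau> permutes Z. of_int (sign \<tau>) * (if \<pi> = cj \<tau> then 1 else 0))" for \<pi>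
  have ZP: "\<tau> permutes P" if "\<tau> permutes Z" for \<tau> using that P(3) by (rule permutes_subset)
  have cjP: "cj \<tau> permutes P" if "\<tau> permutes Z" for \<tau>
    unfolding cj_def using ZP[OF that] c(1) by (intro permutes_compose permutes_inv)
  have "alternators_in P ?n G I"
    unfolding alternators_in_def
  proof (intro allI impI)
    fix X g assume X: "X \<subseteq> P" "card X = Suc ?n" and g: "g permutes P"
    have finX: "finite X" using P(1) X(1) finite_subset by blast
    have "(\<Sum>\<tau> | \<tau> permutes X. of_int (sign \<tau>) * G (g \<circ> \<tau>))
        = (\<Sum>\<tau> | \<tau> permutes X. of_int (sign (inv \<tau>)) * trace_monomial P s ?b (inv \<tau> \<circ> inv g))"
    proof (rule sum.cong[OF refl])
      fix \<tau> assume "\<tau> \<in> {\<tau>. \<tau> permutes X}"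
      then have \<tau>: "\<tau> permutes X" by simp
      then have "inv (g \<circ> \<tau>) = inv \<tau> \<circ> inv g"
        using permutes_bij[OF g] permutes_bij[OF \<tau>] by (simp add: o_inv_distrib)
      then show "of_int (sign \<tau>) * G (g \<circ> \<tau>) = of_int (sign (inv \<tau>)) * trace_monomial P s ?b (inv \<tau> \<circ> inv g)"
        using \<tau> finX by (simp add: G_def sign_inverse permutes_imp_permutation)
    qed
    also have "\<dots> = (\<Sum>\<tau> | \<tau> permutes X. of_int (sign \<tau>) * trace_monomial P s ?b (\<tau> \<circ> inv g))"
      by (rule sum_permutations_inverse[symmetric])
    also have "\<dots> \<in> I"
      by (rule trace_monomials_alternating[OF I P(1) X P(2) permutes_inv[OF g]])
    finally show "(\<Sum>\<tau> | \<tau> permutes X. of_int (sign \<tau>) * G (g \<circ> \<tau>)) \<in> I" .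
  qed
  moreover have "symmetrizers_in P ?n a {0}"
    unfolding symmetrizers_in_def
  proof (intro allI impI)
    fix f g :: "nat \<Rightarrow> nat" assume f: "f ` P \<subseteq> {..<?n}" and g: "g permutes P"
    let ?Y = "{\<tau>. \<tau> permutes P \<and> (\<forall>x\<in>P. f (\<tau> x) = f x)}"
    have finY: "finite ?Y" using finite_permutations[OF P(1)] by (rule finite_subset[rotated]) auto
    \<comment> \<open>A point of \<open>Z\<close> carries its own colour and that of its preimage
      under \<open>g\<close>. There are at most \<open>n^2\<close> such pairs, so two points of
      \<open>Z\<close> agree in both colours.\<close>
    define k where "k z = (f z, f (inv g z))" for z
    have "k ` Z \<subseteq> {..<?n} \<times> {..<?n}"
      using f P(3) permutes_in_image[OF permutes_inv[OF g]] by (fastforce simp: k_def)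
    then have "card (k ` Z) \<le> card ({..<?n} \<times> {..<?n})" by (intro card_mono) auto
    then have "card (k ` Z) \<le> ?n\<^sup>2" by (simp add: card_cartesian_product power2_eq_square)
    then have "\<not> inj_on k Z" using Z(2) card_image by fastforce
    then obtain z1 z2 where z: "z1 \<in> Z" "z2 \<in> Z" "z1 \<noteq> z2" "f z1 = f z2" "f (inv g z1) = f (inv g z2)"
      by (auto simp: inj_on_def k_def)
    let ?t = "transpose z1 z2"
    have ft: "f (?t x) = f x" "f (inv g (?t x)) = f (inv g x)" for x
      using z by (auto simp: Transposition.transpose_def)
    have tP: "?t permutes P" using z P(3) by (intro permutes_swap_id) auto
    \<comment> \<open>\<open>K \<tau>\<close> says that \<open>cj \<tau>\<close> lies in the coset
      of \<open>g\<close> modulo the colour-preserving permutations. Replacing \<open>\<tau>\<close>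
      by \<open>?t \<circ> \<tau>\<close> conjugates \<open>cj \<tau>\<close> by \<open>?t\<close>,
      which neither of the two colourings notices.\<close>
    define K where "K \<tau> \<longleftrightarrow> (\<forall>x\<in>P. f (inv g (cj \<tau> x)) = f x)" for \<tau>
    have K: "K (?t \<circ> \<tau>) = K \<tau>" if "\<tau> permutes Z" for \<tau>
    proof -
      have "inv (?t \<circ> \<tau>) = inv \<tau> \<circ> ?t"
        using permutes_bij[OF that] by (simp add: o_inv_distrib)
      then have cj: "cj (?t \<circ> \<tau>) x = ?t (cj \<tau> (?t x))" for x by (simp add: cj_def)
      have "K (?t \<circ> \<tau>) \<longleftrightarrow> (\<forall>x\<in>P. f (inv g (cj \<tau> (?t x))) = f (?t x))"
        unfolding K_def cj ft ..
      also have "\<dots> \<longleftrightarrow> K \<tau>"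
      proof
        assume *: "\<forall>x\<in>P. f (inv g (cj \<tau> (?t x))) = f (?t x)"
        show "K \<tau>" unfolding K_def
        proof
          fix x assume "x \<in> P"
          then have "?t x \<in> P" using permutes_in_image[OF tP] by blast
          with * have "f (inv g (cj \<tau> (?t (?t x)))) = f (?t (?t x))" by blast
          then show "f (inv g (cj \<tau> x)) = f x" by simp
        qed
      next
        assume "K \<tau>"
        then show "\<forall>x\<in>P. f (inv g (cj \<tau> (?t x))) = f (?t x)"
          unfolding K_def using permutes_in_image[OF tP] by blast
      qed
      finally show ?thesis .
    qed
    have "(\<Sum>\<tau>\<in>?Y. a (g \<circ> \<tau>))
        = (\<Sum>\<tau> | \<tau> permutes Z. of_int (sign \<tau>) * (\<Sum>\<tau>'\<in>?Y. if g \<circ> \<tau>' = cj \<tau> then 1 else 0))"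
      unfolding a_def by (subst sum.swap) (simp add: sum_distrib_left)
    also have "\<dots> = (\<Sum>\<tau> | \<tau> permutes Z. of_int (sign \<tau>) * (if K \<tau> then 1 else 0))"
    proof (rule sum.cong[OF refl])
      fix \<tau> assume "\<tau> \<in> {\<tau>. \<tau> permutes Z}"
      then have \<tau>: "\<tau> permutes Z" by simp
      have eq: "g \<circ> \<tau>' = cj \<tau> \<longleftrightarrow> \<tau>' = inv g \<circ> cj \<tau>" for \<tau>'
        using permutes_inverses[OF g] by (auto simp: fun_eq_iff) metis
      have mem: "inv g \<circ> cj \<tau> \<in> ?Y \<longleftrightarrow> K \<tau>"
        using permutes_compose[OF cjP[OF \<tau>] permutes_inv[OF g]] by (simp add: K_def)
      have "(\<Sum>\<tau>'\<in>?Y. if g \<circ> \<tau>' = cj \<tau> then 1 else (0::('a, 'n) qpoly))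
          = (\<Sum>\<tau>'\<in>?Y. if \<tau>' = inv g \<circ> cj \<tau> then 1 else 0)" by (simp only: eq)
      also have "\<dots> = (if inv g \<circ> cj \<tau> \<in> ?Y then 1 else 0)" using finY by (rule sum.delta)
      finally show "of_int (sign \<tau>) * (\<Sum>\<tau>'\<in>?Y. if g \<circ> \<tau>' = cj \<tau> then 1 else (0::('a, 'n) qpoly))
          = of_int (sign \<tau>) * (if K \<tau> then 1 else 0)" by (simp only: mem)
    qed
    also have "\<dots> = 0"
      by (rule alternating_sum_vanishes_left[OF finZ z(1-3)]) (simp only: K)
    finally show "(\<Sum>\<tau>\<in>?Y. a (g \<circ> \<tau>)) \<in> {0}" by (simp only: singleton_iff)
  qed
  ultimately have "(\<Sum>\<pi> | \<pi> permutes P. a \<pi> * G \<pi>) \<in> I"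
    using T_idealD[OF I(1)] by (intro symmetrizer_free_combination_in_alternators[OF P(1)]) auto
  also have "(\<Sum>\<pi> | \<pi> permutes P. a \<pi> * G \<pi>)
      = (\<Sum>\<tau> | \<tau> permutes Z. \<Sum>\<pi> | \<pi> permutes P. (if \<pi> = cj \<tau> then of_int (sign \<tau>) * G \<pi> else 0))"
    unfolding a_def sum_distrib_right by (subst sum.swap) (auto intro!: sum.cong)
  also have "\<dots> = (\<Sum>\<tau> | \<tau> permutes Z. of_int (sign \<tau>) * wsubst var (map \<tau> w))"
  proof (rule sum.cong[OF refl])
    fix \<tau> assume "\<tau> \<in> {\<tau>. \<tau> permutes Z}"
    then have \<tau>: "\<tau> permutes Z" by simp
    have \<tau>s: "\<tau> s = s" using permutes_not_in[OF \<tau>] s Z(1) by auto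
    have inv_cj: "inv (cj \<tau>) = \<tau> \<circ> c \<circ> inv \<tau>"
      using permutes_bij[OF \<tau>] permutes_bij[OF c(1)] by (simp add: cj_def o_inv_distrib bij_imp_bij_inv inv_inv_eq comp_assoc bij_comp)
    have "is_cycle (inv (cj \<tau>)) (map \<tau> (s # w))"
      unfolding inv_cj using permutes_inverses[OF \<tau>] permutes_inj_on[OF \<tau>] by (intro is_cycle_map[OF c(2)]) auto
    then have cyc: "cycle_from (inv (cj \<tau>)) s = s # map \<tau> w"
      by (intro cycle_from_eq) (auto simp: \<tau>s)
    have "set (map \<tau> (s # w)) = P" using permutes_image[OF ZP[OF \<tau>]] by (simp add: P_def)
    then have "G (cj \<tau>) = wsubst ?b (map \<tau> (s # w))"
      unfolding G_def trace_monomial_def cyc using \<tau>s by (simp add: cembed_simps)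
    also have "\<dots> = wsubst ?b (map \<tau> w)" by (simp add: \<tau>s)
    also have "\<dots> = wsubst var (map \<tau> w)"
    proof (rule wsubst_cong)
      fix x assume "x \<in> set (map \<tau> w)"
      then obtain y where y: "y \<in> set w" "x = \<tau> y" by auto
      have "x \<noteq> s"
      proof
        assume "x = s"
        then have "\<tau> y = \<tau> s" using y \<tau>s by simp
        then have "y = s" by (rule injD[OF permutes_inj[OF \<tau>]])
        then show False using y s by simp
      qed
      then show "?b x = var x" by simp
    qed
    finally show "(\<Sum>\<pi> | \<pi> permutes P. (if \<pi> = cj \<tau> then of_int (sign \<tau>) * G \<pi> else 0))
        = of_int (sign \<tau>) * wsubst var (map \<tau> w)"
      using cjP[OF \<tau>] finite_permutations[OF P(1)] by (simp add: sum.delta)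
  qed
  finally show ?thesis .
qed

section \<open>The Nagata--Higman theorem\<close>

text \<open>This is the coefficient of \<open>t ^ e\<close> in \<open>(y + t * x) ^ k\<close>, the
  sum of all products of \<open>e\<close> factors \<open>x\<close> and \<open>k - e\<close> factors
  \<open>y\<close>. The recursion splits off the leftmost factor.\<close>

fun pencil_coeff :: "'r::ring_1 \<Rightarrow> 'r \<Rightarrow> nat \<Rightarrow> nat \<Rightarrow> 'r" where
  "pencil_coeff x y 0 e = (if e = 0 then 1 else 0)"
| "pencil_coeff x y (Suc k) e = y * pencil_coeff x y k e + (if e = 0 then 0 else x * pencil_coeff x y k (e - 1))"

lemma pencil_coeff_large: "e > k \<Longrightarrow> pencil_coeff x y k e = 0"
  by (induction k arbitrary: e) auto

lemma pencil_power: "(y + of_nat t * x) ^ k = (\<Sum>e\<le>k. of_nat (t ^ e) * pencil_coeff x y k e)"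
proof (induction k)
  case (Suc k)
  let ?c = "pencil_coeff x y k"
  have "(y + of_nat t * x) ^ Suc k = (\<Sum>e\<le>k. y * (of_nat (t ^ e) * ?c e)) + (\<Sum>e\<le>k. of_nat t * x * (of_nat (t ^ e) * ?c e))"
    by (simp only: power_Suc Suc.IH distrib_right sum_distrib_left sum.distrib)
  also have "(\<Sum>e\<le>k. y * (of_nat (t ^ e) * ?c e)) = (\<Sum>e\<le>Suc k. of_nat (t ^ e) * (y * ?c e))"
    by (simp only: sum.atMost_Suc of_nat_mult_left_commute[of y]) (simp add: pencil_coeff_large)
  also have "(\<Sum>e\<le>k. of_nat t * x * (of_nat (t ^ e) * ?c e)) = (\<Sum>e\<le>k. of_nat (t ^ Suc e) * (x * ?c e))"
    by (simp only: mult.assoc of_nat_mult_left_commute[of x] power_Suc of_nat_mult)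
  also have "\<dots> = (\<Sum>e\<le>Suc k. of_nat (t ^ e) * (if e = 0 then 0 else x * ?c (e - 1)))"
    by (subst sum.atMost_Suc_shift) simp
  finally show ?case
    by (simp only: pencil_coeff.simps distrib_left sum.distrib)
qed simp

lemma pencil_coeff_top: "pencil_coeff x y k k = x ^ k"
  by (induction k) (auto simp: pencil_coeff_large)

text \<open>The part linear in \<open>y\<close> is the linearisation of the power identity.\<close>

lemma pencil_coeff_subtop: "pencil_coeff x y (Suc k) k = (\<Sum>i\<le>k. x ^ i * y * x ^ (k - i))"
proof (induction k)
  case (Suc k)
  have "pencil_coeff x y (Suc (Suc k)) (Suc k) = y * x ^ Suc k + x * pencil_coeff x y (Suc k) k"
    using pencil_coeff_top[of x y "Suc k"] by simp
  also have "\<dots> = (\<Sum>i\<le>Suc k. x ^ i * y * x ^ (Suc k - i))"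
    unfolding Suc.IH by (subst sum.atMost_Suc_shift) (simp add: sum_distrib_left mult.assoc)
  finally show ?case .
qed simp

text \<open>Higgins' proof: the linearised identity gives \<open>x\<^sup>n z y\<^sup>n \<in> N\<close>, and then the induction hypothesis
applies to each of the two outer factors.\<close>

theorem nagata_higman:
  fixes A N :: "'r::ring_1 set"
  assumes A: "\<And>x y. x \<in> A \<Longrightarrow> y \<in> A \<Longrightarrow> x + y \<in> A" "\<And>x y. x \<in> A \<Longrightarrow> y \<in> A \<Longrightarrow> x * y \<in> A"
    and "divisible_subgroup N" "\<And>a x. a \<in> A \<Longrightarrow> x \<in> N \<Longrightarrow> a * x \<in> N" "\<And>a x. a \<in> A \<Longrightarrow> x \<in> N \<Longrightarrow> x * a \<in> N"
    and "n > 0" "\<And>a. a \<in> A \<Longrightarrow> a ^ n \<in> N" and "length xs = 2 ^ n - 1" "set xs \<subseteq> A"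
  shows "prod_list xs \<in> N"
  using \<open>n > 0\<close> assms(3,4,5,7,8,9)
proof (induction n arbitrary: N xs rule: nat_induct_non_zero)
  case 1
  then show ?case by (cases xs) (auto simp: numeral_2_eq_2)
next
  case (Suc n)
  note N = Suc.prems(1) and NA = Suc.prems(2,3) and pow = Suc.prems(4)
  \<comment> \<open>\<open>A\<close> is closed under sums and products but may contain neither
    \<open>1\<close> nor \<open>0\<close>; exponents and multiples are kept positive.\<close>
  have powA: "x ^ k \<in> A" if "x \<in> A" "k > 0" for x k
    using that(2,1) by (induction k rule: nat_induct_non_zero) (auto intro: A)
  have natA: "of_nat t * x \<in> A" if "x \<in> A" "t > 0" for x t
    using that(2,1) by (induction t rule: nat_induct_non_zero) (auto intro: A simp: distrib_right)
  have Npow: "u * x ^ k \<in> N" "x ^ k * u \<in> N" if "u \<in> N" "x \<in> A" for u x k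
    using that NA powA[OF that(2)] by (cases "k = 0"; simp)+
  have lin: "(\<Sum>i\<le>n. x ^ i * y * x ^ (n - i)) \<in> N" if "x \<in> A" "y \<in> A" for x y
  proof -
    have "pencil_coeff x y (Suc n) n \<in> N"
    proof (rule polynomial_coefficients_mem[OF N, where v = "pencil_coeff x y (Suc n)" and D = "Suc n"])
      fix t :: nat assume "t > 0"
      then have "(y + of_nat t * x) ^ Suc n \<in> N" using that natA A pow by simp
      then show "(\<Sum>e\<le>Suc n. of_nat (t ^ e) * pencil_coeff x y (Suc n) e) \<in> N" by (simp only: pencil_power)
    qed simp
    then show ?thesis by (simp only: pencil_coeff_subtop)
  qed
  have lin': "(\<Sum>i\<le>n. x ^ (n - i) * y * x ^ i) \<in> N" if "x \<in> A" "y \<in> A" for x y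
  proof -
    have "(\<Sum>i\<le>n. x ^ (n - i) * y * x ^ i) = (\<Sum>i\<le>n. x ^ i * y * x ^ (n - i))"
      by (rule sum.reindex_bij_witness[where i = "\<lambda>i. n - i" and j = "\<lambda>i. n - i"]) auto
    then show ?thesis using lin[OF that] by simp
  qed
  have sandwich: "x ^ n * z * y ^ n \<in> N" if x: "x \<in> A" and y: "y \<in> A" and z: "z \<in> A" for x y z
  proof -
    \<comment> \<open>Summed over \<open>i\<close>, this is a linearised power with
      \<open>z * y ^ j\<close> in the middle; summed over \<open>j\<close> for fixed
      \<open>i > 0\<close>, it contains one with \<open>x ^ i\<close> in the middle. Both lie in
      \<open>N\<close>, which leaves \<open>i = 0\<close>, that is \<open>n + 1\<close> copies of
      \<open>x ^ n * z * y ^ n\<close>.\<close>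
    let ?T = "\<lambda>i j. x ^ (n - i) * z * y ^ j * x ^ i * y ^ (n - j)"
    have "(\<Sum>j\<le>n. \<Sum>i\<le>n. ?T i j) \<in> N"
    proof (rule divisible_subgroup_sum[OF N])
      fix j
      have "z * y ^ j \<in> A" using z powA[OF y, of j] A(2) by (cases "j = 0") auto
      then have "(\<Sum>i\<le>n. x ^ (n - i) * (z * y ^ j) * x ^ i) * y ^ (n - j) \<in> N"
        using Npow(1)[OF lin'[OF x] y] by blast
      then show "(\<Sum>i\<le>n. ?T i j) \<in> N" by (simp add: sum_distrib_right mult.assoc)
    qed
    then have "(\<Sum>i\<le>n. \<Sum>j\<le>n. ?T i j) \<in> N" by (subst sum.swap)
    moreover have "(\<Sum>i\<le>n. \<Sum>j\<le>n. ?T i j) = (\<Sum>j\<le>n. ?T 0 j) + (\<Sum>i<n. \<Sum>j\<le>n. ?T (Suc i) j)"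
      by (simp add: lessThan_Suc_atMost[symmetric] sum.lessThan_Suc_shift del: sum.lessThan_Suc)
    moreover have "(\<Sum>i<n. \<Sum>j\<le>n. ?T (Suc i) j) \<in> N"
    proof (rule divisible_subgroup_sum[OF N])
      fix i
      have "z * (\<Sum>j\<le>n. y ^ j * x ^ Suc i * y ^ (n - j)) \<in> N"
        using NA(1)[OF z lin[OF y powA[OF x]]] by blast
      from Npow(2)[OF this x, of "n - Suc i"]
      show "(\<Sum>j\<le>n. ?T (Suc i) j) \<in> N" by (simp add: sum_distrib_left mult.assoc)
    qed
    ultimately have "(\<Sum>j\<le>n. ?T 0 j) \<in> N"
      using divisible_subgroup_diff[OF N] by fastforce
    moreover have "(\<Sum>j\<le>n. ?T 0 j) = (\<Sum>j\<le>n. x ^ n * z * y ^ n)"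
      by (rule sum.cong) (auto simp: mult.assoc power_add[symmetric])
    ultimately have "of_nat (Suc n) * (x ^ n * z * y ^ n) \<in> N" by simp
    then show ?thesis by (rule divisible_subgroup_cancel[OF N, rotated]) simp
  qed
  have outer: "prod_list us * z * y ^ n \<in> N"
    if "length us = 2 ^ n - 1" "set us \<subseteq> A" "z \<in> A" "y \<in> A" for us z y
  proof -
    \<comment> \<open>The condition on \<open>u\<close> is additive and absorbs factors from
      \<open>A\<close>, and \<open>sandwich\<close> puts every \<open>a ^ n\<close> into
      \<open>M\<close>. So the induction hypothesis applies with \<open>M\<close> in place of
      \<open>N\<close>.\<close>
    define M where "M = {u. \<forall>z\<in>A. \<forall>y\<in>A. u * z * y ^ n \<in> N}"
    have "prod_list us \<in> M"
    proof (rule Suc.IH)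
      show "divisible_subgroup M"
        unfolding divisible_subgroup_def
      proof (intro conjI ballI allI impI)
        show "0 \<in> M" using divisible_subgroup_zero[OF N] by (simp add: M_def)
        show "u - v \<in> M" if "u \<in> M" "v \<in> M" for u v
          using that divisible_subgroup_diff[OF N] by (simp add: M_def left_diff_distrib)
        show "u \<in> M" if "k > 0" "of_nat k * u \<in> M" for k :: nat and u
          using that divisible_subgroup_cancel[OF N] by (simp add: M_def mult.assoc)
      qed
      show "a * u \<in> M" if "a \<in> A" "u \<in> M" for a u using that NA(1) by (simp add: M_def mult.assoc)
      show "u * a \<in> M" if "a \<in> A" "u \<in> M" for a u
        unfolding M_def
      proof (rule CollectI, intro ballI)
        fix z y assume "z \<in> A" "y \<in> A"
        then have "u * (a * z) * y ^ n \<in> N" using that A(2) by (simp add: M_def)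
        then show "u * a * z * y ^ n \<in> N" by (simp add: mult.assoc)
      qed
      show "a ^ n \<in> M" if "a \<in> A" for a using that sandwich by (simp add: M_def)
    qed (use that in auto)
    then show ?thesis using that by (simp add: M_def)
  qed
  \<comment> \<open>The same device for the right-hand factor; the left-hand factor is now already
    one of the products covered by \<open>outer\<close>.\<close>
  define M where "M = {v. \<forall>us. length us = 2 ^ n - 1 \<longrightarrow> set us \<subseteq> A \<longrightarrow> (\<forall>z\<in>A. prod_list us * z * v \<in> N)}"
  have inner: "prod_list vs \<in> M" if "length vs = 2 ^ n - 1" "set vs \<subseteq> A" for vs
  proof (rule Suc.IH)
    show "divisible_subgroup M"
      unfolding divisible_subgroup_def
    proof (intro conjI ballI allI impI)
      show "0 \<in> M" using divisible_subgroup_zero[OF N] by (simp add: M_def)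
      show "u - v \<in> M" if "u \<in> M" "v \<in> M" for u v
        using that divisible_subgroup_diff[OF N] by (simp add: M_def right_diff_distrib)
      show "u \<in> M" if "k > 0" "of_nat k * u \<in> M" for k :: nat and u
        unfolding M_def
      proof (rule CollectI, intro allI impI ballI)
        fix us z assume "length us = 2 ^ n - 1" "set us \<subseteq> A" "z \<in> A"
        then have "prod_list us * z * (of_nat k * u) \<in> N" using that by (simp add: M_def)
        then have "of_nat k * (prod_list us * z * u) \<in> N"
          by (simp only: of_nat_mult_left_commute[of "prod_list us * z" k u])
        then show "prod_list us * z * u \<in> N" by (rule divisible_subgroup_cancel[OF N that(1)])
      qed
    qed
    show "u * a \<in> M" if "a \<in> A" "u \<in> M" for a u using that NA(2) by (simp add: M_def mult.assoc[symmetric])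
    show "a * u \<in> M" if "a \<in> A" "u \<in> M" for a u
      unfolding M_def
    proof (rule CollectI, intro allI impI ballI)
      fix us z assume "length us = 2 ^ n - 1" "set us \<subseteq> A" "z \<in> A"
      then have "prod_list us * (z * a) * u \<in> N" using that A(2) by (simp add: M_def)
      then show "prod_list us * z * (a * u) \<in> N" by (simp add: mult.assoc)
    qed
    show "a ^ n \<in> M" if "a \<in> A" for a using that outer by (simp add: M_def)
  qed (use that in auto)
  define l where "l = 2 ^ n - (1::nat)"
  have "(2::nat) ^ n \<ge> 1" by simp
  \<comment> \<open>The length \<open>2 ^ Suc n - 1\<close> is that of two blocks of length
    \<open>2 ^ n - 1\<close> and one factor between them, which plays the part of
    \<open>z\<close>.\<close>
  then have len: "length xs = l + Suc l" using Suc.prems(5) unfolding l_def power_Suc by linarith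
  have xs: "xs = take l xs @ xs ! l # drop (Suc l) xs" using len id_take_nth_drop[of l xs] by simp
  have sub: "set (take l xs) \<subseteq> A" "xs ! l \<in> A" "set (drop (Suc l) xs) \<subseteq> A"
    using Suc.prems(6) len set_take_subset[of l xs] set_drop_subset[of "Suc l" xs] by auto
  have "prod_list (take l xs) * xs ! l * prod_list (drop (Suc l) xs) \<in> N"
    using inner[of "drop (Suc l) xs"] sub len by (simp add: M_def l_def)
  moreover have "prod_list xs = prod_list (take l xs) * xs ! l * prod_list (drop (Suc l) xs)"
    by (subst xs) (simp add: mult.assoc)
  ultimately show ?case by simp
qed

section \<open>Homogeneity\<close>

text \<open>Makes \<open>{0}\<close> a divisible subgroup, so that identities holding for all
  \<open>t\<close> can be compared coefficientwise.\<close>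

lemma T_ideal_zero: "T_ideal {0 :: ('a::field_char_0, 'n::finite) qpoly}"
  by (auto simp: T_ideal_def is_ideal_def qsubst_simps)

definition scale_vars :: "(nat \<Rightarrow> nat) \<Rightarrow> nat \<Rightarrow> nat \<Rightarrow> ('a::field, 'n::finite) qpoly" where
  "scale_vars \<omega> t k = of_nat (t ^ \<omega> k) * var k"

lemma qsubst_scale_vars:
  fixes p :: "('a::field, 'n::finite) qpoly"
  assumes "\<And>mw. mw \<in> keys p \<Longrightarrow> weight \<omega> mw \<le> D"
  shows "qsubst (scale_vars \<omega> t) p = (\<Sum>e\<le>D. of_nat (t ^ e) * restrict_keys (\<lambda>mw. weight \<omega> mw = e) p)"
proof -
  have "qsubst (scale_vars \<omega> t) (\<Sum>mw\<in>keys p. single mw (lookup p mw))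
      = (\<Sum>mw\<in>keys p. of_nat (t ^ weight \<omega> mw) * single mw (lookup p mw))"
    unfolding scale_vars_def by (simp add: qsubst_simps qsubst_scale_single del: of_nat_power)
  then have "qsubst (scale_vars \<omega> t) p
      = (\<Sum>mw\<in>keys p. of_nat (t ^ weight \<omega> mw) * single mw (lookup p mw))"
    by (simp only: poly_mapping_single_sum)
  also have "\<dots> = (\<Sum>mw\<in>keys p. \<Sum>e\<le>D.
      if weight \<omega> mw = e then of_nat (t ^ weight \<omega> mw) * single mw (lookup p mw) else 0)"
    using assms by (auto intro!: sum.cong simp: sum.delta)
  also have "\<dots> = (\<Sum>e\<le>D. of_nat (t ^ e) * restrict_keys (\<lambda>mw. weight \<omega> mw = e) p)"
    by (subst sum.swap) (auto simp: restrict_keys_def sum_distrib_left sum.inter_filter intro!: sum.cong)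
  finally show ?thesis .
qed

definition homogeneous :: "(nat \<Rightarrow> nat) \<Rightarrow> nat \<Rightarrow> ('a::field, 'n::finite) qpoly \<Rightarrow> bool" where
  "homogeneous \<omega> e p \<longleftrightarrow> (\<forall>mw\<in>keys p. weight \<omega> mw = e)"

lemma homogeneous_qsubst_scale:
  assumes "homogeneous \<omega> e p"
  shows "qsubst (scale_vars \<omega> t) p = of_nat (t ^ e) * p"
proof -
  have "qsubst (scale_vars \<omega> t) p = (\<Sum>f\<le>e. of_nat (t ^ f) * restrict_keys (\<lambda>mw. weight \<omega> mw = f) p)"
    using assms by (intro qsubst_scale_vars) (auto simp: homogeneous_def)
  also have "\<dots> = (\<Sum>f\<le>e. if f = e then of_nat (t ^ e) * p else 0)"
    using assms by (intro sum.cong) (auto simp: homogeneous_def restrict_keys_all restrict_keys_none)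
  also have "\<dots> = of_nat (t ^ e) * p" by simp
  finally show ?thesis .
qed

text \<open>Homogeneity is detected by rescaling. Rescaling composes with substitutions, so degrees
  can be followed without describing the keys of a substituted quasi-polynomial.\<close>

lemma homogeneousI:
  fixes p :: "('a::field_char_0, 'n::finite) qpoly"
  assumes scale: "\<And>t. qsubst (scale_vars \<omega> t) p = of_nat (t ^ e) * p"
  shows "homogeneous \<omega> e p"
  unfolding homogeneous_def
proof
  fix mw assume mw: "mw \<in> keys p"
  define D where "D = e + (\<Sum>mw\<in>keys p. weight \<omega> mw)"
  have D: "weight \<omega> mw \<le> D" if "mw \<in> keys p" for mw
    using member_le_sum[OF that, of "weight \<omega>"] by (simp add: D_def)
  let ?v = "\<lambda>f. restrict_keys (\<lambda>mw. weight \<omega> mw = f) p - (if f = e then p else 0)"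
  have "?v (weight \<omega> mw) \<in> {0}"
  proof (rule polynomial_coefficients_mem[OF divisible_subgroup_T_ideal[OF T_ideal_zero], where v = ?v and D = D])
    fix t :: nat
    have "(\<Sum>f\<le>D. of_nat (t ^ f) * ?v f)
        = (\<Sum>f\<le>D. of_nat (t ^ f) * restrict_keys (\<lambda>mw. weight \<omega> mw = f) p) - (\<Sum>f\<le>D. if f = e then of_nat (t ^ f) * p else 0)"
      unfolding sum_subtractf[symmetric] by (intro sum.cong) (auto simp: algebra_simps)
    also have "\<dots> = qsubst (scale_vars \<omega> t) p - of_nat (t ^ e) * p"
      using qsubst_scale_vars[of p \<omega> D t] D by (simp add: D_def del: of_nat_power)
    finally show "(\<Sum>f\<le>D. of_nat (t ^ f) * ?v f) \<in> {0}" using scale by simp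
  qed (use D mw in auto)
  then have "weight \<omega> mw = e \<or> restrict_keys (\<lambda>mw'. weight \<omega> mw' = weight \<omega> mw) p = 0"
    by (auto split: if_splits)
  then show "weight \<omega> mw = e"
    using mw by (metis (mono_tags, lifting) in_keys_iff lookup_restrict_keys lookup_zero)
qed

lemma qsubst_cong_scale:
  assumes "\<And>k. qsubst (scale_vars \<omega> t) (H k) = of_nat (t ^ \<omega>' k) * H k"
  shows "qsubst (scale_vars \<omega> t) (qsubst H p) = qsubst H (qsubst (scale_vars \<omega>' t) p)"
  by (simp add: qsubst_qsubst assms scale_vars_def qsubst_simps ring_hom_of_nat[OF ring_hom_qsubst])

lemma homogeneous_qsubst:
  fixes p :: "('a::field_char_0, 'n::finite) qpoly"
  assumes H: "\<And>k. homogeneous \<omega> (\<omega>' k) (H k)" and p: "homogeneous \<omega>' e p"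
  shows "homogeneous \<omega> e (qsubst H p)"
proof (rule homogeneousI)
  fix t
  have "qsubst (scale_vars \<omega> t) (qsubst H p) = qsubst H (qsubst (scale_vars \<omega>' t) p)"
    by (intro qsubst_cong_scale homogeneous_qsubst_scale H)
  then show "qsubst (scale_vars \<omega> t) (qsubst H p) = of_nat (t ^ e) * qsubst H p"
    by (simp add: homogeneous_qsubst_scale[OF p] qsubst_simps ring_hom_of_nat[OF ring_hom_qsubst])
qed

lemma keys_var: "keys (var k :: ('a::field, 'n::finite) qpoly) = {(0, Word [k])}"
  by (simp add: var_def)

lemma homogeneous_var: "homogeneous \<omega> (\<omega> k) (var k)"
  by (simp add: homogeneous_def keys_var weight_def)

lemma homogeneous_add: "homogeneous \<omega> e p \<Longrightarrow> homogeneous \<omega> e q \<Longrightarrow> homogeneous \<omega> e (p + q)"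
  using Poly_Mapping.keys_add[of p q] by (auto simp: homogeneous_def)

lemma homogeneous_rename:
  fixes p :: "('a::field_char_0, 'n::finite) qpoly"
  shows "homogeneous (\<lambda>k. \<omega> (h k)) e p \<Longrightarrow> homogeneous \<omega> e (qsubst (\<lambda>k. var (h k)) p)"
  by (rule homogeneous_qsubst[where \<omega>' = "\<lambda>k. \<omega> (h k)"]) (auto intro: homogeneous_var)

lemma weight_additive: "weight (\<lambda>k. \<omega> k + \<omega>' k) mw = weight \<omega> mw + weight \<omega>' mw"
  by (simp add: weight_def distrib_left sum.distrib sum_list_addf)

definition key_vars :: "'n cmon \<times> word \<Rightarrow> nat set" where
  "key_vars mw = set (unword (snd mw)) \<union> fst ` keys (fst mw)"

lemma finite_key_vars: "finite (key_vars mw)"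
  by (simp add: key_vars_def)

lemma qvars_eq: "qvars p = (\<Union>mw\<in>keys p. key_vars mw)"
  unfolding qvars_def key_vars_def by force

lemma finite_qvars: "finite (qvars p)"
  by (simp add: qvars_eq finite_key_vars)

lemma weight_zero_iff: "weight \<omega> mw = 0 \<longleftrightarrow> (\<forall>k\<in>key_vars mw. \<omega> k = 0)"
  unfolding weight_def key_vars_def by (auto simp: in_keys_iff sum_list_eq_0_iff)

lemma degree_in_zero_iff: "degree_in k mw = 0 \<longleftrightarrow> k \<notin> key_vars mw"
  by (auto simp: weight_zero_iff)

lemma mon_eval_cong: "(\<And>v. v \<in> keys m \<Longrightarrow> A (fst v) = A' (fst v)) \<Longrightarrow> mon_eval A m = mon_eval A' m"
  unfolding mon_eval_def by (intro prod.cong) auto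

lemma qsubst_single_cong:
  assumes "\<And>k. k \<in> key_vars mw \<Longrightarrow> H k = H' k"
  shows "qsubst H (single mw c) = qsubst H' (single mw c)"
proof (cases mw)
  case (Pair m w)
  have "mon_eval (\<lambda>k. Phi (H k)) m = mon_eval (\<lambda>k. Phi (H' k)) m"
    using assms Pair by (intro mon_eval_cong) (auto simp: key_vars_def)
  moreover have "wsubst H (unword w) = wsubst H' (unword w)"
    using assms Pair by (intro wsubst_cong) (auto simp: key_vars_def)
  ultimately show ?thesis by (simp add: Pair qsubst_single)
qed

lemma qsubst_sum_single: "qsubst H p = (\<Sum>mw\<in>keys p. qsubst H (single mw (lookup p mw)))"
  by (subst poly_mapping_single_sum[of p, symmetric]) (simp only: qsubst_simps)

lemma qsubst_cong:
  assumes "\<And>k. k \<in> qvars p \<Longrightarrow> H k = H' k"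
  shows "qsubst H p = qsubst H' p"
  using assms unfolding qsubst_sum_single[of _ p]
  by (intro sum.cong refl qsubst_single_cong) (auto simp: qvars_eq)

section \<open>Multilinearisation\<close>

text \<open>Differentiating \<open>p(\<dots>, x\<^sub>k + t y, \<dots>)\<close> at \<open>t = 0\<close> and substituting \<open>y = x\<^sub>k\<close>: Euler's identity.\<close>

lemma euler_identity:
  fixes p :: "('a::field_char_0, 'n::finite) qpoly"
  assumes y: "y \<notin> qvars p" "y \<noteq> k" and p: "homogeneous (\<lambda>l. if l = k then 1 else 0) d p"
  defines "p' \<equiv> qsubst (var(k := var k + var y)) p"
  shows "qsubst (var(y := var k)) (restrict_keys (\<lambda>mw. degree_in y mw = 1) p') = of_nat d * p"
proof -
  let ?E = "qsubst (var(y := var k))"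
  let ?r = "\<lambda>f. restrict_keys (\<lambda>mw. degree_in y mw = f) p'"
  define D where "D = d + 1 + (\<Sum>mw\<in>keys p'. degree_in y mw)"
  have D: "degree_in y mw \<le> D" if "mw \<in> keys p'" for mw
    using member_le_sum[OF that, of "degree_in y"] by (simp add: D_def)
  \<comment> \<open>Once \<open>x_y\<close> is set to \<open>x_k\<close>, replacing
    \<open>x_k\<close> by \<open>x_k + t x_y\<close> amounts to replacing it by
    \<open>(1 + t) x_k\<close>. The coefficient of \<open>t ^ f\<close> is therefore
    \<open>d choose f\<close> times \<open>p\<close>; the case \<open>f = 1\<close> is
    wanted.\<close>
  let ?v = "\<lambda>f. ?E (?r f) - of_nat (d choose f) * p"
  have "?v 1 \<in> {0}"
  proof (rule polynomial_coefficients_mem[OF divisible_subgroup_T_ideal[OF T_ideal_zero], where v = ?v and D = D])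
    fix t :: nat
    have "?E (qsubst (scale_vars (\<lambda>l. if l = y then 1 else 0) t) p')
        = qsubst (\<lambda>l. ?E (qsubst (scale_vars (\<lambda>l. if l = y then 1 else 0) t) ((var(k := var k + var y)) l))) p"
      unfolding p'_def by (simp only: qsubst_qsubst)
    also have "\<dots> = qsubst (scale_vars (\<lambda>l. if l = k then 1 else 0) (1 + t)) p"
      using y by (intro qsubst_cong)
        (auto simp: scale_vars_def qsubst_simps ring_hom_of_nat[OF ring_hom_qsubst] distrib_right)
    also have "\<dots> = of_nat ((1 + t) ^ d) * p" by (rule homogeneous_qsubst_scale[OF p])
    finally have 1: "?E (qsubst (scale_vars (\<lambda>l. if l = y then 1 else 0) t) p') = of_nat ((1 + t) ^ d) * p" .
    have "(1 + t) ^ d = (\<Sum>f\<le>d. (d choose f) * t ^ f)" using binomial[of t 1 d] by simp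
    also have "\<dots> = (\<Sum>f\<le>D. (d choose f) * t ^ f)"
      by (rule sum.mono_neutral_left) (auto simp: D_def)
    finally have 2: "of_nat ((1 + t) ^ d) * p = (\<Sum>f\<le>D. of_nat (t ^ f) * (of_nat (d choose f) * p))"
    proof -
      assume eq: "(1 + t) ^ d = (\<Sum>f\<le>D. (d choose f) * t ^ f)"
      have "of_nat ((d choose f) * t ^ f) * p = of_nat (t ^ f) * (of_nat (d choose f) * p)" for f
        by (simp only: mult.commute[of "d choose f"] of_nat_mult mult.assoc)
      then show ?thesis unfolding eq of_nat_sum sum_distrib_right by (simp only:)
    qed
    have 3: "?E (qsubst (scale_vars (\<lambda>l. if l = y then 1 else 0) t) p') = (\<Sum>f\<le>D. of_nat (t ^ f) * ?E (?r f))"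
      by (subst qsubst_scale_vars[OF D]) (simp_all add: qsubst_simps ring_hom_of_nat[OF ring_hom_qsubst] del: of_nat_power)
    have "(\<Sum>f\<le>D. of_nat (t ^ f) * ?v f) = (\<Sum>f\<le>D. of_nat (t ^ f) * ?E (?r f)) - (\<Sum>f\<le>D. of_nat (t ^ f) * (of_nat (d choose f) * p))"
      unfolding sum_subtractf[symmetric] by (simp only: right_diff_distrib)
    also have "\<dots> = 0" unfolding 3[symmetric] 2[symmetric] 1 by simp
    finally show "(\<Sum>f\<le>D. of_nat (t ^ f) * ?v f) \<in> {0}" by simp
  qed (simp add: D_def)
  then show ?thesis by simp
qed

definition multihomogeneous :: "(nat \<Rightarrow> nat) \<Rightarrow> ('a::field, 'n::finite) qpoly \<Rightarrow> bool" where
  "multihomogeneous e p \<longleftrightarrow> (\<forall>k. homogeneous (\<lambda>l. if l = k then 1 else 0) (e k) p)"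

lemma multihomogeneous_degree_zero:
  assumes "multihomogeneous e p" "p \<noteq> 0"
  shows "e k \<noteq> 0 \<longleftrightarrow> k \<in> qvars p"
proof -
  have "keys p \<noteq> {}" using assms(2) by simp
  then obtain mw where mw: "mw \<in> keys p" by blast
  have "degree_in k mw' = e k" if "mw' \<in> keys p" for mw'
    using that assms(1) by (auto simp: multihomogeneous_def homogeneous_def)
  then have "e k \<noteq> 0 \<longleftrightarrow> k \<in> key_vars mw'" if "mw' \<in> keys p" for mw'
    using that degree_in_zero_iff[of k mw'] by metis
  then show ?thesis using mw unfolding qvars_eq by blast
qed

text \<open>Induction on the total excess of the degrees over one. A variable of degree at least two
  hands one degree to a fresh \<open>x_y\<close>; Euler's identity then returns \<open>e k\<close>
  times the original, and \<open>e k\<close> can be cancelled.\<close>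

lemma multihomogeneous_quasi_id_in:
  fixes I :: "('a::field_char_0, 'n::finite) qpoly set"
  assumes I: "T_ideal I"
    and multilinear: "\<And>P q. finite P \<Longrightarrow> q \<in> quasi_ids \<Longrightarrow> multihomogeneous (\<lambda>k. if k \<in> P then 1 else 0) q \<Longrightarrow> q \<in> I"
    and p: "p \<in> quasi_ids" "multihomogeneous e p" "finite {k. e k \<noteq> 0}"
  shows "p \<in> I"
  using p
proof (induction "\<Sum>k | e k \<noteq> 0. e k - 1" arbitrary: p e rule: less_induct)
  case less
  show ?case
  proof (cases "\<exists>k. e k \<ge> 2")
    case False
    then have "e = (\<lambda>k. if k \<in> {k. e k \<noteq> 0} then 1 else 0)"
    proof (intro ext)
      fix k
      have "e k < 2" using False by (meson not_le)
      then show "e k = (if k \<in> {k. e k \<noteq> 0} then 1 else 0)" by (cases "e k = 0") auto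
    qed
    then show ?thesis using multilinear[OF less.prems(3,1)] less.prems(2) by simp
  next
    case True
    then obtain k where k: "e k \<ge> 2" by blast
    show ?thesis
    proof (cases "p = 0")
      case True then show ?thesis using T_idealD(1)[OF I] by simp
    next
      case nz: False
      obtain y where y: "y \<notin> {k. e k \<noteq> 0}" using ex_new_if_finite[OF infinite_UNIV_nat less.prems(3)] by blast
      have yk: "y \<noteq> k" and yp: "y \<notin> qvars p"
        using y k multihomogeneous_degree_zero[OF less.prems(2) nz, of y] by auto
      define p' where "p' = qsubst (var(k := var k + var y)) p"
      define q where "q = restrict_keys (\<lambda>mw. degree_in y mw = 1) p'"
      define e' where "e' = e(k := e k - 1, y := 1)"
      have "p' \<in> quasi_ids" unfolding p'_def using T_idealD(5)[OF T_ideal_quasi_ids less.prems(1)] .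
      then have "q \<in> quasi_ids" unfolding q_def by (rule weight_component_T_ideal[OF T_ideal_quasi_ids])
      moreover have "multihomogeneous e' q"
        unfolding multihomogeneous_def
      proof
        fix l
        let ?\<delta> = "\<lambda>i l. if l = i then 1 else 0 :: nat"
        have sub: "homogeneous \<omega> d p' \<Longrightarrow> homogeneous \<omega> d q" for \<omega> d
          by (auto simp: q_def homogeneous_def keys_restrict_keys)
        have ph: "homogeneous (?\<delta> l) (e l) p" for l
          using less.prems(2) by (auto simp: multihomogeneous_def)
        show "homogeneous (?\<delta> l) (e' l) q"
        proof -
          consider "l = y" | "l = k" | "l \<noteq> y" "l \<noteq> k" by blast
          then show ?thesis
          proof cases
            case 1
            then show ?thesis by (auto simp: e'_def q_def homogeneous_def keys_restrict_keys)
          next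
            case 2
            \<comment> \<open>The substitution preserves only the joint degree in \<open>x_k\<close>
              and \<open>x_y\<close>. As \<open>q\<close> has degree one in \<open>x_y\<close>, its
              degree in \<open>x_k\<close> is \<open>e k - 1\<close>.\<close>
            let ?\<omega> = "\<lambda>i. ?\<delta> k i + ?\<delta> y i"
            have hp: "homogeneous ?\<omega> (e k + e y) p"
              using ph[of k] ph[of y] by (auto simp: homogeneous_def weight_additive)
            have hH: "homogeneous ?\<omega> (?\<omega> i) ((var(k := var k + var y)) i)" for i
              using homogeneous_var[of ?\<omega> i] homogeneous_add[of ?\<omega> 1 "var k" "var y"]
                homogeneous_var[of ?\<omega> k] homogeneous_var[of ?\<omega> y] yk by auto
            have "homogeneous ?\<omega> (e k + e y) p'"
              unfolding p'_def by (rule homogeneous_qsubst[OF hH hp])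
            then have "degree_in k mw + degree_in y mw = e k" if "mw \<in> keys p'" for mw
              using that y by (auto simp: homogeneous_def weight_additive)
            then show ?thesis using 2 yk by (auto simp: e'_def q_def homogeneous_def keys_restrict_keys)
                (metis add_diff_cancel_right' One_nat_def)+
          next
            case 3
            have hH: "homogeneous (?\<delta> l) (?\<delta> l i) ((var(k := var k + var y)) i)" for i
              using homogeneous_var[of "?\<delta> l" i] homogeneous_add[of "?\<delta> l" 0 "var k" "var y"]
                homogeneous_var[of "?\<delta> l" k] homogeneous_var[of "?\<delta> l" y] 3 by auto
            have "homogeneous (?\<delta> l) (e l) p'"
              unfolding p'_def by (rule homogeneous_qsubst[OF hH ph])
            then show ?thesis using 3 sub by (simp add: e'_def)
          qed
        qed
      qed
      moreover have "(\<Sum>k | e' k \<noteq> 0. e' k - 1) < (\<Sum>k | e k \<noteq> 0. e k - 1)" and fin: "finite {k. e' k \<noteq> 0}"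
      proof -
        let ?S = "insert y {k. e k \<noteq> 0}"
        have S: "finite ?S" using less.prems(3) by simp
        have sub: "{k. e' k \<noteq> 0} \<subseteq> ?S" by (auto simp: e'_def split: if_splits)
        then show "finite {k. e' k \<noteq> 0}" using S finite_subset by blast
        have "(\<Sum>k | e' k \<noteq> 0. e' k - 1) = (\<Sum>k\<in>?S. e' k - 1)"
          using S sub by (intro sum.mono_neutral_left) auto
        also have "\<dots> < (\<Sum>k\<in>?S. e k - 1)"
        proof (rule sum_strict_mono_ex1[OF S])
          show "\<forall>x\<in>?S. e' x - 1 \<le> e x - 1" by (auto simp: e'_def)
          show "\<exists>x\<in>?S. e' x - 1 < e x - 1" using k yk by (intro bexI[of _ k]) (auto simp: e'_def)
        qed
        also have "\<dots> = (\<Sum>k | e k \<noteq> 0. e k - 1)"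
          using S y by (intro sum.mono_neutral_right) auto
        finally show "(\<Sum>k | e' k \<noteq> 0. e' k - 1) < (\<Sum>k | e k \<noteq> 0. e k - 1)" .
      qed
      ultimately have "q \<in> I" using less.hyps by blast
      then have "qsubst (var(y := var k)) q \<in> I" by (rule T_idealD(5)[OF I])
      moreover have "qsubst (var(y := var k)) q = of_nat (e k) * p"
        unfolding q_def p'_def using less.prems(2) by (intro euler_identity yp yk) (auto simp: multihomogeneous_def)
      ultimately have "of_nat (e k) * p \<in> I" by simp
      then show ?thesis
        by (rule divisible_subgroup_cancel[OF divisible_subgroup_T_ideal[OF I], rotated]) (use k in simp)
    qed
  qed
qed

lemma quasi_ids_subset_if_multilinear:
  fixes I :: "('a::field_char_0, 'n::finite) qpoly set"
  assumes I: "T_ideal I"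
    and multilinear: "\<And>P q. finite P \<Longrightarrow> q \<in> quasi_ids \<Longrightarrow> multihomogeneous (\<lambda>k. if k \<in> P then 1 else 0) q \<Longrightarrow> q \<in> I"
  shows "quasi_ids \<subseteq> I"
proof
  fix p :: "('a, 'n) qpoly" assume p: "p \<in> quasi_ids"
  define dg where "dg mw = (\<lambda>k. degree_in k mw)" for mw :: "'n cmon \<times> word"
  let ?c = "\<lambda>e. restrict_keys (\<lambda>mw. dg mw = e) p"
  have "p = (\<Sum>e\<in>dg ` keys p. ?c e)"
  proof (rule poly_mapping_eqI)
    fix mw
    show "lookup p mw = lookup (\<Sum>e\<in>dg ` keys p. ?c e) mw"
      by (auto simp: lookup_sum lookup_restrict_keys sum.delta in_keys_iff)
  qed
  also have "\<dots> \<in> I"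
  proof (rule T_ideal_sum[OF I])
    fix e assume "e \<in> dg ` keys p"
    then obtain mw0 where mw0: "mw0 \<in> keys p" "e = dg mw0" by blast
    have out: "degree_in k mw = 0" if "mw \<in> keys p" "k \<notin> qvars p" for k mw
      using that by (auto simp: degree_in_zero_iff qvars_eq)
    \<comment> \<open>All degrees vanish outside \<open>qvars p\<close>, so equality of degree
      functions can be tested on this finite set.\<close>
    have "?c e = restrict_keys (\<lambda>mw. \<forall>k\<in>qvars p. degree_in k mw = e k) p"
    proof (rule poly_mapping_eqI)
      fix mw
      have "dg mw = e \<longleftrightarrow> (\<forall>k\<in>qvars p. degree_in k mw = e k)" if "mw \<in> keys p"
        using out[OF that] out[OF mw0(1)] unfolding mw0(2) dg_def fun_eq_iff by metis
      then show "lookup (?c e) mw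
          = lookup (restrict_keys (\<lambda>mw. \<forall>k\<in>qvars p. degree_in k mw = e k) p) mw"
        by (cases "mw \<in> keys p") (auto simp: lookup_restrict_keys in_keys_iff)
    qed
    then have "?c e \<in> quasi_ids"
      using multidegree_component_T_ideal[OF finite_qvars T_ideal_quasi_ids p] by simp
    moreover have "multihomogeneous e (?c e)"
      by (auto simp: multihomogeneous_def homogeneous_def keys_restrict_keys dg_def)
    moreover have "{k. e k \<noteq> 0} \<subseteq> key_vars mw0"
      unfolding mw0(2) dg_def by (auto simp: degree_in_zero_iff)
    then have "finite {k. e k \<noteq> 0}" using finite_key_vars finite_subset by blast
    ultimately show "?c e \<in> I" using multilinear by (rule multihomogeneous_quasi_id_in[OF I, rotated 1])
  qed
  finally show "p \<in> I" .
qed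

section \<open>Reduction to short words\<close>

text \<open>Taking constant terms is an evaluation, hence a ring homomorphism; constant terms of
  traces are then computed on zero matrices.\<close>

lemma ceval_at_zero:
  fixes c :: "('a::field, 'n::finite) cpoly"
  shows "ceval id (\<lambda>_. 0) c = lookup c 0"
proof (induction c rule: poly_mapping_single_induct)
  case zero
  show ?case by (simp add: ceval_def)
next
  case (add m a c)
  have "mon_eval (\<lambda>_. 0 :: 'a^'n^'n) m = (if m = 0 then 1 else 0)"
  proof (cases "m = 0")
    case False
    then have "keys m \<noteq> {}" by simp
    then obtain v where "v \<in> keys m" by blast
    then show ?thesis using False unfolding mon_eval_def
      by (auto intro!: prod_zero bexI[of _ v] simp: zero_power_eq in_keys_iff)
  qed simp
  then have "ceval id (\<lambda>_. 0) (single m a) = lookup (single m a) 0"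
    by (auto simp: ceval_single[OF ring_hom_id(1)] lookup_single)
  with add show ?case by (simp only: ring_homD(3)[OF ring_hom_ceval[OF ring_hom_id(1)]] lookup_add)
qed

lemma wprod_zero_matrices: "w \<noteq> 0 \<Longrightarrow> wprod (\<lambda>_. 0) w = 0"
  by (cases "unword w") (auto simp: wprod_def zero_word_def matrix_mult_distribs intro: word.expand)

lemma geval_at_zero:
  fixes p :: "('a::field, 'n::finite) qpoly"
  shows "geval id (\<lambda>_. 0) p = mat (lookup p 0)"
proof (induction p rule: poly_mapping_single_induct)
  case zero
  show ?case by (simp add: vec_eq_iff mat_def)
next
  case (add k c p)
  obtain m w where k: "k = (m, w)" by (cases k)
  have "mon_eval (\<lambda>_. 0 :: 'a^'n^'n) m = (if m = 0 then 1 else 0)"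
    using ceval_at_zero[of "single m (1::'a)"] by (simp add: ceval_single[OF ring_hom_id(1)] lookup_single)
  then have "geval id (\<lambda>_. 0) (single k c) = mat (lookup (single k c) 0)"
    by (cases "w = 0") (auto simp: k vec_eq_iff geval_single[OF ring_hom_id(1)] mat_def lookup_single zero_prod_def when_def wprod_zero_matrices)
  with add show ?case by (simp only: geval_add[OF ring_hom_id(1)] lookup_add) (simp add: vec_eq_iff mat_def)
qed

lemma lookup_mult_zero: "lookup (p * q) 0 = lookup p 0 * lookup q 0"
  for p q :: "('a::field, 'n::finite) qpoly"
proof -
  have "mat (lookup (p * q) 0) = ((mat (lookup p 0) :: 'a^'n^'n) ** (mat (lookup q 0) :: 'a^'n^'n))"
    unfolding geval_at_zero[symmetric] by (rule geval_mult[OF ring_hom_id(1)])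
  from arg_cong[OF this, of "\<lambda>M. M $ undefined $ undefined"]
  have "(mat (lookup (p * q) 0) :: 'a^'n^'n) $ undefined $ undefined
      = ((mat (lookup p 0) :: 'a^'n^'n) ** (mat (lookup q 0) :: 'a^'n^'n)) $ undefined $ undefined" .
  then show ?thesis unfolding mat_mult_nth by (simp add: mat_def)
qed

section \<open>Working modulo coefficients of positive degree\<close>

definition positive_coeffs :: "('a::field, 'n::finite) qpoly \<Rightarrow> bool" where
  "positive_coeffs p \<longleftrightarrow> (\<forall>mw\<in>keys p. fst mw \<noteq> 0)"

lemma positive_coeffs_zero: "positive_coeffs 0"
  by (simp add: positive_coeffs_def)

lemma positive_coeffs_add: "positive_coeffs p \<Longrightarrow> positive_coeffs q \<Longrightarrow> positive_coeffs (p + q)"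
  using Poly_Mapping.keys_add[of p q] unfolding positive_coeffs_def by blast

lemma positive_coeffs_sum: "(\<And>i. i \<in> A \<Longrightarrow> positive_coeffs (f i)) \<Longrightarrow> positive_coeffs (sum f A)"
  by (induction A rule: infinite_finite_induct) (auto simp: positive_coeffs_zero positive_coeffs_add)

lemma cmon_add_eq_zero: "m + m' = 0 \<longleftrightarrow> m = 0 \<and> m' = (0 :: 'n cmon)"
  by (auto simp: poly_mapping_eq_iff lookup_add fun_eq_iff)

lemma positive_coeffs_mult: "positive_coeffs p \<or> positive_coeffs q \<Longrightarrow> positive_coeffs (p * q)"
proof -
  assume a: "positive_coeffs p \<or> positive_coeffs q"
  show "positive_coeffs (p * q)"
    unfolding positive_coeffs_def
  proof
    fix mw assume "mw \<in> keys (p * q)"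
    then obtain k l where "mw = k + l" "k \<in> keys p" "l \<in> keys q"
      using Poly_Mapping.keys_mult[of p q] by blast
    then show "fst mw \<noteq> 0" using a by (auto simp: positive_coeffs_def cmon_add_eq_zero)
  qed
qed

lemma positive_coeffs_cembed:
  fixes c :: "('a::field, 'n::finite) cpoly"
  assumes c: "lookup c 0 = 0"
  shows "positive_coeffs (cembed c)"
proof -
  have "positive_coeffs (single (m, 0) a)" if "m \<in> keys c" for m and a :: 'a
  proof -
    have "m \<noteq> 0" using that c by (auto simp: in_keys_iff)
    then show ?thesis by (auto simp: positive_coeffs_def split: if_splits)
  qed
  then show ?thesis unfolding cembed_def by (intro positive_coeffs_sum)
qed

lemma perm_trace_hom:
  fixes h :: "'r::comm_ring_1 \<Rightarrow> 's::comm_ring_1"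
  shows "ring_hom h \<Longrightarrow> h (perm_trace S B \<sigma>) = perm_trace S (\<lambda>p. map_mat h (B p)) \<sigma>"
  by (simp add: perm_trace_def ring_hom_sum ring_hom_prod)

lemma is_cycle_permutes_unique:
  assumes "is_cycle \<sigma> l" "is_cycle \<sigma>' l" "\<sigma> permutes set l" "\<sigma>' permutes set l"
  shows "\<sigma> = \<sigma>'"
proof
  fix x
  have "chain \<sigma> k t \<Longrightarrow> chain \<sigma>' k t \<Longrightarrow> x \<in> set k \<Longrightarrow> \<sigma> x = \<sigma>' x" for k t
    by (induction k) auto
  then show "\<sigma> x = \<sigma>' x"
    using assms by (cases "x \<in> set l") (auto simp: is_cycle_def permutes_not_in)
qed

text \<open>Modulo positive coefficients, quasi-polynomials become the free algebra over the field,
  and Cayley-Hamilton becomes a nil identity. Substitutions with constant terms do not respect this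
  passage, so only ideal properties are carried over.\<close>

definition modulo_positive :: "('a::field, 'n::finite) qpoly set \<Rightarrow> ('a, 'n) qpoly set" where
  "modulo_positive I = {i + r | i r. i \<in> I \<and> positive_coeffs r}"

lemma modulo_positive_ideal:
  assumes I: "T_ideal I"
  shows "a \<in> modulo_positive I \<Longrightarrow> r * a \<in> modulo_positive I" "a \<in> modulo_positive I \<Longrightarrow> a * r \<in> modulo_positive I"
    "a \<in> modulo_positive I \<Longrightarrow> b \<in> modulo_positive I \<Longrightarrow> a - b \<in> modulo_positive I"
    "a \<in> I \<Longrightarrow> a \<in> modulo_positive I" "positive_coeffs a \<Longrightarrow> a \<in> modulo_positive I"
proof -
  show "r * a \<in> modulo_positive I" if "a \<in> modulo_positive I"
    using that unfolding modulo_positive_def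
    by (auto simp: distrib_left intro!: T_idealD(3)[OF I] positive_coeffs_mult)
      (metis T_idealD(3)[OF I] positive_coeffs_mult)
  show "a * r \<in> modulo_positive I" if "a \<in> modulo_positive I"
    using that unfolding modulo_positive_def
    by (auto simp: distrib_right) (metis T_idealD(4)[OF I] positive_coeffs_mult)
  show "a - b \<in> modulo_positive I" if ab: "a \<in> modulo_positive I" "b \<in> modulo_positive I"
  proof -
    obtain i r j q where *: "a = i + r" "b = j + q" "i \<in> I" "j \<in> I" "positive_coeffs r" "positive_coeffs q"
      using ab unfolding modulo_positive_def by blast
    have "positive_coeffs (r + (- 1) * q)" using * by (intro positive_coeffs_add positive_coeffs_mult) auto
    moreover have "a - b = (i - j) + (r + (- 1) * q)" using * by simp
    ultimately show ?thesis unfolding modulo_positive_def using T_idealD(7)[OF I *(3,4)] by blast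
  qed
  show "a \<in> modulo_positive I" if "a \<in> I"
    using that positive_coeffs_zero unfolding modulo_positive_def by force
  show "a \<in> modulo_positive I" if "positive_coeffs a"
    using that T_idealD(1)[OF I] unfolding modulo_positive_def by force
qed

lemma divisible_subgroup_modulo_positive:
  fixes I :: "('a::field_char_0, 'n::finite) qpoly set"
  assumes I: "T_ideal I"
  shows "divisible_subgroup (modulo_positive I)"
  unfolding divisible_subgroup_def
proof (intro conjI ballI allI impI)
  show "0 \<in> modulo_positive I" using modulo_positive_ideal(4)[OF I T_idealD(1)[OF I]] .
  show "x \<in> modulo_positive I" if "k > 0" "of_nat k * x \<in> modulo_positive I" for k :: nat and x
    using modulo_positive_ideal(1)[OF I that(2), of "single 0 (1 / of_nat k)"] of_nat_cancel[OF that(1), of x]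
    by simp
qed (use modulo_positive_ideal(3)[OF I] in auto)

lemma wsubst_const: "(\<And>k. k \<in> set w \<Longrightarrow> b k = a) \<Longrightarrow> wsubst b w = a ^ length w"
  by (induction w) auto

text \<open>In the Cayley-Hamilton polynomial put \<open>1\<close> for \<open>x_0\<close> and
  \<open>a\<close> for the other variables. Each full cycle gives \<open>a ^ n\<close> with sign
  \<open>(-1) ^ n\<close>. Any other permutation carries traces of powers of \<open>a\<close> as
  coefficients, and these have no constant term because \<open>a\<close> has none.\<close>

lemma power_in_modulo_positive:
  fixes I :: "('a::field_char_0, 'n::finite) qpoly set"
  assumes I: "T_ideal I" "cayley_hamilton \<in> I" and a: "lookup a 0 = 0"
  shows "a ^ CARD('n) \<in> modulo_positive I"
proof -
  let ?n = "CARD('n)"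
  let ?P = "{..?n}" and ?b = "\<lambda>k::nat. if k = 0 then 1 else a"
  define F where "F = {\<tau>. \<tau> permutes ?P \<and> set (cycle_from \<tau> 0) = ?P}"
  let ?G = "{\<tau>. \<tau> permutes ?P \<and> set (cycle_from \<tau> 0) \<noteq> ?P}"
  let ?t = "\<lambda>\<tau>. of_int (sign \<tau>) * trace_monomial ?P 0 ?b \<tau>"
  have finP: "finite {\<tau>. \<tau> permutes ?P}" by (rule finite_permutations) simp
  have fin: "finite F" "finite ?G" unfolding F_def by (rule finite_subset[OF _ finP], blast)+
  have full: "?t \<tau> = of_int ((-1) ^ ?n) * a ^ ?n" if "\<tau> \<in> F" for \<tau>
  proof -
    have \<tau>: "\<tau> permutes ?P" and set: "set (cycle_from \<tau> 0) = ?P" using that by (auto simp: F_def)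
    note c = cycle_from_props[OF _ \<tau>, of 0]
    obtain ws where ws: "cycle_from \<tau> 0 = 0 # ws" using c(1,2) by (cases "cycle_from \<tau> 0") (auto simp: is_cycle_def)
    have dist: "distinct (0 # ws)" and cyc: "is_cycle \<tau> (0 # ws)" using c(1) ws by (auto simp: is_cycle_def)
    have "length (0 # ws) = card ?P" using distinct_card[OF dist] set ws by simp
    then have len: "length ws = ?n" by simp
    obtain c where "c permutes set (0 # ws)" "is_cycle c (0 # ws)" "sign c = (-1) ^ length ws"
      using cycle_of_distinct_list[OF dist] by blast
    moreover have "\<tau> permutes set (0 # ws)" using \<tau> set ws by simp
    ultimately have sgn: "sign \<tau> = (-1) ^ ?n" using is_cycle_permutes_unique[OF cyc] len by metis
    have "wsubst ?b ws = a ^ length ws"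
      by (rule wsubst_const) (use dist in auto)
    then have "wsubst ?b ws = a ^ ?n" by (simp only: len)
    then have "trace_monomial ?P 0 ?b \<tau> = a ^ ?n"
      unfolding trace_monomial_def set using ws by (simp add: cembed_simps)
    then show ?thesis using sgn by simp
  qed
  have other: "positive_coeffs (?t \<tau>)" if "\<tau> \<in> ?G" for \<tau>
  proof -
    have \<tau>: "\<tau> permutes ?P" and set: "set (cycle_from \<tau> 0) \<noteq> ?P" using that by auto
    note c = cycle_from_props[OF _ \<tau>, of 0]
    let ?O = "?P - set (cycle_from \<tau> 0)"
    have O: "?O \<noteq> {}" using c(3) set by auto
    have zero: "0 \<in> set (cycle_from \<tau> 0)" using c(1,2) by (metis atMost_iff finite_atMost hd_in_set is_cycle_def le0)
    have "lookup (perm_trace ?O (\<lambda>p. Phi (?b p)) \<tau>) 0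
        = perm_trace ?O (\<lambda>p. map_mat (ceval id (\<lambda>_. 0)) (Phi (?b p))) \<tau>"
      unfolding ceval_at_zero[symmetric] by (rule perm_trace_hom[OF ring_hom_ceval[OF ring_hom_id(1)]])
    also have "\<dots> = perm_trace ?O (\<lambda>p. 0 :: 'a^'n^'n) \<tau>"
    proof (rule perm_trace_cong)
      fix p assume "p \<in> ?O"
      then have "?b p = a" using zero by auto
      then show "map_mat (ceval id (\<lambda>_. 0)) (Phi (?b p)) = (0 :: 'a^'n^'n)"
        using a by (simp add: geval_Phi[OF ring_hom_id(1), symmetric] geval_at_zero vec_eq_iff mat_def)
    qed simp
    also have "\<dots> = 0"
    proof -
      obtain p where "p \<in> ?O" using O by blast
      then have "(\<Prod>p\<in>?O. (0 :: 'a^'n^'n) $ \<iota> p $ \<iota> (\<tau> p)) = 0" for \<iota>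
        by (intro prod_zero) auto
      then show ?thesis unfolding perm_trace_def by (simp only: sum.neutral_const)
    qed
    finally have "positive_coeffs (cembed (perm_trace ?O (\<lambda>p. Phi (?b p)) \<tau>))" by (rule positive_coeffs_cembed)
    then show ?thesis unfolding trace_monomial_def by (intro positive_coeffs_mult disjI1 disjI2) 
  qed
  have "qsubst ?b cayley_hamilton = (\<Sum>\<tau> | \<tau> permutes ?P. ?t \<tau>)"
    by (simp add: cayley_hamilton_def qsubst_simps ring_hom_of_int[OF ring_hom_qsubst] qsubst_trace_monomial)
  also have "\<dots> = (\<Sum>\<tau>\<in>F \<union> ?G. ?t \<tau>)" by (rule sum.cong) (auto simp: F_def)
  also have "\<dots> = (\<Sum>\<tau>\<in>F. ?t \<tau>) + (\<Sum>\<tau>\<in>?G. ?t \<tau>)" by (rule sum.union_disjoint) (use fin in \<open>auto simp: F_def\<close>)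
  also have "(\<Sum>\<tau>\<in>F. ?t \<tau>) = of_nat (card F) * (of_int ((-1) ^ ?n) * a ^ ?n)" by (simp add: full)
  finally have "of_nat (card F) * (of_int ((-1) ^ ?n) * a ^ ?n) = qsubst ?b cayley_hamilton - (\<Sum>\<tau>\<in>?G. ?t \<tau>)" by simp
  also have "\<dots> \<in> modulo_positive I"
    using other by (intro modulo_positive_ideal(3)[OF I(1)] modulo_positive_ideal(4)[OF I(1)] modulo_positive_ideal(5)[OF I(1)]
      T_idealD(5)[OF I] positive_coeffs_sum)
  finally have mem: "of_nat (card F) * (of_int ((-1) ^ ?n) * a ^ ?n) \<in> modulo_positive I" .
  \<comment> \<open>One full cycle is enough: the multiplicity of \<open>a ^ n\<close> only has to
    be positive in order to be cancelled.\<close>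
  have "F \<noteq> {}"
  proof -
    obtain c where c: "c permutes set (0 # [1..<Suc ?n])" "is_cycle c (0 # [1..<Suc ?n])"
      using cycle_of_distinct_list[of 0 "[1..<Suc ?n]"] by auto
    have "set (0 # [1..<Suc ?n]) = ?P" by auto
    moreover have "cycle_from c 0 = 0 # [1..<Suc ?n]" using c(2) by (rule cycle_from_eq) simp
    ultimately have "c \<in> F" unfolding F_def using c(1) by simp
    then show ?thesis by blast
  qed
  then have "card F > 0" using fin by (simp add: card_gt_0_iff)
  from divisible_subgroup_cancel[OF divisible_subgroup_modulo_positive[OF I(1)] this mem]
  have "of_int ((-1) ^ ?n) * a ^ ?n \<in> modulo_positive I" .
  then have "of_int ((-1) ^ ?n) * (of_int ((-1) ^ ?n) * a ^ ?n) \<in> modulo_positive I"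
    by (rule modulo_positive_ideal(1)[OF I(1)])
  moreover have "of_int ((-1) ^ ?n) * (of_int ((-1) ^ ?n) * a ^ ?n) = a ^ ?n"
    by (cases "even ?n") auto
  ultimately show ?thesis by simp
qed

text \<open>Nagata-Higman is applied to the quasi-polynomials without constant term, whose
  \<open>n\<close>-th powers have just been treated. It covers a prefix of the word; multiplication
  on the right does the rest.\<close>

lemma long_words_in_modulo_positive:
  fixes I :: "('a::field_char_0, 'n::finite) qpoly set"
  assumes I: "T_ideal I" "cayley_hamilton \<in> I" and len: "length w \<ge> 2 ^ CARD('n) - 1"
  shows "wsubst var w \<in> modulo_positive I"
proof -
  define L where "L = 2 ^ CARD('n) - (1::nat)"
  let ?A = "{p :: ('a, 'n) qpoly. lookup p 0 = 0}"
  have "prod_list (map var (take L w)) \<in> modulo_positive I"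
  proof (rule nagata_higman[of ?A])
    show "set (map var (take L w)) \<subseteq> ?A"
      by (auto simp: var_def lookup_single zero_prod_def zero_word_def)
    show "length (map (var :: nat \<Rightarrow> ('a, 'n) qpoly) (take L w)) = 2 ^ CARD('n) - 1" using len by (simp add: L_def)
    show "a ^ CARD('n) \<in> modulo_positive I" if "a \<in> ?A" for a
      using that power_in_modulo_positive[OF I] by simp
    show "CARD('n) > 0" by simp
  qed (auto simp: lookup_add lookup_mult_zero divisible_subgroup_modulo_positive[OF I(1)] modulo_positive_ideal[OF I(1)])
  then have "wsubst var (take L w) * wsubst var (drop L w) \<in> modulo_positive I"
    by (intro modulo_positive_ideal(2)[OF I(1)]) (simp add: wsubst_def)
  then show ?thesis by (simp only: wsubst_simps(3)[symmetric] append_take_drop_id)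
qed

definition short_words :: "nat \<Rightarrow> ('a::field, 'n::finite) qpoly \<Rightarrow> bool" where
  "short_words L p \<longleftrightarrow> (\<forall>mw\<in>keys p. length (unword (snd mw)) < L)"

lemma short_words_add: "short_words L p \<Longrightarrow> short_words L q \<Longrightarrow> short_words L (p + q)"
  using Poly_Mapping.keys_add[of p q] unfolding short_words_def by blast

lemma short_words_coeff_mult: "short_words L p \<Longrightarrow> short_words L (single (m, 0) c * p)"
  unfolding short_words_def
proof
  fix mw assume p: "\<forall>mw\<in>keys p. length (unword (snd mw)) < L"
    and "mw \<in> keys (single (m, 0) c * p)"
  then obtain k l where kl: "mw = k + l" "k \<in> keys (single (m, 0::word) c)" "l \<in> keys p"
    using Poly_Mapping.keys_mult[of "single (m, 0) c" p] by blast
  then have "k = (m, 0)" by (auto split: if_splits)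
  then show "length (unword (snd mw)) < L" using kl p by auto
qed

text \<open>Modulo positive coefficients long words vanish; comparing total degrees, they are combinations
of shorter words with coefficients.\<close>

theorem congruent_to_short_words:
  fixes I :: "('a::field_char_0, 'n::finite) qpoly set"
  assumes I: "T_ideal I" "cayley_hamilton \<in> I"
  shows "\<exists>q. short_words (2 ^ CARD('n) - 1) q \<and> p - q \<in> I"
proof -
  define L where "L = 2 ^ CARD('n) - (1::nat)"
  define R where "R = {p :: ('a, 'n) qpoly. \<exists>q. short_words L q \<and> p - q \<in> I}"
  have R0: "0 \<in> R" using T_idealD(1)[OF I(1)] by (auto simp: R_def short_words_def intro!: exI[of _ 0])
  have Radd: "p + q \<in> R" if pq: "p \<in> R" "q \<in> R" for p q
  proof -
    obtain p' q' where *: "short_words L p'" "p - p' \<in> I" "short_words L q'" "q - q' \<in> I" using pq by (auto simp: R_def)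
    have "(p + q) - (p' + q') \<in> I" using T_idealD(2)[OF I(1) *(2,4)] by (simp add: algebra_simps)
    then show ?thesis using short_words_add[OF *(1,3)] by (auto simp: R_def)
  qed
  have Rmult: "single (m, 0) c * p \<in> R" if p: "p \<in> R" for m c p
  proof -
    obtain p' where *: "short_words L p'" "p - p' \<in> I" using p by (auto simp: R_def)
    have "single (m, 0) c * p - single (m, 0) c * p' \<in> I"
      using T_idealD(3)[OF I(1) *(2), of "single (m, 0) c"] by (simp add: right_diff_distrib)
    then show ?thesis using short_words_coeff_mult[OF *(1)] by (auto simp: R_def)
  qed
  have single: "single mw c = single (fst mw, 0) c * wsubst var (unword (snd mw))"
    for mw and c :: 'a
    by (cases mw) (simp add: wsubst_var mult_single)
  have Rsum: "p \<in> R" if "\<And>mw. mw \<in> keys p \<Longrightarrow> wsubst var (unword (snd mw)) \<in> R" for p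
  proof -
    have "(\<Sum>mw\<in>A. single mw (lookup p mw)) \<in> R" if "A \<subseteq> keys p" for A
      using finite_subset[OF that finite_keys] that
    proof induction
      case (insert mw A)
      have "single (fst mw, 0) (lookup p mw) * wsubst var (unword (snd mw)) \<in> R"
        using insert.prems \<open>\<And>mw. mw \<in> keys p \<Longrightarrow> wsubst var (unword (snd mw)) \<in> R\<close> by (intro Rmult) auto
      then have "single mw (lookup p mw) \<in> R" by (simp only: single[symmetric])
      then show ?case using insert by (auto intro: Radd)
    qed (simp add: R0)
    from this[OF subset_refl] show ?thesis by (simp only: poly_mapping_single_sum)
  qed
  have words: "wsubst var w \<in> R" for w
  proof (induction w rule: length_induct)
    case (1 w)
    show ?case
    proof (cases "length w < L")
      case True
      then have "short_words L (wsubst var w :: ('a, 'n) qpoly)" by (simp add: short_words_def wsubst_var)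
      then show ?thesis using T_idealD(1)[OF I(1)] by (auto simp: R_def intro!: exI[of _ "wsubst var w"])
    next
      case False
      then have "(wsubst var w :: ('a, 'n) qpoly) \<in> modulo_positive I"
        using long_words_in_modulo_positive[OF I] by (simp add: L_def)
      then obtain i r where ir: "wsubst var w = i + r" "i \<in> I" "positive_coeffs r"
        unfolding modulo_positive_def by blast
      let ?C = "restrict_keys (\<lambda>mw. weight (\<lambda>_. 1) mw = length w)"
      have "wsubst var w = ?C (wsubst var w :: ('a, 'n) qpoly)"
        by (rule restrict_keys_all[symmetric]) (auto simp: wsubst_var weight_def sum_list_triv)
      also have "\<dots> = ?C i + ?C r" by (simp only: ir(1) restrict_keys_add)
      finally have eq: "wsubst var w = ?C i + ?C r" .
      have "?C i \<in> I" by (rule weight_component_T_ideal[OF I(1) ir(2)])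
      then have "?C i \<in> R" by (auto simp: R_def short_words_def intro!: exI[of _ 0])
      moreover have "?C r \<in> R"
      proof (rule Rsum)
        fix mw assume "mw \<in> keys (?C r)"
        then have mw: "fst mw \<noteq> 0" "weight (\<lambda>_. 1) mw = length w"
          using ir(3) by (auto simp: keys_restrict_keys positive_coeffs_def)
        have "keys (fst mw) \<noteq> {}" using mw(1) by simp
        then have "(\<Sum>v\<in>keys (fst mw). lookup (fst mw) v) > 0"
          by (intro sum_pos) (auto simp: in_keys_iff)
        then have "length (unword (snd mw)) < length w"
          using mw(2) by (simp add: weight_def sum_list_triv)
        then show "wsubst var (unword (snd mw)) \<in> R" using 1 by blast
      qed
      ultimately show ?thesis unfolding eq by (rule Radd)
    qed
  qed
  have "p \<in> R" by (rule Rsum) (rule words)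
  then show ?thesis by (simp add: R_def L_def)
qed

lemma wsubst_eq_zero: "k \<in> set w \<Longrightarrow> H k = 0 \<Longrightarrow> wsubst H w = 0"
  by (induction w) auto

text \<open>Setting a variable to \<open>0\<close> also kills its coordinates, so exactly the keys
  avoiding it survive. This confines a reduced quasi-polynomial to the permitted variables.\<close>

lemma qsubst_restrict_vars:
  fixes p :: "('a::field, 'n::finite) qpoly"
  shows "qsubst (\<lambda>k. if k \<in> K then var k else 0) p = restrict_keys (\<lambda>mw. key_vars mw \<subseteq> K) p"
proof (induction p rule: poly_mapping_single_induct)
  case zero
  show ?case by (simp add: qsubst_simps)
next
  case (add mw c p)
  let ?H = "\<lambda>k. if k \<in> K then var k else 0 :: ('a, 'n) qpoly"
  have "qsubst ?H (single mw c) = restrict_keys (\<lambda>mw. key_vars mw \<subseteq> K) (single mw c)"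
  proof (cases "key_vars mw \<subseteq> K")
    case True
    then have "qsubst ?H (single mw c) = qsubst var (single mw c)"
      by (intro qsubst_single_cong) auto
    moreover have "restrict_keys (\<lambda>mw. key_vars mw \<subseteq> K) (single mw c) = single mw c"
      using True by (intro restrict_keys_all) (auto split: if_splits)
    ultimately show ?thesis by simp
  next
    case False
    obtain m w where mw: "mw = (m, w)" by (cases mw)
    from False obtain k where k: "k \<in> key_vars mw" "k \<notin> K" by blast
    have "qsubst ?H (single mw c) = 0"
    proof (cases "k \<in> set (unword w)")
      case True
      then show ?thesis using k wsubst_eq_zero[of k "unword w" ?H] by (simp add: mw qsubst_single)
    next
      case False
      then obtain v where v: "v \<in> keys m" "fst v = k" using k by (auto simp: key_vars_def mw)
      have "mon_eval (\<lambda>k. Phi (?H k)) m = 0"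
        unfolding mon_eval_def
        by (rule prod_zero) (use v k in \<open>auto intro!: bexI[of _ v] simp: zero_power_eq in_keys_iff\<close>)
      then show ?thesis by (simp add: mw qsubst_single cembed_simps)
    qed
    moreover have "restrict_keys (\<lambda>mw. key_vars mw \<subseteq> K) (single mw c) = 0"
      using False by (intro restrict_keys_none) (auto split: if_splits)
    ultimately show ?thesis by simp
  qed
  with add show ?case by (simp add: qsubst_simps restrict_keys_add)
qed

section \<open>Noetherianity\<close>

text \<open>Induction on the coordinates. A finite \<open>Y0\<close> serves the old ones; it can
  fail in the new coordinate only where the value is at most a bound, and each of these finitely
  many slices has a finite set of its own.\<close>

lemma dickson:
  fixes X :: "('x \<Rightarrow> nat) set"
  assumes "finite V"
  shows "\<exists>Y. finite Y \<and> Y \<subseteq> X \<and> (\<forall>x\<in>X. \<exists>y\<in>Y. \<forall>v\<in>V. y v \<le> x v)"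
  using assms
proof (induction V arbitrary: X)
  case empty
  then show ?case
  proof (cases "X = {}")
    case False
    then obtain x where "x \<in> X" by blast
    then show ?thesis by (intro exI[of _ "{x}"]) auto
  qed auto
next
  case (insert v V)
  obtain Y0 where Y0: "finite Y0" "Y0 \<subseteq> X" "\<forall>x\<in>X. \<exists>y\<in>Y0. \<forall>v\<in>V. y v \<le> x v"
    using insert.IH[of X] by (elim exE conjE)
  define B where "B = (\<Sum>y\<in>Y0. y v)"
  have B: "y v \<le> B" if "y \<in> Y0" for y
    unfolding B_def using member_le_sum[OF that, of "\<lambda>y. y v"] Y0(1) by simp
  have "\<forall>b. \<exists>Y. finite Y \<and> Y \<subseteq> {x\<in>X. x v = b} \<and> (\<forall>x\<in>{x\<in>X. x v = b}. \<exists>y\<in>Y. \<forall>v\<in>V. y v \<le> x v)"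
    by (intro allI insert.IH)
  from choice[OF this] obtain Z where
    ZZ: "\<forall>b. finite (Z b) \<and> Z b \<subseteq> {x\<in>X. x v = b} \<and> (\<forall>x\<in>{x\<in>X. x v = b}. \<exists>y\<in>Z b. \<forall>v\<in>V. y v \<le> x v)" ..
  then have Z: "\<And>b. finite (Z b)" "\<And>b. Z b \<subseteq> {x\<in>X. x v = b}"
    "\<And>b x. x \<in> X \<Longrightarrow> x v = b \<Longrightarrow> \<exists>y\<in>Z b. \<forall>v\<in>V. y v \<le> x v" by simp_all
  let ?Y = "Y0 \<union> (\<Union>b\<in>{..B}. Z b)"
  have "\<exists>y\<in>?Y. \<forall>u\<in>insert v V. y u \<le> x u" if x: "x \<in> X" for x
  proof (cases "x v \<le> B")
    case True
    obtain y where y: "y \<in> Z (x v)" "\<forall>u\<in>V. y u \<le> x u" using Z(3)[OF x refl] by blast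
    have "y v = x v" using Z(2) y(1) by blast
    then show ?thesis using y True by (intro bexI[of _ y]) auto
  next
    case False
    obtain y where y: "y \<in> Y0" "\<forall>u\<in>V. y u \<le> x u" using Y0(3) x by blast
    have "y v \<le> x v" using B[OF y(1)] False by simp
    then show ?thesis using y by (intro bexI[of _ y]) auto
  qed
  moreover have "finite ?Y" using Y0(1) Z(1) by simp
  moreover have "?Y \<subseteq> X" using Y0(2) Z(2) by blast
  ultimately show ?case by blast
qed

text \<open>Multiplication by a monomial shifts the exponents and leaves the last entry, the code of
  the word, alone; so it respects the order on keys.\<close>

lemma lex_map_add:
  fixes f g h :: "'x \<Rightarrow> nat"
  shows "(map f vs @ [a], map g vs @ [b]) \<in> lex less_than
    \<Longrightarrow> (map (\<lambda>v. f v + h v) vs @ [a], map (\<lambda>v. g v + h v) vs @ [b]) \<in> lex less_than"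
  by (induction vs) auto

lemma lex_total:
  fixes xs ys :: "nat list"
  shows "length xs = length ys \<Longrightarrow> xs \<noteq> ys \<Longrightarrow> (xs, ys) \<in> lex less_than \<or> (ys, xs) \<in> lex less_than"
  by (induction xs ys rule: list_induct2) auto

lemma finite_has_lex_max:
  fixes f :: "'x \<Rightarrow> nat list"
  assumes "finite A" "A \<noteq> {}" "inj_on f A" "\<And>x. x \<in> A \<Longrightarrow> length (f x) = K"
  shows "\<exists>x\<in>A. \<forall>y\<in>A. y \<noteq> x \<longrightarrow> (f y, f x) \<in> lex less_than"
  using assms
proof (induction A rule: finite_ne_induct)
  case (insert x A)
  then obtain z where z: "z \<in> A" "\<forall>y\<in>A. y \<noteq> z \<longrightarrow> (f y, f z) \<in> lex less_than" by auto
  have "f x \<noteq> f z" using insert z by (auto simp: inj_on_def)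
  then consider "(f x, f z) \<in> lex less_than" | "(f z, f x) \<in> lex less_than"
    using lex_total[of "f x" "f z"] insert.prems z(1) by auto
  then show ?case
  proof cases
    case 1
    then show ?thesis using z by auto
  next
    case 2
    have "(f y, f x) \<in> lex less_than" if "y \<in> A" for y
      using that z(2) 2 lex_transI[OF trans_less_than] by (cases "y = z") (auto elim: transE)
    then show ?thesis by auto
  qed
qed auto

lemma lookup_monomial_mult:
  fixes q :: "('a::field, 'n::finite) qpoly"
  shows "keys (single (u, 0) c * q) \<subseteq> (\<lambda>mw. (u + fst mw, snd mw)) ` keys q"
    "lookup (single (u, 0) c * q) (u + m, w) = c * lookup q (m, w)"
proof -
  show "keys (single (u, 0) c * q) \<subseteq> (\<lambda>mw. (u + fst mw, snd mw)) ` keys q"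
  proof
    fix mw assume "mw \<in> keys (single (u, 0) c * q)"
    then obtain k l where kl: "mw = k + l" "k \<in> keys (single (u, 0::word) c)" "l \<in> keys q"
      using Poly_Mapping.keys_mult[of "single (u, 0) c" q] by blast
    then have "k = (u, 0)" by (auto split: if_splits)
    then show "mw \<in> (\<lambda>mw. (u + fst mw, snd mw)) ` keys q" using kl by (intro image_eqI[of _ _ l]) (auto simp: plus_prod_def)
  qed
  show "lookup (single (u, 0) c * q) (u + m, w) = c * lookup q (m, w)"
  proof (induction q rule: poly_mapping_single_induct)
    case (add k d q)
    have "lookup (single (u, 0) c * single k d) (u + m, w)
        = c * lookup (single k d) (m, w)"
      by (cases k) (auto simp: mult_single lookup_single when_def)
    with add show ?case by (simp add: distrib_left lookup_add)
  qed simp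
qed

text \<open>A Groebner basis argument: leading terms are taken with respect to the lexicographic order
on exponent vectors, with words as a tie breaker.\<close>

theorem coefficient_submodule_finitely_generated:
  fixes Q :: "('a::field, 'n::finite) qpoly set"
  assumes V: "finite V" and W: "finite W"
    and keys: "\<And>q m w. q \<in> Q \<Longrightarrow> (m, w) \<in> keys q \<Longrightarrow> keys m \<subseteq> V \<and> w \<in> W"
    and closed: "\<And>q q' u c. q \<in> Q \<Longrightarrow> q' \<in> Q \<Longrightarrow> keys u \<subseteq> V
        \<Longrightarrow> q - single (u, 0) c * q' \<in> Q"
  shows "\<exists>S. finite S \<and> S \<subseteq> Q \<and> (\<forall>I. is_ideal I \<longrightarrow> S \<subseteq> I \<longrightarrow> Q \<subseteq> I)"
proof -
  obtain vs where vs: "set vs = V" "distinct vs" using finite_distinct_list[OF V] by blast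
  define code where "code w = (to_nat (unword w))" for w
  \<comment> \<open>\<open>lex\<close> compares lists of equal length and is well founded. All
    encodings have length \<open>Suc (length vs)\<close>, so it is total on them and serves both for
    choosing leading keys and for the final induction.\<close>
  define enc where "enc mw = map (lookup (fst mw)) vs @ [code (snd mw)]" for mw :: "'n cmon \<times> word"
  define K where "K = {mw :: 'n cmon \<times> word. keys (fst mw) \<subseteq> V}"
  have inj: "inj_on enc K"
  proof (rule inj_onI)
    fix x y assume xy: "x \<in> K" "y \<in> K" "enc x = enc y"
    have "lookup (fst x) v = lookup (fst y) v" for v
    proof (cases "v \<in> V")
      case True
      then show ?thesis using xy(3) vs(1) by (auto simp: enc_def)
    next
      case False
      then have "v \<notin> keys (fst x)" "v \<notin> keys (fst y)" using xy(1,2) by (auto simp: K_def)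
      then show ?thesis by (simp add: in_keys_iff)
    qed
    then have "fst x = fst y" by (rule poly_mapping_eqI)
    moreover have "snd x = snd y" using xy(3) by (auto simp: enc_def code_def intro: word.expand)
    ultimately show "x = y" by (rule prod_eqI)
  qed
  have len: "length (enc mw) = Suc (length vs)" for mw by (simp add: enc_def)
  have keysK: "keys q \<subseteq> K" if "q \<in> Q" for q
  proof
    fix mw assume "mw \<in> keys q"
    then show "mw \<in> K" using keys[OF that, of "fst mw" "snd mw"] by (simp add: K_def)
  qed
  define lt where "lt q k \<longleftrightarrow> k \<in> keys q \<and> (\<forall>l\<in>keys q. l \<noteq> k \<longrightarrow> (enc l, enc k) \<in> lex less_than)"
    for q :: "('a, 'n) qpoly" and k
  have lt_ex: "\<exists>k. lt q k" if "q \<in> Q" "q \<noteq> 0" for q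
  proof -
    have "\<exists>k\<in>keys q. \<forall>l\<in>keys q. l \<noteq> k \<longrightarrow> (enc l, enc k) \<in> lex less_than"
      by (rule finite_has_lex_max[OF _ _ inj_on_subset[OF inj keysK[OF that(1)]] len]) (use that(2) in auto)
    then show ?thesis unfolding lt_def by blast
  qed
  \<comment> \<open>Leading monomials are collected word by word, since multiplication by
    coefficients never changes a word.\<close>
  define X where "X w = {m. \<exists>q\<in>Q. lt q (m, w)}" for w
  have "\<forall>w. \<exists>Y. finite Y \<and> Y \<subseteq> X w \<and> (\<forall>m\<in>X w. \<exists>y\<in>Y. \<forall>v\<in>V. lookup y v \<le> lookup m v)"
  proof
    fix w
    obtain Z where Z: "finite Z" "Z \<subseteq> lookup ` X w"
      "\<forall>x\<in>lookup ` X w. \<exists>y\<in>Z. \<forall>v\<in>V. y v \<le> x v"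
      using dickson[OF V, of "lookup ` X w"] by (elim exE conjE)
    obtain Y where "Y \<subseteq> X w" "finite Y" "Z = lookup ` Y"
      using finite_subset_image[OF Z(1,2)] by blast
    then show "\<exists>Y. finite Y \<and> Y \<subseteq> X w \<and> (\<forall>m\<in>X w. \<exists>y\<in>Y. \<forall>v\<in>V. lookup y v \<le> lookup m v)"
      using Z(3) by (intro exI[of _ Y]) auto
  qed
  from choice[OF this] obtain Y where
    "\<forall>w. finite (Y w) \<and> Y w \<subseteq> X w \<and> (\<forall>m\<in>X w. \<exists>y\<in>Y w. \<forall>v\<in>V. lookup y v \<le> lookup m v)" ..
  then have Y: "\<And>w. finite (Y w)" "\<And>w. Y w \<subseteq> X w"
    "\<And>w m. m \<in> X w \<Longrightarrow> \<exists>y\<in>Y w. \<forall>v\<in>V. lookup y v \<le> lookup m v" by simp_all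
  have "\<forall>mw. \<exists>q. fst mw \<in> X (snd mw) \<longrightarrow> q \<in> Q \<and> lt q mw" by (auto simp: X_def)
  from choice[OF this] obtain g where "\<forall>mw. fst mw \<in> X (snd mw) \<longrightarrow> g mw \<in> Q \<and> lt (g mw) mw" ..
  then have g: "\<And>m w. m \<in> X w \<Longrightarrow> g (m, w) \<in> Q \<and> lt (g (m, w)) (m, w)" by force
  define S where "S = (\<Union>w\<in>W. (\<lambda>m. g (m, w)) ` Y w)"
  have "finite S" using W Y(1) by (simp add: S_def)
  moreover have "S \<subseteq> Q" using g Y(2) by (fastforce simp: S_def)
  moreover have "Q \<subseteq> I" if I: "is_ideal I" "S \<subseteq> I" for I
  proof -
    have wf: "wf (inv_image (lex less_than) enc)" by (intro wf_inv_image wf_lex wf_less_than)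
    have "\<forall>q\<in>Q. lt q k \<longrightarrow> q \<in> I" for k
      using wf
    proof (induction k rule: wf_induct_rule)
      case (less k)
      show ?case
      proof (intro ballI impI)
        fix q assume q: "q \<in> Q" "lt q k"
        obtain m w where k: "k = (m, w)" by (cases k)
        have "m \<in> X w" using q k by (auto simp: X_def)
        then obtain y where y: "y \<in> Y w" "\<forall>v\<in>V. lookup y v \<le> lookup m v" using Y(3) by blast
        have mK: "(m, w) \<in> keys q" using q k by (auto simp: lt_def)
        have w: "w \<in> W" and mV: "keys m \<subseteq> V" using keys[OF q(1) mK] by auto
        define s where "s = g (y, w)"
        have "s \<in> S" unfolding s_def S_def using w y(1) by blast
        moreover have "y \<in> X w" using Y(2) y(1) by blast
        ultimately have s: "s \<in> Q" "lt s (y, w)" "s \<in> I" using g[of y w] I(2) by (auto simp: s_def)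
        have yK: "(y, w) \<in> keys s" using s(2) by (simp add: lt_def)
        have yV: "keys y \<subseteq> V" using keys[OF s(1) yK] by auto
        \<comment> \<open>Subtraction of exponents is truncated; it is exact here because
          \<open>y\<close> divides \<open>m\<close>.\<close>
        define u where "u = m - y"
        have uy: "u + y = m"
        proof (rule poly_mapping_eqI)
          fix v
          have "lookup y v \<le> lookup m v"
          proof (cases "v \<in> V")
            case False
            then have "v \<notin> keys y" using yV by blast
            then show ?thesis by (simp add: in_keys_iff)
          qed (use y(2) in blast)
          then show "lookup (u + y) v = lookup m v" by (simp add: u_def lookup_add lookup_minus)
        qed
        have uV: "keys u \<subseteq> V"
        proof
          fix v assume "v \<in> keys u"
          then have "v \<in> keys m" by (auto simp: u_def in_keys_iff lookup_minus)
          then show "v \<in> V" using mV by blast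
        qed
        define c where "c = lookup q (m, w) / lookup s (y, w)"
        define t where "t = single (u, 0) c * s"
        define r where "r = q - t"
        have r: "r \<in> Q" unfolding r_def t_def by (rule closed[OF q(1) s(1) uV])
        have tI: "t \<in> I" using I(1) s(3) by (auto simp: t_def is_ideal_def)
        have t_key: "(enc l, enc k) \<in> lex less_than" if l: "l \<in> keys t" "l \<noteq> k" for l
        proof -
          obtain l' where l': "l = (u + fst l', snd l')" "l' \<in> keys s"
            using l(1) lookup_monomial_mult(1)[of u c s] by (auto simp: t_def)
          have "l' \<noteq> (y, w)" using l(2) l'(1) uy k by auto
          then have "(enc l', enc (y, w)) \<in> lex less_than" using s(2) l'(2) by (simp add: lt_def)
          then have "(map (\<lambda>v. lookup (fst l') v + lookup u v) vs @ [code (snd l')],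
              map (\<lambda>v. lookup y v + lookup u v) vs @ [code w]) \<in> lex less_than"
            unfolding enc_def by (intro lex_map_add) simp
          moreover have "enc l = map (\<lambda>v. lookup (fst l') v + lookup u v) vs @ [code (snd l')]"
            by (simp add: enc_def l'(1) lookup_add add.commute)
          moreover have "enc k = map (\<lambda>v. lookup y v + lookup u v) vs @ [code w]"
            by (simp add: enc_def k uy[symmetric] lookup_add add.commute)
          ultimately show ?thesis by simp
        qed
        have r_k: "lookup r k = 0"
          using lookup_monomial_mult(2)[of u c s y w] yK
          by (simp add: r_def t_def lookup_minus k uy c_def in_keys_iff)
        have r_key: "(enc l, enc k) \<in> lex less_than" if "l \<in> keys r" for l
        proof -
          have "l \<noteq> k" using that r_k by (auto simp: in_keys_iff)
          moreover have "l \<in> keys q \<or> l \<in> keys t"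
            using that by (auto simp: r_def in_keys_iff lookup_minus)
          ultimately show ?thesis using t_key q(2) unfolding lt_def by blast
        qed
        have "r \<in> I"
        proof (cases "r = 0")
          case True then show ?thesis using I(1) by (simp add: is_ideal_def)
        next
          case False
          then obtain l where l: "lt r l" using lt_ex[OF r] by blast
          then have "(enc l, enc k) \<in> lex less_than" using r_key[of l] by (simp add: lt_def)
          then show ?thesis using less.IH[of l] l r by (simp add: in_inv_image)
        qed
        then have "r + t \<in> I" using I(1) tI by (simp add: is_ideal_def)
        then show "q \<in> I" by (simp add: r_def)
      qed
    qed
    then show ?thesis using lt_ex I(1) by (metis is_ideal_def subsetI)
  qed
  ultimately show ?thesis by blast
qed

section \<open>Multilinear quasi-identities\<close>

lemma degree_in_eq: "degree_in k (m, w) =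
    (\<Sum>v\<in>keys m. lookup m v * (if fst v = k then 1 else 0)) + count_list (unword w) k"
proof -
  have "(\<Sum>l\<leftarrow>u. if l = k then 1 else 0) = count_list u k" for u :: "nat list" by (induction u) auto
  then show ?thesis by (simp add: weight_def)
qed

text \<open>This dichotomy between letter and coordinate is the origin of the factor two in
  \<open>2 * CARD('n)\<^sup>2\<close>.\<close>

lemma degree_in_one_cases:
  assumes "degree_in k (m, w) = 1"
  obtains (word) "k \<in> set (unword w)" "count_list (unword w) k = 1" "\<And>v. v \<in> keys m \<Longrightarrow> fst v \<noteq> k"
  | (coeff) i j where "k \<notin> set (unword w)" "lookup m (k, i, j) = 1"
      "\<And>v. v \<in> keys m \<Longrightarrow> fst v = k \<Longrightarrow> v = (k, i, j)"
proof -
  let ?f = "\<lambda>v. lookup m v * (if fst v = k then 1 else 0)"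
  consider "sum ?f (keys m) = 0" "count_list (unword w) k = 1"
    | "sum ?f (keys m) = 1" "count_list (unword w) k = 0"
    using assms unfolding degree_in_eq by linarith
  then show thesis
  proof cases
    case 1
    have "fst v \<noteq> k" if "v \<in> keys m" for v
      using 1(1) that by (auto simp: in_keys_iff split: if_splits)
    moreover have "k \<in> set (unword w)" using 1(2) count_list_0_iff[of "unword w" k] by (metis zero_neq_one)
    ultimately show thesis using 1(2) word by blast
  next
    case 2
    then obtain v where v: "v \<in> keys m" "?f v = 1" "\<forall>u\<in>keys m. v \<noteq> u \<longrightarrow> ?f u = 0"
      using sum_eq_1_iff[OF finite_keys, of ?f m] by auto
    obtain l i j where vl: "v = (l, i, j)" by (cases v)
    have l: "l = k" "lookup m v = 1" using v(2) vl by (auto split: if_splits)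
    have "u = (k, i, j)" if "u \<in> keys m" "fst u = k" for u
    proof -
      have "v = u"
      proof (rule ccontr)
        assume "v \<noteq> u"
        then have "?f u = 0" using v(3) that(1) by blast
        then show False using that by (simp add: in_keys_iff)
      qed
      then show ?thesis using vl l(1) by simp
    qed
    moreover have "k \<notin> set (unword w)" using 2(2) by (simp add: count_list_0_iff)
    ultimately show thesis using coeff[of i j] l vl by blast
  qed
qed

lemma distinct_if_count_list_le_one: "(\<And>k. count_list w k \<le> 1) \<Longrightarrow> distinct w"
proof (induction w)
  case (Cons a w)
  have "count_list w k \<le> 1" for k using Cons.prems[of k] by (auto split: if_splits)
  moreover have "count_list w a = 0" using Cons.prems[of a] by simp
  ultimately show ?case using Cons.IH by (simp add: count_list_0_iff)
qed simp

lemma cmon_split: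
  fixes m :: "'n cmon"
  assumes "lookup m v = 1"
  obtains m' where "m = single v 1 + m'" "keys m' = keys m - {v}"
    "\<And>u. u \<noteq> v \<Longrightarrow> lookup m' u = lookup m u"
proof -
  define m' where "m' = m - single v 1"
  have l: "lookup m' u = (if u = v then 0 else lookup m u)" for u
    using assms by (auto simp: m'_def lookup_minus lookup_single when_def)
  have "m = single v 1 + m'"
    by (rule poly_mapping_eqI) (use assms in \<open>auto simp: l lookup_add lookup_single when_def\<close>)
  moreover have "keys m' = keys m - {v}"
    unfolding set_eq_iff in_keys_iff by (auto simp: l in_keys_iff)
  ultimately show thesis using that[of m'] l by simp
qed

abbreviation rename :: "(nat \<Rightarrow> nat) \<Rightarrow> ('a::field, 'n::finite) qpoly \<Rightarrow> ('a, 'n) qpoly" where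
  "rename h \<equiv> qsubst (\<lambda>k. var (h k))"

lemma rename_rename: "rename g (rename h p) = rename (g \<circ> h) p"
  by (simp add: qsubst_qsubst)

lemma rename_single:
  "rename h (single (m, w) c)
    = single 0 c * cembed (mon_eval (\<lambda>k. generic (h k)) m) * wsubst var (map h (unword w))"
  by (simp add: qsubst_single wsubst_def o_def)

lemma of_int_sign_mult_left: "of_int (sign \<tau>) * (x * y) = x * (of_int (sign \<tau>) * y)" for x y :: "'r::ring_1"
  by (cases \<tau> rule: sign_cases) auto

text \<open>More than \<open>n^2\<close> of the variables in \<open>X\<close> occur in the same way.
  Among letters, the alternating sum over these variables alone already lies in \<open>I\<close>.
  Among coordinates, two variables occupy the same position \<open>(i, j)\<close>, and exchanging
  them fixes the monomial.\<close>

lemma alternating_monomial_in: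
  fixes I :: "('a::field_char_0, 'n::finite) qpoly set"
  assumes I: "T_ideal I" "cayley_hamilton \<in> I" and P: "finite P"
    and deg: "\<And>k. degree_in k (m, w) = (if k \<in> P then 1 else 0)"
    and X: "X \<subseteq> P" "card X > 2 * CARD('n)\<^sup>2"
  shows "(\<Sum>\<tau> | \<tau> permutes X. of_int (sign \<tau>) * rename \<tau> (single (m, w) c)) \<in> I"
proof -
  let ?n2 = "CARD('n)\<^sup>2" and ?M = "single (m, w) c :: ('a, 'n) qpoly"
  have finX: "finite X" using P X(1) finite_subset by blast
  have dist: "distinct (unword w)"
  proof (rule distinct_if_count_list_le_one)
    fix k show "count_list (unword w) k \<le> 1" using deg[of k] unfolding degree_in_eq by (auto split: if_splits)
  qed
  show ?thesis
  proof (cases "card (X \<inter> set (unword w)) > ?n2")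
    case True
    define Z where "Z = X \<inter> set (unword w)"
    have Z: "Z \<subseteq> set (unword w)" "card Z > ?n2" "Z \<subseteq> X" using True by (auto simp: Z_def)
    have finZ: "finite Z" using finX Z(3) finite_subset by blast
    have fst: "fst v \<notin> Z" if v: "v \<in> keys m" for v
    proof
      assume "fst v \<in> Z"
      then have "fst v \<in> P" "fst v \<in> set (unword w)" using Z X(1) by auto
      then have "degree_in (fst v) (m, w) = 1" using deg by simp
      then show False
        by (cases rule: degree_in_one_cases) (use v \<open>fst v \<in> set (unword w)\<close> in blast)+
    qed
    have "rename \<rho> ?M = single 0 c * cembed (mon_eval generic m) * wsubst var (map \<rho> (unword w))"
      if "\<rho> permutes Z" for \<rho>
    proof -
      have "mon_eval (\<lambda>k. generic (\<rho> k)) m = (mon_eval generic m :: ('a, 'n) cpoly)"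
        using fst permutes_not_in[OF that] by (intro mon_eval_cong) auto
      then show ?thesis unfolding rename_single by simp
    qed
    then have "(\<Sum>\<rho> | \<rho> permutes Z. of_int (sign \<rho>) * rename \<rho> ?M)
        = single 0 c * cembed (mon_eval generic m) * (\<Sum>\<rho> | \<rho> permutes Z. of_int (sign \<rho>) * wsubst var (map \<rho> (unword w)))"
      by (simp add: sum_distrib_left of_int_sign_mult_left)
    then have inner: "(\<Sum>\<rho> | \<rho> permutes Z. of_int (sign \<rho>) * rename \<rho> ?M) \<in> I"
      using T_idealD(3)[OF I(1) alternating_words_in_T_ideal[OF I dist Z(1,2)]] by simp
    let ?F = "\<lambda>\<tau>. of_int (sign \<tau>) * rename \<tau> ?M"
    have comp: "?F (\<tau> \<circ> \<rho>) = of_int (sign \<tau>) * rename \<tau> (of_int (sign \<rho>) * rename \<rho> ?M)"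
      if "\<tau> permutes X" "\<rho> permutes Z" for \<tau> \<rho>
    proof -
      have "permutation \<tau>" "permutation \<rho>" using that finX finZ permutation_permutes by blast+
      then show ?thesis
        unfolding qsubst_simps(4) ring_hom_of_int[OF ring_hom_qsubst] rename_rename
        by (simp add: sign_compose mult.assoc)
    qed
    \<comment> \<open>Instead of choosing coset representatives, the sum is repeated once for every
      \<open>\<rho>\<close> and reindexed by \<open>\<tau> \<circ> \<rho>\<close>; the multiplicity
      is cancelled at the end.\<close>
    have "of_nat (card {\<rho>. \<rho> permutes Z}) * (\<Sum>\<tau> | \<tau> permutes X. ?F \<tau>) = (\<Sum>\<rho> | \<rho> permutes Z. \<Sum>\<tau> | \<tau> permutes X. ?F \<tau>)"
      by simp
    also have "\<dots> = (\<Sum>\<rho> | \<rho> permutes Z. \<Sum>\<tau> | \<tau> permutes X. ?F (\<tau> \<circ> \<rho>))"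
    proof (rule sum.cong[OF refl])
      fix \<rho> assume "\<rho> \<in> {\<rho>. \<rho> permutes Z}"
      then have "\<rho> permutes X" using permutes_subset[OF _ Z(3)] by blast
      then show "(\<Sum>\<tau> | \<tau> permutes X. ?F \<tau>) = (\<Sum>\<tau> | \<tau> permutes X. ?F (\<tau> \<circ> \<rho>))"
        by (rule sum_permutations_right[symmetric, where f = ?F])
    qed
    also have "\<dots> = (\<Sum>\<tau> | \<tau> permutes X. \<Sum>\<rho> | \<rho> permutes Z. ?F (\<tau> \<circ> \<rho>))" by (rule sum.swap)
    also have "\<dots> = (\<Sum>\<tau> | \<tau> permutes X. of_int (sign \<tau>) * rename \<tau> (\<Sum>\<rho> | \<rho> permutes Z. of_int (sign \<rho>) * rename \<rho> ?M))"
      unfolding ring_hom_sum[OF ring_hom_qsubst] sum_distrib_left by (intro sum.cong refl comp) auto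
    also have "\<dots> \<in> I"
      by (intro T_ideal_sum[OF I(1)] T_idealD(3)[OF I(1)] T_idealD(5)[OF I(1)] inner)
    finally have "of_nat (card {\<rho>. \<rho> permutes Z}) * (\<Sum>\<tau> | \<tau> permutes X. ?F \<tau>) \<in> I" .
    then show ?thesis
      by (rule divisible_subgroup_cancel[OF divisible_subgroup_T_ideal[OF I(1)], rotated])
        (simp add: card_permutations[OF refl finZ])
  next
    case False
    let ?Y = "X - set (unword w)"
    have "card X = card ?Y + card (X \<inter> set (unword w))"
      using card_Int_Diff[OF finX, of "set (unword w)"] by simp
    then have cardY: "card ?Y > ?n2" using False X(2) by linarith
    have "\<forall>k\<in>?Y. \<exists>ij. lookup m (k, ij) = 1 \<and> (\<forall>v\<in>keys m. fst v = k \<longrightarrow> v = (k, ij))"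
    proof
      fix k assume k: "k \<in> ?Y"
      then have "degree_in k (m, w) = 1" using deg X(1) by auto
      then show "\<exists>ij. lookup m (k, ij) = 1 \<and> (\<forall>v\<in>keys m. fst v = k \<longrightarrow> v = (k, ij))"
        by (cases rule: degree_in_one_cases) (use k in blast)+
    qed
    from bchoice[OF this] obtain f where
      f: "\<forall>k\<in>?Y. lookup m (k, f k) = 1 \<and> (\<forall>v\<in>keys m. fst v = k \<longrightarrow> v = (k, f k))" ..
    have "card (f ` ?Y) \<le> card (UNIV :: ('n \<times> 'n) set)" by (rule card_mono) auto
    also have "\<dots> = ?n2" by (simp add: card_cartesian_product power2_eq_square flip: UNIV_Times_UNIV)
    finally have "\<not> inj_on f ?Y" using cardY card_image by fastforce
    then obtain x y where xy: "x \<in> ?Y" "y \<in> ?Y" "x \<noteq> y" "f x = f y" by (auto simp: inj_on_def)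
    obtain i j where ij: "f x = (i, j)" by (cases "f x")
    have fx: "lookup m (x, i, j) = 1" "\<forall>v\<in>keys m. fst v = x \<longrightarrow> v = (x, i, j)"
      and fy: "lookup m (y, i, j) = 1" "\<forall>v\<in>keys m. fst v = y \<longrightarrow> v = (y, i, j)"
      using f xy ij by metis+
    obtain m1 where m1: "m = single (x, i, j) 1 + m1" "keys m1 = keys m - {(x, i, j)}"
      "\<And>u. u \<noteq> (x, i, j) \<Longrightarrow> lookup m1 u = lookup m u"
      by (rule cmon_split[OF fx(1)], rule that)
    have m1y: "lookup m1 (y, i, j) = 1" using m1(3)[of "(y, i, j)"] fy(1) xy(3) by simp
    obtain m2 where m2: "m1 = single (y, i, j) 1 + m2" "keys m2 = keys m1 - {(y, i, j)}"
      by (rule cmon_split[OF m1y], rule that)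
    have m2k: "fst v \<noteq> x \<and> fst v \<noteq> y" if "v \<in> keys m2" for v
    proof -
      have v: "v \<in> keys m" "v \<noteq> (x, i, j)" "v \<noteq> (y, i, j)" using that unfolding m2(2) m1(2) by blast+
      have "fst v = x \<Longrightarrow> v = (x, i, j)" "fst v = y \<Longrightarrow> v = (y, i, j)" using fx(2) fy(2) v(1) by blast+
      then show ?thesis using v by blast
    qed
    let ?t = "transpose x y"
    have "rename (\<tau> \<circ> ?t) ?M = rename \<tau> ?M" for \<tau>
    proof -
      have "mon_eval (\<lambda>k. generic ((\<tau> \<circ> ?t) k)) m2 = (mon_eval (\<lambda>k. generic (\<tau> k)) m2 :: ('a, 'n) cpoly)"
        using m2k by (intro mon_eval_cong) (auto simp: Transposition.transpose_def)
      then have "mon_eval (\<lambda>k. generic ((\<tau> \<circ> ?t) k)) m = (mon_eval (\<lambda>k. generic (\<tau> k)) m :: ('a, 'n) cpoly)"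
        unfolding m1(1) m2(1) mon_eval_add by (simp add: mult_ac)
      moreover have "map (\<tau> \<circ> ?t) (unword w) = map \<tau> (unword w)"
        using xy by (intro map_cong refl) (auto simp: Transposition.transpose_def)
      ultimately show ?thesis unfolding rename_single by (simp only:)
    qed
    then have "(\<Sum>\<tau> | \<tau> permutes X. of_int (sign \<tau>) * rename \<tau> ?M) = 0"
      using xy by (intro alternating_sum_vanishes_right[OF finX, of x y "\<lambda>\<tau>. rename \<tau> ?M"]) auto
    then show ?thesis using T_idealD(1)[OF I(1)] by simp
  qed
qed

text \<open>The only occurrence of \<open>x_i\<close> is a letter, where the product distributes, or
  a coordinate, where \<open>Phi\<close> is additive.\<close>

lemma qsubst_additive_single:
  assumes "degree_in i (m, w) = 1"
  shows "qsubst (H(i := u + v)) (single (m, w) c)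
    = qsubst (H(i := u)) (single (m, w) c) + qsubst (H(i := v)) (single (m, w) c)"
  using assms
proof (cases rule: degree_in_one_cases)
  case word
  obtain w1 w2 where w12: "unword w = w1 @ i # w2" using word(1) by (meson split_list)
  have "count_list w1 i = 0" "count_list w2 i = 0" using word(2) w12 by auto
  then have n: "i \<notin> set w1" "i \<notin> set w2" by (auto simp: count_list_0_iff)
  have m: "mon_eval (\<lambda>k. Phi ((H(i := x)) k)) m = mon_eval (\<lambda>k. Phi (H k)) m" for x
    using word(3) by (intro mon_eval_cong) auto
  have w: "wsubst (H(i := x)) (unword w) = wsubst H w1 * x * wsubst H w2" for x
  proof -
    have "wsubst (H(i := x)) w1 = wsubst H w1" "wsubst (H(i := x)) w2 = wsubst H w2"
      using n by (auto intro!: wsubst_cong)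
    then show ?thesis by (simp only: w12 wsubst_simps fun_upd_same mult.assoc)
  qed
  show ?thesis unfolding qsubst_single m w by (simp add: algebra_simps)
next
  case (coeff a b)
  obtain m' where m': "m = single (i, a, b) 1 + m'" "keys m' = keys m - {(i, a, b)}"
    by (rule cmon_split[OF coeff(2)], rule that)
  have n: "fst v \<noteq> i" if "v \<in> keys m'" for v using that coeff(3)[of v] unfolding m'(2) by blast
  have m: "mon_eval (\<lambda>k. Phi ((H(i := x)) k)) m = Phi x $ a $ b * mon_eval (\<lambda>k. Phi (H k)) m'" for x
  proof -
    have "mon_eval (\<lambda>k. Phi ((H(i := x)) k)) m' = mon_eval (\<lambda>k. Phi (H k)) m'"
      using n by (intro mon_eval_cong) auto
    then show ?thesis unfolding m'(1) mon_eval_add by simp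
  qed
  have w: "wsubst (H(i := x)) (unword w) = wsubst H (unword w)" for x
    using coeff(1) by (intro wsubst_cong) auto
  show ?thesis unfolding qsubst_single m w by (simp add: Phi_add cembed_simps algebra_simps)
qed

lemma qsubst_additive_sum:
  assumes "\<And>mw. mw \<in> keys q \<Longrightarrow> degree_in i mw = 1" "finite A"
  shows "qsubst (H(i := (\<Sum>j\<in>A. g j))) q = (\<Sum>j\<in>A. qsubst (H(i := g j)) q)"
proof -
  have add: "qsubst (H(i := u + v)) q = qsubst (H(i := u)) q + qsubst (H(i := v)) q" for u v
    unfolding qsubst_sum_single[of _ q] sum.distrib[symmetric]
  proof (rule sum.cong[OF refl])
    fix mw assume "mw \<in> keys q"
    then have "degree_in i (fst mw, snd mw) = 1" using assms(1) by simp
    from qsubst_additive_single[OF this, of H u v "lookup q mw"]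
    show "qsubst (H(i := u + v)) (single mw (lookup q mw))
      = qsubst (H(i := u)) (single mw (lookup q mw)) + qsubst (H(i := v)) (single mw (lookup q mw))"
      by (simp only: prod.collapse)
  qed
  have zero: "qsubst (H(i := 0)) q = 0" using add[of 0 0] by (simp only: add_0_right) simp
  from assms(2) show ?thesis by induction (simp_all add: zero add del: fun_upd_apply)
qed

lemma qsubst_multilinear_expand:
  assumes "finite T" "\<And>i. i \<in> T \<Longrightarrow> finite (A i)"
    and "\<And>mw i. mw \<in> keys q \<Longrightarrow> i \<in> T \<Longrightarrow> degree_in i mw = 1"
  shows "qsubst (\<lambda>i. if i \<in> T then \<Sum>j\<in>A i. var j else H i) q
    = (\<Sum>h\<in>PiE T A. qsubst (\<lambda>i. if i \<in> T then var (h i) else H i) q)"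
  using assms
proof (induction T arbitrary: H)
  case empty
  then show ?case by simp
next
  case (insert x T)
  have "(\<lambda>i. if i \<in> insert x T then \<Sum>j\<in>A i. var j else H i)
      = (\<lambda>i. if i \<in> T then \<Sum>j\<in>A i. var j else (H(x := (\<Sum>j\<in>A x. var j))) i)"
    using insert.hyps by (auto simp: fun_eq_iff)
  then have "qsubst (\<lambda>i. if i \<in> insert x T then \<Sum>j\<in>A i. var j else H i) q
      = (\<Sum>h\<in>PiE T A. qsubst (\<lambda>i. if i \<in> T then var (h i) else (H(x := (\<Sum>j\<in>A x. var j))) i) q)"
    using insert.IH[of "H(x := (\<Sum>j\<in>A x. var j))"] insert.prems by simp
  also have "\<dots> = (\<Sum>h\<in>PiE T A. \<Sum>j\<in>A x. qsubst (\<lambda>i. if i \<in> insert x T then var ((h(x := j)) i) else H i) q)"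
  proof (rule sum.cong[OF refl])
    fix h
    let ?H = "\<lambda>i. if i \<in> T then var (h i) else H i"
    have "(\<lambda>i. if i \<in> T then var (h i) else (H(x := (\<Sum>j\<in>A x. var j))) i) = ?H(x := (\<Sum>j\<in>A x. var j))"
      using insert.hyps by (auto simp: fun_eq_iff)
    moreover have "qsubst (?H(x := (\<Sum>j\<in>A x. var j))) q = (\<Sum>j\<in>A x. qsubst (?H(x := var j)) q)"
      using insert.prems by (intro qsubst_additive_sum) auto
    moreover have "?H(x := var j) = (\<lambda>i. if i \<in> insert x T then var ((h(x := j)) i) else H i)" for j
      using insert.hyps by (auto simp: fun_eq_iff)
    ultimately show "qsubst (\<lambda>i. if i \<in> T then var (h i) else (H(x := (\<Sum>j\<in>A x. var j))) i) q
        = (\<Sum>j\<in>A x. qsubst (\<lambda>i. if i \<in> insert x T then var ((h(x := j)) i) else H i) q)"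
      by (simp only:)
  qed
  also have "\<dots> = (\<Sum>h\<in>PiE (insert x T) A. qsubst (\<lambda>i. if i \<in> insert x T then var (h i) else H i) q)"
    using sum_PiE_insert[OF insert.hyps(2), of "\<lambda>h. qsubst (\<lambda>i. if i \<in> insert x T then var (h i) else H i) q" A] by (simp only:)
  finally show ?case .
qed

lemma weight_cong: "(\<And>k. k \<in> key_vars mw \<Longrightarrow> \<omega> k = \<omega>' k) \<Longrightarrow> weight \<omega> mw = weight \<omega>' mw"
  unfolding weight_def key_vars_def
  by (intro arg_cong2[where f = "(+)"] sum.cong arg_cong[where f = sum_list] map_cong) auto

text \<open>The duality theorem is applied to the renamings of \<open>q\<close>, as a function on
  the permutations of its variables. Alternators are treated monomial by monomial; symmetrizers
  arise by identifying variables of equal colour and polarising back.\<close>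

theorem multilinear_quasi_id_in:
  fixes I :: "('a::field_char_0, 'n::finite) qpoly set"
  assumes I: "T_ideal I" "cayley_hamilton \<in> I"
    and small: "\<And>r. r \<in> quasi_ids \<Longrightarrow> qvars r \<subseteq> {..<2 * CARD('n)\<^sup>2} \<Longrightarrow> r \<in> I"
    and P: "finite P" and q: "q \<in> quasi_ids" "multihomogeneous (\<lambda>k. if k \<in> P then 1 else 0) q"
  shows "q \<in> I"
proof -
  let ?N = "2 * CARD('n)\<^sup>2"
  have deg: "degree_in k mw = (if k \<in> P then 1 else 0)" if "mw \<in> keys q" for k mw
    using q(2) that by (auto simp: multihomogeneous_def homogeneous_def)
  have kv: "key_vars mw = P" if "mw \<in> keys q" for mw
    using deg[OF that] degree_in_zero_iff[of _ mw] by (metis (mono_tags, lifting) equalityI subsetI zero_neq_one)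
  have qv: "qvars q \<subseteq> P" unfolding qvars_eq using kv by blast
  define G where "G \<pi> = rename \<pi> q" for \<pi>
  have alt: "alternators_in P ?N G I"
    unfolding alternators_in_def
  proof (intro allI impI)
    fix X g assume X: "X \<subseteq> P" "card X = Suc ?N" and g: "g permutes P"
    have "(\<Sum>\<tau> | \<tau> permutes X. of_int (sign \<tau>) * rename \<tau> q)
        = (\<Sum>mw\<in>keys q. \<Sum>\<tau> | \<tau> permutes X. of_int (sign \<tau>) * rename \<tau> (single mw (lookup q mw)))"
      unfolding qsubst_sum_single[of _ q] sum_distrib_left by (rule sum.swap)
    also have "\<dots> \<in> I"
    proof (rule T_ideal_sum[OF I(1)])
      fix mw assume "mw \<in> keys q"
      then have "degree_in k (fst mw, snd mw) = (if k \<in> P then 1 else 0)" for k using deg by simp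
      from alternating_monomial_in[OF I P this X(1)] X(2)
      show "(\<Sum>\<tau> | \<tau> permutes X. of_int (sign \<tau>) * rename \<tau> (single mw (lookup q mw))) \<in> I"
        by simp
    qed
    finally have "rename g (\<Sum>\<tau> | \<tau> permutes X. of_int (sign \<tau>) * rename \<tau> q) \<in> I" by (rule T_idealD(5)[OF I(1)])
    then show "(\<Sum>\<tau> | \<tau> permutes X. of_int (sign \<tau>) * G (g \<circ> \<tau>)) \<in> I"
      unfolding G_def qsubst_simps(4) ring_hom_sum[OF ring_hom_qsubst] ring_hom_of_int[OF ring_hom_qsubst] rename_rename .
  qed
  have sym: "symmetrizers_in P ?N G I"
    unfolding symmetrizers_in_def
  proof (intro allI impI)
    fix f g :: "nat \<Rightarrow> nat" assume f: "f ` P \<subseteq> {..<?N}" and g: "g permutes P"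
    let ?Y = "{\<tau>. \<tau> permutes P \<and> (\<forall>x\<in>P. f (\<tau> x) = f x)}"
    let ?A = "\<lambda>i. {j\<in>P. f j = f i}"
    \<comment> \<open>Elements of \<open>PiE P ?A\<close> are \<open>undefined\<close> outside
      \<open>P\<close>; \<open>?e\<close> continues them by the identity, as required of a
      permutation of \<open>P\<close>.\<close>
    let ?e = "\<lambda>h i. if i \<in> P then h i else i"
    have hom: "homogeneous (\<lambda>l. if l = k then 1 else 0) d (rename h q)"
      if "\<And>mw. mw \<in> keys q \<Longrightarrow> weight (\<lambda>l. if h l = k then 1 else 0) mw = d" for h k d
      using that by (intro homogeneous_rename) (auto simp: homogeneous_def)
    \<comment> \<open>After variables of equal colour are identified, only colours below
      \<open>2 * n^2\<close> remain as variables, the case covered by \<open>small\<close>.\<close>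
    have "rename f q \<in> I"
    proof (rule small)
      show "rename f q \<in> quasi_ids" by (rule T_idealD(5)[OF T_ideal_quasi_ids q(1)])
      show "qvars (rename f q) \<subseteq> {..<?N}"
      proof
        fix k assume k: "k \<in> qvars (rename f q)"
        show "k \<in> {..<?N}"
        proof (rule ccontr)
          assume nk: "k \<notin> {..<?N}"
          have "homogeneous (\<lambda>l. if l = k then 1 else 0) 0 (rename f q)"
            using f nk kv by (intro hom) (auto simp: weight_zero_iff)
          then show False using k by (auto simp: qvars_eq homogeneous_def degree_in_zero_iff)
        qed
      qed
    qed
    \<comment> \<open>Polarisation: every colour is replaced by the sum of its variables.
      Multilinear expansion gives one renaming of \<open>q\<close> for each colour-preserving
      self-map of \<open>P\<close>.\<close>
    then have "qsubst (\<lambda>c. \<Sum>j\<in>{j\<in>P. f j = c}. var j) (rename f q) \<in> I" by (rule T_idealD(5)[OF I(1)])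
    also have "qsubst (\<lambda>c. \<Sum>j\<in>{j\<in>P. f j = c}. var j) (rename f q) = qsubst (\<lambda>i. \<Sum>j\<in>?A i. var j) q"
      by (simp only: qsubst_qsubst qsubst_var)
    also have "\<dots> = qsubst (\<lambda>i. if i \<in> P then \<Sum>j\<in>?A i. var j else var i) q"
      using qv by (intro qsubst_cong) auto
    also have "\<dots> = (\<Sum>h\<in>PiE P ?A. qsubst (\<lambda>i. if i \<in> P then var (h i) else var i) q)"
      using P deg by (intro qsubst_multilinear_expand) auto
    also have "\<dots> = (\<Sum>h\<in>PiE P ?A. rename (?e h) q)"
      by (intro sum.cong refl arg_cong2[where f = qsubst]) auto
    finally have "(\<Sum>h\<in>PiE P ?A. rename (?e h) q) \<in> I" .
    \<comment> \<open>The component of degree one in every variable of \<open>P\<close> retains the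
      injective maps, which are the colour-preserving permutations.\<close>
    from multidegree_component_T_ideal[OF P I(1) this, of "\<lambda>_. 1"]
    have "(\<Sum>h\<in>PiE P ?A. restrict_keys (\<lambda>mw. \<forall>k\<in>P. degree_in k mw = 1) (rename (?e h) q)) \<in> I"
      by (simp only: restrict_keys_sum)
    also have "(\<Sum>h\<in>PiE P ?A. restrict_keys (\<lambda>mw. \<forall>k\<in>P. degree_in k mw = 1) (rename (?e h) q))
        = (\<Sum>h\<in>PiE P ?A. if inj_on h P then rename (?e h) q else 0)"
    proof (rule sum.cong[OF refl])
      fix h assume h: "h \<in> PiE P ?A"
      have hP: "h ` P \<subseteq> P" using h by (auto simp: PiE_def Pi_def)
      show "restrict_keys (\<lambda>mw. \<forall>k\<in>P. degree_in k mw = 1) (rename (?e h) q) = (if inj_on h P then rename (?e h) q else 0)"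
      proof (cases "inj_on h P")
        case True
        have surj: "h ` P = P" using endo_inj_surj[OF P hP True] .
        have "homogeneous (\<lambda>l. if l = k then 1 else 0) 1 (rename (?e h) q)" if k: "k \<in> P" for k
        proof (rule hom)
          fix mw assume mw: "mw \<in> keys q"
          obtain l0 where l0: "l0 \<in> P" "h l0 = k" using k surj by (metis imageE)
          have "weight (\<lambda>l. if ?e h l = k then 1 else 0) mw = degree_in l0 mw"
            using kv[OF mw] True l0 by (intro weight_cong) (auto simp: inj_on_def)
          then show "weight (\<lambda>l. if ?e h l = k then 1 else 0) mw = 1" using deg[OF mw] l0 by simp
        qed
        then have "restrict_keys (\<lambda>mw. \<forall>k\<in>P. degree_in k mw = 1) (rename (?e h) q) = rename (?e h) q"
          by (intro restrict_keys_all) (auto simp: homogeneous_def)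
        then show ?thesis using True by simp
      next
        case False
        then have "h ` P \<noteq> P" using P eq_card_imp_inj_on[of P h] by fastforce
        then obtain k where k: "k \<in> P" "k \<notin> h ` P" using hP by blast
        have "homogeneous (\<lambda>l. if l = k then 1 else 0) 0 (rename (?e h) q)"
          using k kv by (intro hom) (auto simp: weight_zero_iff)
        then have "restrict_keys (\<lambda>mw. \<forall>k\<in>P. degree_in k mw = 1) (rename (?e h) q) = 0"
        proof (intro restrict_keys_none notI)
          fix mw assume "mw \<in> keys (rename (?e h) q)" "\<forall>k\<in>P. degree_in k mw = 1"
          moreover have "degree_in k mw = 0" using calculation \<open>homogeneous _ 0 _\<close> by (simp add: homogeneous_def)
          ultimately show False using k(1) by (metis zero_neq_one)
        qed
        then show ?thesis using False by simp
      qed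
    qed
    also have "\<dots> = (\<Sum>h\<in>{h \<in> PiE P ?A. inj_on h P}. rename (?e h) q)"
      using P by (intro sum.inter_filter[symmetric] finite_PiE) auto
    also have "\<dots> = (\<Sum>\<tau>\<in>?Y. rename \<tau> q)"
    proof (rule sum.reindex_bij_witness[where i = "\<lambda>\<tau>. restrict \<tau> P" and j = ?e])
      fix h assume h: "h \<in> {h \<in> PiE P ?A. inj_on h P}"
      then have hP: "\<And>i. i \<in> P \<Longrightarrow> h i \<in> P \<and> f (h i) = f i" by (auto simp: PiE_def Pi_def)
      show "restrict (?e h) P = h" using h by (auto simp: fun_eq_iff PiE_def extensional_def)
      have "?e h permutes P"
        using h hP P by (intro inj_imp_permutes) (auto simp: inj_on_def)
      then show "?e h \<in> ?Y" using hP by auto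
    next
      fix \<tau> assume \<tau>: "\<tau> \<in> ?Y"
      then have p: "\<tau> permutes P" by simp
      show "?e (restrict \<tau> P) = \<tau>" using permutes_not_in[OF p] by (auto simp: fun_eq_iff)
      show "restrict \<tau> P \<in> {h \<in> PiE P ?A. inj_on h P}"
        using \<tau> permutes_in_image[OF p] permutes_inj_on[OF p] by (auto simp: inj_on_def)
    qed auto
    finally have "rename g (\<Sum>\<tau>\<in>?Y. rename \<tau> q) \<in> I" by (rule T_idealD(5)[OF I(1)])
    then show "(\<Sum>\<tau>\<in>?Y. G (g \<circ> \<tau>)) \<in> I"
      unfolding G_def ring_hom_sum[OF ring_hom_qsubst] rename_rename .
  qed
  \<comment> \<open>A field of characteristic zero contains the rationals, which act here through
    constants.\<close>
  have vs: "vector_space (\<lambda>r (v :: ('a, 'n) qpoly). single 0 (of_rat r) * v)"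
    by unfold_locales (auto simp: distrib_left distrib_right of_rat_add of_rat_mult single_add mult_single mult.assoc[symmetric])
  have "G id \<in> I"
    by (rule mem_if_alternators_and_symmetrizers_in[OF vs P T_idealD(1,2)[OF I(1)] _ alt sym permutes_id])
      (assumption | rule T_idealD(3)[OF I(1)])+
  then show ?thesis by (simp add: G_def)
qed

section \<open>Assembling a finite generating set\<close>

lemma trace_monomial_cong:
  assumes "finite P" "\<sigma> permutes P" "s \<in> P" "\<And>p. p \<in> P \<Longrightarrow> b p = b' p"
  shows "trace_monomial P s b \<sigma> = trace_monomial P s b' \<sigma>"
proof -
  have "wsubst b (cycle_from \<sigma> s) = wsubst b' (cycle_from \<sigma> s)"
    using assms cycle_from_props(3)[OF assms(1-3)] by (intro wsubst_cong) auto
  moreover have "perm_trace (P - set (cycle_from \<sigma> s)) (\<lambda>p. Phi (b p)) \<sigma> = perm_trace (P - set (cycle_from \<sigma> s)) (\<lambda>p. Phi (b' p)) \<sigma>"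
    using assms(4) by (intro perm_trace_cong) auto
  ultimately show ?thesis by (simp only: trace_monomial_def)
qed

text \<open>Rescaling any further variable leaves all trace monomials of the sum unchanged, so the
  degree in that variable is zero.\<close>

lemma qvars_cayley_hamilton: "qvars (cayley_hamilton :: ('a::field_char_0, 'n::finite) qpoly) \<subseteq> {..CARD('n)}"
proof
  fix k assume k: "k \<in> qvars (cayley_hamilton :: ('a, 'n) qpoly)"
  show "k \<in> {..CARD('n)}"
  proof (rule ccontr)
    assume nk: "k \<notin> {..CARD('n)}"
    have "homogeneous (\<lambda>l. if l = k then 1 else 0) 0 (cayley_hamilton :: ('a, 'n) qpoly)"
    proof (rule homogeneousI)
      fix t
      have "trace_monomial {..CARD('n)} 0 (\<lambda>p. qsubst (scale_vars (\<lambda>l. if l = k then 1 else 0) t) (var p)) \<tau>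
          = (trace_monomial {..CARD('n)} 0 var \<tau> :: ('a, 'n) qpoly)" if "\<tau> permutes {..CARD('n)}" for \<tau>
        using that nk by (intro trace_monomial_cong) (auto simp: scale_vars_def)
      then show "qsubst (scale_vars (\<lambda>l. if l = k then 1 else 0) t) (cayley_hamilton :: ('a, 'n) qpoly) = of_nat (t ^ 0) * cayley_hamilton"
        unfolding cayley_hamilton_def ring_hom_sum[OF ring_hom_qsubst] qsubst_simps(4) ring_hom_of_int[OF ring_hom_qsubst] qsubst_trace_monomial
        by (simp del: qsubst_var)
    qed
    then show False using k by (auto simp: qvars_eq homogeneous_def degree_in_zero_iff)
  qed
qed

lemma qvars_diff: "qvars (p - q) \<subseteq> qvars p \<union> qvars q"
  unfolding qvars_eq using Poly_Mapping.keys_diff[of p q] by blast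

lemma qvars_monomial_mult: "qvars (single (u, 0) c * q) \<subseteq> fst ` keys u \<union> qvars q"
proof
  fix k assume "k \<in> qvars (single (u, 0) c * q)"
  then obtain mw where "mw \<in> keys q" "k \<in> key_vars (u + fst mw, snd mw)"
    using lookup_monomial_mult(1)[of u c q] by (auto simp: qvars_eq)
  then show "k \<in> fst ` keys u \<union> qvars q"
    using Poly_Mapping.keys_add[of u "fst mw"] by (fastforce simp: qvars_eq key_vars_def)
qed

theorem mainTheorem19:
  shows "\<exists>S :: ('a::field_char_0, 'n::finite) qpoly set.
           finite S \<and> T_gen S = quasi_ids \<and>
           (\<forall>p\<in>S. card (qvars p) \<le> 2 * CARD('n)^2)"
proof -
  let ?N = "2 * CARD('n)^2" and ?L = "2 ^ CARD('n) - 1 :: nat"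
  \<comment> \<open>With variables and word lengths bounded, these quasi-identities lie in a module
    of finite rank over a polynomial ring in finitely many coordinates. Only the module structure
    enters here, not substitution.\<close>
  define Q where "Q = {q :: ('a, 'n) qpoly. q \<in> quasi_ids \<and> short_words ?L q \<and> qvars q \<subseteq> {..<?N}}"
  have "\<exists>S. finite S \<and> S \<subseteq> Q \<and> (\<forall>I. is_ideal I \<longrightarrow> S \<subseteq> I \<longrightarrow> Q \<subseteq> I)"
  proof (rule coefficient_submodule_finitely_generated[where V = "{..<?N} \<times> UNIV"
        and W = "Word ` {u. set u \<subseteq> {..<?N} \<and> length u \<le> ?L}"])
    show "finite ({..<?N} \<times> (UNIV :: ('n \<times> 'n) set))" by simp
    show "finite (Word ` {u. set u \<subseteq> {..<?N} \<and> length u \<le> ?L})"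
      by (intro finite_imageI finite_lists_length_le) simp
    fix q m w assume q: "q \<in> Q" "(m, w) \<in> keys q"
    then have kv: "key_vars (m, w) \<subseteq> {..<?N}" by (auto simp: Q_def qvars_eq)
    have "w = Word (unword w)" "set (unword w) \<subseteq> {..<?N}" "length (unword w) \<le> ?L"
      using q kv by (auto simp: Q_def short_words_def key_vars_def)
    then have "w \<in> Word ` {u. set u \<subseteq> {..<?N} \<and> length u \<le> ?L}" by blast
    moreover have "keys m \<subseteq> {..<?N} \<times> UNIV" using kv by (auto simp: key_vars_def)
    ultimately show "keys m \<subseteq> {..<?N} \<times> UNIV \<and> w \<in> Word ` {u. set u \<subseteq> {..<?N} \<and> length u \<le> ?L}" by simp
  next
    fix q q' :: "('a, 'n) qpoly" and u :: "'n cmon" and c :: 'a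
    assume q: "q \<in> Q" "q' \<in> Q" and u: "keys u \<subseteq> {..<?N} \<times> UNIV"
    let ?t = "single (u, 0) c * q'"
    have "q - ?t \<in> quasi_ids"
      using q by (intro T_idealD(7)[OF T_ideal_quasi_ids] T_idealD(3)[OF T_ideal_quasi_ids]) (auto simp: Q_def)
    moreover have "short_words ?L (q - ?t)"
      using q short_words_coeff_mult[of ?L q' u c] Poly_Mapping.keys_diff[of q ?t]
      unfolding Q_def short_words_def by blast
    moreover have "qvars (q - ?t) \<subseteq> {..<?N}"
      using qvars_diff[of q ?t] qvars_monomial_mult[of u c q'] q u unfolding Q_def by fastforce
    ultimately show "q - ?t \<in> Q" by (simp add: Q_def)
  qed
  then obtain S where S: "finite S" "S \<subseteq> Q" "\<And>I. is_ideal I \<Longrightarrow> S \<subseteq> I \<Longrightarrow> Q \<subseteq> I" by blast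
  \<comment> \<open>The Cayley-Hamilton polynomial joins the generators because both the shortening
    of words and the treatment of alternating letters take place modulo its T-ideal.\<close>
  define I where "I = T_gen (insert cayley_hamilton S)"
  have I: "T_ideal I" unfolding I_def by (rule T_ideal_T_gen)
  have sup: "insert cayley_hamilton S \<subseteq> I" unfolding I_def by (rule T_gen_superset)
  have sub: "I \<subseteq> quasi_ids"
    unfolding I_def using S(2) cayley_hamilton_quasi_id by (intro T_gen_least T_ideal_quasi_ids) (auto simp: Q_def)
  have ch: "cayley_hamilton \<in> I" and QI: "Q \<subseteq> I"
    using sup S(3)[of I] I by (auto simp: T_ideal_def)
  have small: "r \<in> I" if r: "r \<in> quasi_ids" "qvars r \<subseteq> {..<?N}" for r
  proof -
    obtain q where q: "short_words ?L q" "r - q \<in> I" using congruent_to_short_words[OF I ch, of r] by blast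
    \<comment> \<open>The short representative \<open>q\<close> may involve further variables.
      Setting these to \<open>0\<close> fixes \<open>r\<close> and keeps the words short.\<close>
    let ?\<rho> = "qsubst (\<lambda>k. if k \<in> {..<?N} then var k else 0) :: ('a, 'n) qpoly \<Rightarrow> _"
    have "r - (r - q) \<in> quasi_ids" using T_idealD(7)[OF T_ideal_quasi_ids r(1)] q(2) sub by blast
    then have "?\<rho> q \<in> quasi_ids" using T_idealD(5)[OF T_ideal_quasi_ids] by simp
    moreover have "short_words ?L (?\<rho> q)"
      using q(1) unfolding qsubst_restrict_vars short_words_def keys_restrict_keys by blast
    moreover have "qvars (?\<rho> q) \<subseteq> {..<?N}"
      unfolding qsubst_restrict_vars qvars_eq keys_restrict_keys by blast
    ultimately have "?\<rho> q \<in> I" using QI by (auto simp: Q_def)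
    then have "?\<rho> (r - q) + ?\<rho> q \<in> I" by (rule T_idealD(2)[OF I T_idealD(5)[OF I q(2)]])
    moreover have "?\<rho> (r - q) + ?\<rho> q = ?\<rho> r" by (simp add: qsubst_simps)
    moreover have "?\<rho> r = r"
      unfolding qsubst_restrict_vars using r(2) by (intro restrict_keys_all) (auto simp: qvars_eq)
    ultimately show ?thesis by simp
  qed
  have "quasi_ids \<subseteq> I"
    using multilinear_quasi_id_in[OF I ch small] by (intro quasi_ids_subset_if_multilinear[OF I]) blast
  with sub have eq: "T_gen (insert cayley_hamilton S) = quasi_ids" by (simp add: I_def)
  have card_small: "card (qvars p) \<le> ?N" if "qvars p \<subseteq> {..<?N}" for p :: "('a, 'n) qpoly"
    using card_mono[OF _ that] by simp
  \<comment> \<open>The Cayley-Hamilton polynomial has at most \<open>n + 1\<close> variables,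
    including the extra \<open>x_0\<close>, and \<open>n + 1\<close> is at most
    \<open>2 * n^2\<close> for positive \<open>n\<close>.\<close>
  have "{..CARD('n)} \<subseteq> {..<?N}"
  proof
    fix x assume "x \<in> {..CARD('n)}"
    moreover have "CARD('n) \<le> CARD('n)^2" "CARD('n)^2 > 0" by (simp_all add: power2_eq_square)
    ultimately show "x \<in> {..<?N}" unfolding lessThan_iff atMost_iff by linarith
  qed
  then have "card (qvars (cayley_hamilton :: ('a, 'n) qpoly)) \<le> ?N"
    using qvars_cayley_hamilton by (intro card_small) blast
  moreover have "card (qvars p) \<le> ?N" if "p \<in> S" for p
    using that S(2) by (intro card_small) (auto simp: Q_def)
  ultimately show ?thesis using S(1) eq by (intro exI[of _ "insert cayley_hamilton S"]) auto
qed

end
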